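(* Let $\Psi$ be an Orlicz function and $\phi\colon\mathbb D\to\mathbb D$ analytic. If either (i) $C_\phi\colon H^\Psi\to H^\Psi$ is compact, or (ii) $\Psi$ satisfies $\Delta^0$ and $C_\phi\colon H^\Psi\to H^\Psi$ is weakly compact, then $C_\phi\colon H^2\to H^2$ is compact.
   Context: An Orlicz function is a continuous, strictly convex, increasing $\Psi\colon[0,\infty)\to[0,\infty)$ with $\Psi(0)=0$ and $\Psi(x)/x\to\infty$. $H^\Psi$ is the space of analytic $f$ on $\mathbb D$ with $\sup_{r<1}\|f(re^{i\cdot})\|_{L^\Psi(\mathbb T)}<\infty$ (Luxemburg norm $\|g\|_\Psi=\inf\{C>0:\int_{\mathbb T}\Psi(|g|/C)\,dm\le1\}$), normed by the Luxemburg norm of its boundary function. $C_\phi f=f\circ\phi$. $\Delta^0$: there is $\beta>1$ with $\Psi(\beta x)/\Psi(x)\to\infty$ as $x\to\infty$. *)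

theory Defs
  imports "HOL-Complex_Analysis.Complex_Analysis"
begin

definition orlicz_function :: "(real \<Rightarrow> real) \<Rightarrow> bool" where
  "orlicz_function \<Psi> \<longleftrightarrow>
     continuous_on {0..} \<Psi> \<and>
     (\<forall>x\<ge>0. \<Psi> x \<ge> 0) \<and>
     (\<forall>x\<ge>0. \<forall>y\<ge>0. \<forall>t::real. x \<noteq> y \<and> 0 < t \<and> t < 1 \<longrightarrow>
        \<Psi> ((1 - t) * x + t * y) < (1 - t) * \<Psi> x + t * \<Psi> y) \<and>
     strict_mono_on {0..} \<Psi> \<and>
     \<Psi> 0 = 0 \<and>
     filterlim (\<lambda>x. \<Psi> x / x) at_top at_top"

definition delta0 :: "(real \<Rightarrow> real) \<Rightarrow> bool" where
  "delta0 \<Psi> \<longleftrightarrow> (\<exists>\<beta>>1. filterlim (\<lambda>x. \<Psi> (\<beta> * x) / \<Psi> x) at_top at_top)"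

definition orlicz_modular :: "(real \<Rightarrow> real) \<Rightarrow> (complex \<Rightarrow> complex) \<Rightarrow> real \<Rightarrow> ennreal" where
  "orlicz_modular \<Psi> g C =
     (\<integral>\<^sup>+ t. ennreal (\<Psi> (cmod (g (cis t)) / C)) * indicator {0..2*pi} t \<partial>lborel) / ennreal (2 * pi)"

text \<open>Luxemburg norm on the circle (value infinity if no admissible C).\<close>
definition luxemburg_norm :: "(real \<Rightarrow> real) \<Rightarrow> (complex \<Rightarrow> complex) \<Rightarrow> ereal" where
  "luxemburg_norm \<Psi> g = Inf {ereal C | C. C > 0 \<and> orlicz_modular \<Psi> g C \<le> 1}"

definition hardy_orlicz_enorm :: "(real \<Rightarrow> real) \<Rightarrow> (complex \<Rightarrow> complex) \<Rightarrow> ereal" where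
  "hardy_orlicz_enorm \<Psi> f = (SUP r\<in>{0..<1}. luxemburg_norm \<Psi> (\<lambda>z. f (complex_of_real r * z)))"

definition hardy_orlicz :: "(real \<Rightarrow> real) \<Rightarrow> (complex \<Rightarrow> complex) set" where
  "hardy_orlicz \<Psi> = {f. f holomorphic_on ball 0 1 \<and> hardy_orlicz_enorm \<Psi> f < \<infinity>}"

definition hardy_orlicz_norm :: "(real \<Rightarrow> real) \<Rightarrow> (complex \<Rightarrow> complex) \<Rightarrow> real" where
  "hardy_orlicz_norm \<Psi> f = real_of_ereal (hardy_orlicz_enorm \<Psi> f)"

definition ho_norm_topology :: "(real \<Rightarrow> real) \<Rightarrow> (complex \<Rightarrow> complex) topology" where
  "ho_norm_topology \<Psi> = topology_generated_by
     {{g \<in> hardy_orlicz \<Psi>. hardy_orlicz_norm \<Psi> (\<lambda>z. g z - f z) < r} | f r.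
        f \<in> hardy_orlicz \<Psi> \<and> r > 0}"

definition ho_dual :: "(real \<Rightarrow> real) \<Rightarrow> ((complex \<Rightarrow> complex) \<Rightarrow> complex) set" where
  "ho_dual \<Psi> = {L. (\<forall>f\<in>hardy_orlicz \<Psi>. \<forall>g\<in>hardy_orlicz \<Psi>. \<forall>a b::complex.
        L (\<lambda>z. a * f z + b * g z) = a * L f + b * L g) \<and>
      (\<exists>K. \<forall>f\<in>hardy_orlicz \<Psi>. cmod (L f) \<le> K * hardy_orlicz_norm \<Psi> f)}"

definition ho_weak_topology :: "(real \<Rightarrow> real) \<Rightarrow> (complex \<Rightarrow> complex) topology" where
  "ho_weak_topology \<Psi> = topology_generated_by
     {{f \<in> hardy_orlicz \<Psi>. L f \<in> U} | L U. L \<in> ho_dual \<Psi> \<and> open U}"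

definition ho_unit_ball :: "(real \<Rightarrow> real) \<Rightarrow> (complex \<Rightarrow> complex) set" where
  "ho_unit_ball \<Psi> = {f \<in> hardy_orlicz \<Psi>. hardy_orlicz_norm \<Psi> f \<le> 1}"

definition comp_op :: "(complex \<Rightarrow> complex) \<Rightarrow> (complex \<Rightarrow> complex) \<Rightarrow> (complex \<Rightarrow> complex)" where
  "comp_op \<phi> f = f \<circ> \<phi>"

definition comp_op_compact :: "(real \<Rightarrow> real) \<Rightarrow> (complex \<Rightarrow> complex) \<Rightarrow> bool" where
  "comp_op_compact \<Psi> \<phi> \<longleftrightarrow>
     comp_op \<phi> ` hardy_orlicz \<Psi> \<subseteq> hardy_orlicz \<Psi> \<and>
     (\<exists>K. compactin (ho_norm_topology \<Psi>) K \<and> comp_op \<phi> ` ho_unit_ball \<Psi> \<subseteq> K)"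

definition comp_op_weakly_compact :: "(real \<Rightarrow> real) \<Rightarrow> (complex \<Rightarrow> complex) \<Rightarrow> bool" where
  "comp_op_weakly_compact \<Psi> \<phi> \<longleftrightarrow>
     comp_op \<phi> ` hardy_orlicz \<Psi> \<subseteq> hardy_orlicz \<Psi> \<and>
     (\<exists>K. compactin (ho_weak_topology \<Psi>) K \<and> comp_op \<phi> ` ho_unit_ball \<Psi> \<subseteq> K)"

text \<open>H^2 is H^Psi with Psi x = x^2 (Luxemburg norm = L^2 norm).\<close>
abbreviation hardy2_sq :: "real \<Rightarrow> real" where "hardy2_sq \<equiv> (\<lambda>x. x ^ 2)"

end

(*
Only integrals over the circles |z| = r < 1 are used, never boundary values. For x in the disc put
h = 1 - |x| and bump_x(s) = h^2 / |1 - cnj x s|^2, so that 0 <= bump_x <= 1 and bump_x has mean at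
most h on each circle. If Psi(y) = 1/h, then the function (h / (1 - cnj x z))^2 times y lies in the
unit ball of H^Psi.

(1) Suppose that for some eta > 0 there are x arbitrarily near the circle such that bump_x o phi
exceeds eta on a set of measure more than eta h. Averaging over these sets gives functionals,
bounded on H^Psi, which are almost biorthogonal to a sparse sequence of composed peaks. This
contradicts norm compactness, because the composed peaks cannot be covered by finitely many small
balls. Under Delta^0 the partial sums of a sparse sequence of peaks stay bounded in H^Psi, and a
cluster point of the functionals, given by Tychonoff, contradicts weak compactness.

(2) So these level sets have measure at most eta h for x near the circle. Comparing the scales h
and 2h, this implies that the mean of bump_x o phi is o(h), which says that C_phi maps the
normalised reproducing kernels of H^2 to functions of norm tending to 0.

(3) A Carleson embedding theorem with reproducing kernels, proved by the Vinogradov-Senichkin test,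
and Montel's theorem then give compactness on H^2.
*)

theory Submission
  imports Defs
begin

section \<open>Normalised arc length and Hardy--Orlicz norms\<close>

text \<open>The conclusion no longer mentions \<open>\<Psi>\<close>, so step (1) has to end in a
  statement free of \<open>\<Psi>\<close>. Peaks have amplitude \<open>height h\<close>, the inverse
  of \<open>\<Psi>\<close> at \<open>1 / h\<close>; the functionals divide by
  \<open>height (\<eta> * h)\<close>. Since
  \<open>\<eta> * height (\<eta> * h) \<le> height h\<close> by convexity, the diagonal values stay
  above \<open>\<eta>\<^sup>2\<close> for every \<open>\<Psi>\<close>.

  Inner circles replace boundary values, so each estimate must be uniform in the radius. In
  exchange, \<open>\<phi>\<close> maps each circle into a smaller disc, and a peak close enough to
  the boundary is invisible to all functionals built before.

  In the weak case the composed partial sums imitate the vectors (1,...,1,0,0,...) of c0, a sequence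
  without weak cluster point. Pointwise limits of the functionals are taken along a filter, because
  the functionals act on an uncountable set and no convergent subsequence is at hand.

  Step (2) works since halving the distance to the circle multiplies a small bump by a factor well
  below 1/2. In step (3) the Szego kernel is too large to be compared with normalised reproducing
  kernels; adding the nonnegative contribution of the negative frequencies replaces it by the
  Poisson kernel.\<close>

definition circ :: "real measure" where
  "circ = uniform_measure lborel {0..2*pi}"

lemma sets_circ [simp, measurable_cong]: "sets circ = sets borel"
  by (simp add: circ_def)

lemma space_circ [simp]: "space circ = UNIV"
  by (simp add: circ_def)

lemma emeasure_circ_UNIV [simp]: "emeasure circ UNIV = 1"
  by (simp add: circ_def divide_ennreal)

lemma measure_circ_UNIV [simp]: "measure circ UNIV = 1"
  by (simp add: measure_def)

interpretation circ: finite_measure circ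
  by standard simp

lemma nn_integral_circ:
  assumes "f \<in> borel_measurable borel"
  shows "(\<integral>\<^sup>+t. f t \<partial>circ) = (\<integral>\<^sup>+t. f t * indicator {0..2*pi} t \<partial>lborel) / ennreal (2*pi)"
  unfolding circ_def using assms by (subst nn_integral_uniform_measure) auto

lemma AE_circ: "AE t in circ. t \<in> {0..2*pi}"
  unfolding circ_def by (rule AE_uniform_measureI) auto

text \<open>\<open>circ\<close> lives on the whole line but is carried by a compact interval, so a
  continuous function is bounded almost everywhere.\<close>

lemma integrable_circ_continuous:
  fixes F :: "real \<Rightarrow> 'b::{banach, second_countable_topology}"
  assumes "continuous_on UNIV F"
  shows "integrable circ F"
proof -
  have "compact (F ` {0..2*pi})"
    by (intro compact_continuous_image continuous_on_subset[OF assms]) auto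
  then obtain B where B: "\<And>t. t \<in> {0..2*pi} \<Longrightarrow> norm (F t) \<le> B"
    using compact_imp_bounded bounded_iff by (metis (no_types, lifting) image_eqI)
  show ?thesis
  proof (rule circ.integrable_const_bound)
    show "AE t in circ. norm (F t) \<le> B"
      using AE_circ by eventually_elim (rule B)
    show "F \<in> borel_measurable circ"
      using borel_measurable_continuous_onI[OF assms] by simp
  qed
qed

lemma continuous_on_circle:
  fixes f :: "complex \<Rightarrow> 'b::topological_space"
  assumes "continuous_on (ball 0 1) f" "0 \<le> r" "r < 1"
  shows "continuous_on UNIV (\<lambda>t. f (complex_of_real r * cis t))"
  by (rule continuous_on_compose2[OF assms(1)])
     (use assms in \<open>auto intro!: continuous_intros simp: norm_mult\<close>)

text \<open>Taking all real angles, and not only \<open>{0..2*pi}\<close>, makes later bounds on a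
  circle hold for every \<open>t\<close> instead of almost every \<open>t\<close>.\<close>

lemma circle_compact: "compact (range (\<lambda>t. complex_of_real r * cis t))"
proof -
  have "range (\<lambda>t. complex_of_real r * cis t) = (\<lambda>t. complex_of_real r * cis t) ` {0..2*pi}"
  proof safe
    fix t :: real
    have *: "cis t = cis (2*pi * frac (t / (2*pi)))"
    proof -
      have "t = 2*pi * frac (t / (2*pi)) + 2*pi * of_int \<lfloor>t / (2*pi)\<rfloor>"
        by (simp add: frac_def algebra_simps)
      then have "cis t = cis (2*pi * frac (t / (2*pi))) * cis (2*pi * of_int \<lfloor>t / (2*pi)\<rfloor>)"
        by (metis cis_mult)
      then show ?thesis by (simp add: cis_multiple_2pi)
    qed
    show "complex_of_real r * cis t \<in> (\<lambda>t. complex_of_real r * cis t) ` {0..2*pi}"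
      by (rule image_eqI[of _ _ "2*pi * frac (t / (2*pi))"])
         (use * frac_lt_1[of "t / (2*pi)"] in \<open>auto simp: frac_ge_0\<close>)
  qed auto
  also have "compact \<dots>"
    by (intro compact_continuous_image continuous_intros) auto
  finally show ?thesis .
qed

lemma circle_in_ball: "0 \<le> r \<Longrightarrow> r < 1 \<Longrightarrow> complex_of_real r * cis t \<in> ball 0 1"
  by (simp add: norm_mult)

text \<open>A circle is compact, so its image stays away from the boundary. This margin gives
  dominated convergence of power series along the image, the finiteness condition of the kernel
  test, and the separation of new peaks from old circles.\<close>

lemma circle_image_cball:
  assumes "continuous_on (ball 0 1) \<phi>" "\<phi> ` ball 0 1 \<subseteq> ball (0::complex) 1" "0 \<le> r" "r < 1"
  obtains R where "0 \<le> R" "R < 1" "\<And>t. cmod (\<phi> (complex_of_real r * cis t)) \<le> R"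
proof -
  let ?S = "range (\<lambda>t. complex_of_real r * cis t)"
  have S: "?S \<subseteq> ball 0 1"
    using circle_in_ball assms by blast
  have "compact ((\<lambda>z. cmod (\<phi> z)) ` ?S)"
    by (intro compact_continuous_image circle_compact continuous_intros continuous_on_subset[OF assms(1) S])
  then obtain m where "m \<in> (\<lambda>z. cmod (\<phi> z)) ` ?S" and m: "\<And>x. x \<in> (\<lambda>z. cmod (\<phi> z)) ` ?S \<Longrightarrow> x \<le> m"
    using compact_attains_sup[of "(\<lambda>z. cmod (\<phi> z)) ` ?S"] by auto
  then obtain z where z: "z \<in> ?S" "m = cmod (\<phi> z)" by auto
  then have "m < 1" "0 \<le> m" using S assms(2) by (auto simp: image_subset_iff)
  with m that show ?thesis by blast
qed

section \<open>Orlicz functions and the Hardy-Orlicz norm\<close>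

locale orlicz =
  fixes \<Psi> :: "real \<Rightarrow> real"
  assumes orlicz: "orlicz_function \<Psi>"
begin

lemma zero [simp]: "\<Psi> 0 = 0"
  and nonneg: "x \<ge> 0 \<Longrightarrow> \<Psi> x \<ge> 0"
  and cont: "continuous_on {0..} \<Psi>"
  and strict: "0 \<le> x \<Longrightarrow> x < y \<Longrightarrow> \<Psi> x < \<Psi> y"
  and superlinear: "filterlim (\<lambda>x. \<Psi> x / x) at_top at_top"
  using orlicz unfolding orlicz_function_def strict_mono_on_def by auto

lemma mono: "0 \<le> x \<Longrightarrow> x \<le> y \<Longrightarrow> \<Psi> x \<le> \<Psi> y"
  using strict[of x y] by (cases "x = y") auto

lemma pos: "x > 0 \<Longrightarrow> \<Psi> x > 0"
  using strict[of 0 x] by simp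

lemma convex_ineq:
  assumes "x \<ge> 0" "y \<ge> 0" "0 \<le> t" "t \<le> 1"
  shows "\<Psi> ((1 - t) * x + t * y) \<le> (1 - t) * \<Psi> x + t * \<Psi> y"
proof (cases "x = y \<or> t = 0 \<or> t = 1")
  case True
  then show ?thesis by (auto simp: algebra_simps)
next
  case False
  then show ?thesis
    using orlicz assms unfolding orlicz_function_def by (simp add: less_imp_le)
qed

lemma scale_le: "0 \<le> t \<Longrightarrow> t \<le> 1 \<Longrightarrow> x \<ge> 0 \<Longrightarrow> \<Psi> (t * x) \<le> t * \<Psi> x"
  using convex_ineq[of 0 x t] by simp

lemma continuous_on_comp:
  assumes "continuous_on S u" "\<And>t. t \<in> S \<Longrightarrow> u t \<ge> 0"
  shows "continuous_on S (\<lambda>t. \<Psi> (u t))"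
  by (rule continuous_on_compose2[OF cont assms(1)]) (use assms in auto)

lemma continuous_on_modular:
  assumes "f holomorphic_on ball 0 1" "0 \<le> r" "r < 1" "C > 0"
  shows "continuous_on UNIV (\<lambda>t. \<Psi> (cmod (f (complex_of_real r * cis t)) / C))"
  using assms
  by (intro continuous_on_comp continuous_intros continuous_on_circle holomorphic_on_imp_continuous_on) auto

lemma orlicz_modular_eq:
  assumes "f holomorphic_on ball 0 1" "0 \<le> r" "r < 1" "C > 0"
  shows "orlicz_modular \<Psi> (\<lambda>z. f (complex_of_real r * z)) C =
         ennreal (\<integral>t. \<Psi> (cmod (f (complex_of_real r * cis t)) / C) \<partial>circ)"
proof -
  note c = continuous_on_modular[OF assms]
  have "orlicz_modular \<Psi> (\<lambda>z. f (complex_of_real r * z)) C =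
        (\<integral>\<^sup>+t. ennreal (\<Psi> (cmod (f (complex_of_real r * cis t)) / C)) \<partial>circ)"
    unfolding orlicz_modular_def
    by (rule nn_integral_circ[symmetric]) (use borel_measurable_continuous_onI[OF c] in simp)
  also have "\<dots> = ennreal (\<integral>t. \<Psi> (cmod (f (complex_of_real r * cis t)) / C) \<partial>circ)"
    by (rule nn_integral_eq_integral) (use c assms in \<open>auto intro!: integrable_circ_continuous nonneg\<close>)
  finally show ?thesis .
qed

lemma luxemburg_nonneg: "luxemburg_norm \<Psi> g \<ge> 0"
  unfolding luxemburg_norm_def by (rule Inf_greatest) auto

lemma enorm_nonneg: "hardy_orlicz_enorm \<Psi> f \<ge> 0"
  unfolding hardy_orlicz_enorm_def
  by (rule SUP_upper2[of 0]) (auto intro: luxemburg_nonneg)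

lemma ereal_norm: "f \<in> hardy_orlicz \<Psi> \<Longrightarrow> ereal (hardy_orlicz_norm \<Psi> f) = hardy_orlicz_enorm \<Psi> f"
  unfolding hardy_orlicz_norm_def hardy_orlicz_def
  using enorm_nonneg[of f] by (auto simp: ereal_real)

lemma norm_nonneg: "hardy_orlicz_norm \<Psi> f \<ge> 0"
  unfolding hardy_orlicz_norm_def using enorm_nonneg[of f] by (simp add: real_of_ereal_pos)

lemma hardy_holo: "f \<in> hardy_orlicz \<Psi> \<Longrightarrow> f holomorphic_on ball 0 1"
  by (simp add: hardy_orlicz_def)

lemma hardy_normI:
  assumes "f holomorphic_on ball 0 1" "C > 0"
    and "\<And>r. 0 \<le> r \<Longrightarrow> r < 1 \<Longrightarrow> (\<integral>t. \<Psi> (cmod (f (complex_of_real r * cis t)) / C) \<partial>circ) \<le> 1"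
  shows "f \<in> hardy_orlicz \<Psi>" "hardy_orlicz_norm \<Psi> f \<le> C"
proof -
  have *: "hardy_orlicz_enorm \<Psi> f \<le> ereal C"
    unfolding hardy_orlicz_enorm_def
  proof (rule SUP_least)
    fix r :: real assume r: "r \<in> {0..<1}"
    then have "orlicz_modular \<Psi> (\<lambda>z. f (complex_of_real r * z)) C \<le> 1"
      using assms by (subst orlicz_modular_eq) auto
    then show "luxemburg_norm \<Psi> (\<lambda>z. f (complex_of_real r * z)) \<le> ereal C"
      unfolding luxemburg_norm_def using assms(2) by (intro Inf_lower) auto
  qed
  then show 1: "f \<in> hardy_orlicz \<Psi>"
    using assms(1) unfolding hardy_orlicz_def by (auto simp: less_top[symmetric] top_ereal_def)
  show "hardy_orlicz_norm \<Psi> f \<le> C"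
    using * ereal_norm[OF 1] by (metis ereal_less_eq(3))
qed

text \<open>With a strict inequality the infimum provides an admissible constant below
  \<open>C\<close>, whether or not it is attained; monotonicity of \<open>\<Psi>\<close> passes the
  bound on to \<open>C\<close>.\<close>

lemma modular_le_1:
  assumes f: "f \<in> hardy_orlicz \<Psi>" and C: "C > hardy_orlicz_norm \<Psi> f" and r: "0 \<le> r" "r < 1"
  shows "(\<integral>t. \<Psi> (cmod (f (complex_of_real r * cis t)) / C) \<partial>circ) \<le> 1"
proof -
  note h = hardy_holo[OF f]
  have C0: "C > 0" using C norm_nonneg[of f] by linarith
  have "luxemburg_norm \<Psi> (\<lambda>z. f (complex_of_real r * z)) \<le> hardy_orlicz_enorm \<Psi> f"
    unfolding hardy_orlicz_enorm_def by (rule SUP_upper) (use r in auto)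
  also have "\<dots> < ereal C" using C ereal_norm[OF f] by (metis ereal_less_eq(3) not_le)
  finally obtain D where D: "D > 0" "orlicz_modular \<Psi> (\<lambda>z. f (complex_of_real r * z)) D \<le> 1" "D < C"
    unfolding luxemburg_norm_def by (auto simp: Inf_less_iff)
  have "ennreal (\<integral>t. \<Psi> (cmod (f (complex_of_real r * cis t)) / D) \<partial>circ) \<le> 1"
    using D orlicz_modular_eq[OF h r D(1)] by simp
  then have "(\<integral>t. \<Psi> (cmod (f (complex_of_real r * cis t)) / D) \<partial>circ) \<le> 1"
    by simp
  moreover have "(\<integral>t. \<Psi> (cmod (f (complex_of_real r * cis t)) / C) \<partial>circ)
      \<le> (\<integral>t. \<Psi> (cmod (f (complex_of_real r * cis t)) / D) \<partial>circ)"
    using D C0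
    by (intro integral_mono integrable_circ_continuous continuous_on_modular h r mono)
       (auto intro!: divide_left_mono)
  ultimately show ?thesis by linarith
qed

lemma hardy_add:
  assumes f: "f \<in> hardy_orlicz \<Psi>" and g: "g \<in> hardy_orlicz \<Psi>"
  shows "(\<lambda>z. f z + g z) \<in> hardy_orlicz \<Psi>"
    and "hardy_orlicz_norm \<Psi> (\<lambda>z. f z + g z) \<le> hardy_orlicz_norm \<Psi> f + hardy_orlicz_norm \<Psi> g"
proof -
  have hol: "(\<lambda>z. f z + g z) holomorphic_on ball 0 1"
    using f g by (intro holomorphic_intros hardy_holo)
  have *: "(\<integral>t. \<Psi> (cmod (f (of_real r * cis t) + g (of_real r * cis t)) / (A + B)) \<partial>circ) \<le> 1"
    if A: "A > hardy_orlicz_norm \<Psi> f" and B: "B > hardy_orlicz_norm \<Psi> g" and r: "0 \<le> r" "r < 1" for A B r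
  proof -
    have A0: "A > 0" and B0: "B > 0" using A B norm_nonneg[of f] norm_nonneg[of g] by linarith+
    \<comment> \<open>With weights \<open>A / (A + B)\<close> and \<open>B / (A + B)\<close> the
      scaled sum is a convex combination of the two normalised functions.\<close>
    define s where "s = B / (A + B)"
    have s: "0 \<le> s" "s \<le> 1" "1 - s = A / (A + B)" using A0 B0 by (auto simp: s_def field_simps)
    have pt: "\<Psi> (cmod (a + b) / (A + B)) \<le> (1 - s) * \<Psi> (cmod a / A) + s * \<Psi> (cmod b / B)" for a b
    proof -
      have "\<Psi> (cmod (a + b) / (A + B)) \<le> \<Psi> ((1 - s) * (cmod a / A) + s * (cmod b / B))"
        unfolding s(3) unfolding s_def using A0 B0 norm_triangle_ineq[of a b]
        by (intro mono) (auto simp: add_divide_distrib[symmetric] intro!: divide_right_mono)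
      also have "\<dots> \<le> (1 - s) * \<Psi> (cmod a / A) + s * \<Psi> (cmod b / B)"
        by (rule convex_ineq) (use A0 B0 s in auto)
      finally show ?thesis .
    qed
    let ?F = "\<lambda>t. \<Psi> (cmod (f (of_real r * cis t)) / A)" and ?G = "\<lambda>t. \<Psi> (cmod (g (of_real r * cis t)) / B)"
    have i: "integrable circ ?F" "integrable circ ?G"
      using A0 B0 r f g by (auto intro!: integrable_circ_continuous continuous_on_modular hardy_holo)
    have "(\<integral>t. \<Psi> (cmod (f (of_real r * cis t) + g (of_real r * cis t)) / (A + B)) \<partial>circ)
        \<le> (\<integral>t. (1 - s) * ?F t + s * ?G t \<partial>circ)"
    proof (rule integral_mono)
      show "integrable circ (\<lambda>t. \<Psi> (cmod (f (of_real r * cis t) + g (of_real r * cis t)) / (A + B)))"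
        using A0 B0 r by (intro integrable_circ_continuous continuous_on_modular[OF hol]) auto
    qed (use i pt in auto)
    also have "\<dots> = (1 - s) * (\<integral>t. ?F t \<partial>circ) + s * (\<integral>t. ?G t \<partial>circ)"
      using i by simp
    also have "\<dots> \<le> (1 - s) * 1 + s * 1"
      by (intro add_mono mult_left_mono modular_le_1 f g A B r) (use s in auto)
    finally show ?thesis by simp
  qed
  have n: "(\<lambda>z. f z + g z) \<in> hardy_orlicz \<Psi>"
     "hardy_orlicz_norm \<Psi> (\<lambda>z. f z + g z) \<le> hardy_orlicz_norm \<Psi> f + hardy_orlicz_norm \<Psi> g + e"
    if "e > 0" for e
  proof -
    have "(hardy_orlicz_norm \<Psi> f + e/2) + (hardy_orlicz_norm \<Psi> g + e/2) > 0"
      using that norm_nonneg[of f] norm_nonneg[of g] by linarith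
    then have "(\<lambda>z. f z + g z) \<in> hardy_orlicz \<Psi> \<and>
       hardy_orlicz_norm \<Psi> (\<lambda>z. f z + g z) \<le> (hardy_orlicz_norm \<Psi> f + e/2) + (hardy_orlicz_norm \<Psi> g + e/2)"
      using that
      by (intro conjI hardy_normI[OF hol, of "(hardy_orlicz_norm \<Psi> f + e/2) + (hardy_orlicz_norm \<Psi> g + e/2)"] *)
         linarith+
    then show "(\<lambda>z. f z + g z) \<in> hardy_orlicz \<Psi>"
     "hardy_orlicz_norm \<Psi> (\<lambda>z. f z + g z) \<le> hardy_orlicz_norm \<Psi> f + hardy_orlicz_norm \<Psi> g + e" by auto
  qed
  show "(\<lambda>z. f z + g z) \<in> hardy_orlicz \<Psi>" using n(1)[of 1] by simp
  show "hardy_orlicz_norm \<Psi> (\<lambda>z. f z + g z) \<le> hardy_orlicz_norm \<Psi> f + hardy_orlicz_norm \<Psi> g"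
    by (rule field_le_epsilon) (rule n(2))
qed

lemma hardy_zero: "(\<lambda>z. 0) \<in> hardy_orlicz \<Psi>" and norm_zero: "hardy_orlicz_norm \<Psi> (\<lambda>z. 0) = 0"
proof -
  have *: "(\<lambda>z. 0) \<in> hardy_orlicz \<Psi>" "hardy_orlicz_norm \<Psi> (\<lambda>z. 0) \<le> C" if "C > 0" for C
    using hardy_normI[of "\<lambda>z. 0" C] that by auto
  show "(\<lambda>z. 0) \<in> hardy_orlicz \<Psi>" using *(1)[of 1] by simp
  show "hardy_orlicz_norm \<Psi> (\<lambda>z. 0) = 0"
    using norm_nonneg[of "\<lambda>z. 0"] field_le_epsilon[of "hardy_orlicz_norm \<Psi> (\<lambda>z. 0)" 0] *(2) by force
qed

lemma hardy_cmult:
  assumes f: "f \<in> hardy_orlicz \<Psi>"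
  shows "(\<lambda>z. c * f z) \<in> hardy_orlicz \<Psi>"
    and "hardy_orlicz_norm \<Psi> (\<lambda>z. c * f z) \<le> cmod c * hardy_orlicz_norm \<Psi> f"
proof -
  have hol: "(\<lambda>z. c * f z) holomorphic_on ball 0 1"
    using f by (intro holomorphic_intros hardy_holo)
  have "(\<lambda>z. c * f z) \<in> hardy_orlicz \<Psi> \<and> hardy_orlicz_norm \<Psi> (\<lambda>z. c * f z) \<le> cmod c * hardy_orlicz_norm \<Psi> f"
  proof (cases "c = 0")
    case True then show ?thesis using hardy_zero norm_zero by simp
  next
    case False
    have n: "(\<lambda>z. c * f z) \<in> hardy_orlicz \<Psi> \<and> hardy_orlicz_norm \<Psi> (\<lambda>z. c * f z) \<le> cmod c * (hardy_orlicz_norm \<Psi> f + e)"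
      if "e > 0" for e
    proof -
      have "hardy_orlicz_norm \<Psi> f + e > 0" using that norm_nonneg[of f] by linarith
      then show ?thesis
        using that False modular_le_1[OF f, of "hardy_orlicz_norm \<Psi> f + e"]
        by (intro conjI hardy_normI[OF hol, of "cmod c * (hardy_orlicz_norm \<Psi> f + e)"]) (auto simp: norm_mult)
    qed
    have "hardy_orlicz_norm \<Psi> (\<lambda>z. c * f z) \<le> cmod c * hardy_orlicz_norm \<Psi> f"
    proof (rule field_le_epsilon)
      fix e :: real assume "e > 0"
      then show "hardy_orlicz_norm \<Psi> (\<lambda>z. c * f z) \<le> cmod c * hardy_orlicz_norm \<Psi> f + e"
        using n[of "e / cmod c"] False by (auto simp: algebra_simps)
    qed
    with n[of 1] show ?thesis by simp
  qed
  then show "(\<lambda>z. c * f z) \<in> hardy_orlicz \<Psi>" 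
     "hardy_orlicz_norm \<Psi> (\<lambda>z. c * f z) \<le> cmod c * hardy_orlicz_norm \<Psi> f" by auto
qed

lemma hardy_diff:
  assumes f: "f \<in> hardy_orlicz \<Psi>" and g: "g \<in> hardy_orlicz \<Psi>"
  shows "(\<lambda>z. f z - g z) \<in> hardy_orlicz \<Psi>"
  using hardy_add(1)[OF f hardy_cmult(1)[OF g, of "-1"]] by simp

text \<open>Members of \<open>hardy_orlicz\<close> are functions on the whole plane with arbitrary
  values outside the disc, so the norm is only a seminorm on them.\<close>

lemma hardy_norm_cong:
  assumes "\<And>z. z \<in> ball 0 1 \<Longrightarrow> f z = g z"
  shows "hardy_orlicz_enorm \<Psi> f = hardy_orlicz_enorm \<Psi> g"
    and "hardy_orlicz_norm \<Psi> f = hardy_orlicz_norm \<Psi> g"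
    and "f \<in> hardy_orlicz \<Psi> \<longleftrightarrow> g \<in> hardy_orlicz \<Psi>"
proof -
  show 1: "hardy_orlicz_enorm \<Psi> f = hardy_orlicz_enorm \<Psi> g"
    unfolding hardy_orlicz_enorm_def luxemburg_norm_def orlicz_modular_def
    by (intro SUP_cong refl) (use assms circle_in_ball in auto)
  then show "hardy_orlicz_norm \<Psi> f = hardy_orlicz_norm \<Psi> g"
    by (simp add: hardy_orlicz_norm_def)
  show "f \<in> hardy_orlicz \<Psi> \<longleftrightarrow> g \<in> hardy_orlicz \<Psi>"
    unfolding hardy_orlicz_def using 1 holomorphic_cong[of "ball 0 1" "ball 0 1" f g] assms by simp
qed

end

section \<open>Parseval on circles\<close>

lemma borel_measurable_circ_iff: "f \<in> borel_measurable circ \<longleftrightarrow> f \<in> borel_measurable borel"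
  by (rule arg_cong2[where f = "(\<in>)"] refl measurable_cong_sets sets_circ)+

lemma integral_circ:
  fixes f :: "real \<Rightarrow> complex"
  assumes "continuous_on UNIV f"
  shows "(\<integral>t. f t \<partial>circ) = integral {0..2*pi} f / (2*pi)"
proof -
  have c: "continuous_on {0..2*pi} f" by (rule continuous_on_subset[OF assms]) auto
  have m [measurable]: "f \<in> borel_measurable borel"
    by (rule borel_measurable_continuous_onI[OF assms])
  have e: "indicator {0..2*pi} x / emeasure lborel {0..2*pi} = ennreal (indicator {0..2*pi} x / (2*pi))" for x
    by (auto split: split_indicator simp: divide_ennreal ennreal_1[symmetric] simp del: ennreal_1)
  have "(\<integral>t. f t \<partial>circ) = (\<integral>t. (indicator {0..2*pi} t / (2*pi)) *\<^sub>R f t \<partial>lborel)"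
    unfolding circ_def uniform_measure_def e
    by (rule integral_density) auto
  also have "\<dots> = (\<integral>t. (1 / (2*pi)) *\<^sub>R (indicator {0..2*pi} t *\<^sub>R f t) \<partial>lborel)"
    by (intro Bochner_Integration.integral_cong) auto
  also have "\<dots> = (1 / (2*pi)) *\<^sub>R (LINT t:{0..2*pi}|lborel. f t)"
    unfolding set_lebesgue_integral_def by (rule integral_scaleR_right)
  also have "(LINT t:{0..2*pi}|lborel. f t) = integral {0..2*pi} f"
    by (rule set_borel_integral_eq_integral) (rule borel_integrable_atLeastAtMost'[OF c])
  finally show ?thesis by (simp add: scaleR_conv_of_real)
qed

lemma integral_circ_cis_power:
  "(\<integral>t. cis t ^ m * cnj (cis t) ^ n \<partial>circ) = (if m = n then 1 else 0)"
proof (cases "m = n")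
  case True
  have "cis t ^ m * cnj (cis t) ^ n = 1" for t
    using True by (simp add: power_mult_distrib[symmetric] cis_cnj cis_mult)
  then show ?thesis using True by simp
next
  case False
  define k :: complex where "k = of_nat m - of_nat n"
  have k: "k \<noteq> 0" using False by (simp add: k_def)
  have e: "cis t ^ m * cnj (cis t) ^ n = exp (\<i> * k * of_real t)" for t
  proof -
    have "cis t ^ m * cnj (cis t) ^ n = exp (of_nat m * (\<i> * of_real t)) * exp (of_nat n * (\<i> * of_real (- t)))"
      unfolding cis_cnj unfolding cis_conv_exp exp_of_nat_mult ..
    then show ?thesis by (simp add: exp_add[symmetric] k_def algebra_simps)
  qed
  have d: "((\<lambda>t. exp (\<i> * k * of_real t) / (\<i> * k)) has_vector_derivative exp (\<i> * k * of_real t)) (at t within {0..2*pi})" for t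
  proof -
    have "((\<lambda>z. exp (\<i> * k * z) / (\<i> * k)) has_field_derivative exp (\<i> * k * of_real t)) (at (of_real t))"
      using k by (auto intro!: derivative_eq_intros)
    from has_vector_derivative_real_field[OF this] show ?thesis .
  qed
  have "integral {0..2*pi} (\<lambda>t. exp (\<i> * k * of_real t)) = exp (\<i> * k * of_real (2*pi)) / (\<i> * k) - exp (\<i> * k * of_real 0) / (\<i> * k)"
    by (rule integral_unique, rule fundamental_theorem_of_calculus) (use d in auto)
  also have "exp (\<i> * k * of_real (2*pi)) = 1"
  proof -
    have "\<i> * k * of_real (2*pi) = of_int (2 * (int m - int n)) * (of_real pi * \<i>)" by (simp add: k_def)
    also have "exp \<dots> = 1" using exp_integer_2pi[of "of_int (int m - int n)"] by (simp add: mult_ac)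
    finally show ?thesis .
  qed
  finally show ?thesis using False unfolding e
    by (subst integral_circ) (auto intro!: continuous_intros)
qed

lemma circle_mean_square_poly:
  fixes a :: "nat \<Rightarrow> complex"
  shows "(\<integral>t. (cmod (\<Sum>n<N. a n * (of_real r * cis t) ^ n))\<^sup>2 \<partial>circ) = (\<Sum>n<N. (cmod (a n))\<^sup>2 * r ^ (2*n))"
proof -
  have i: "integrable circ (\<lambda>t. c * (cis t ^ m * cnj (cis t) ^ n))" for c m n
    by (intro integrable_circ_continuous continuous_intros)
  have "complex_of_real (\<integral>t. (cmod (\<Sum>n<N. a n * (of_real r * cis t) ^ n))\<^sup>2 \<partial>circ)
     = (\<integral>t. complex_of_real ((cmod (\<Sum>n<N. a n * (of_real r * cis t) ^ n))\<^sup>2) \<partial>circ)"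
    by (rule integral_complex_of_real[symmetric])
  also have "\<dots> = (\<integral>t. (\<Sum>m<N. \<Sum>n<N. (a m * of_real r ^ m * cnj (a n * of_real r ^ n)) * (cis t ^ m * cnj (cis t) ^ n)) \<partial>circ)"
    unfolding complex_norm_square cnj_sum sum_product
    by (intro Bochner_Integration.integral_cong refl sum.cong) (auto simp: power_mult_distrib)
  also have "\<dots> = (\<Sum>m<N. \<Sum>n<N. (a m * of_real r ^ m * cnj (a n * of_real r ^ n)) * (if m = n then 1 else 0))"
    using i by (simp add: Bochner_Integration.integral_sum integral_circ_cis_power)
  also have "\<dots> = (\<Sum>m<N. a m * of_real r ^ m * cnj (a m * of_real r ^ m))"
    by (intro sum.cong refl) (simp add: if_distrib[of "\<lambda>x. _ * x"] sum.delta' cong: if_cong)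
  also have "\<dots> = (\<Sum>n<N. of_real ((cmod (a n * of_real r ^ n))\<^sup>2))"
    unfolding complex_norm_square ..
  also have "\<dots> = of_real (\<Sum>n<N. (cmod (a n))\<^sup>2 * r ^ (2*n))"
    by (simp add: norm_mult norm_power power_mult_distrib power_mult[symmetric] mult.commute power_even_abs)
  finally show ?thesis using of_real_eq_iff by blast
qed

lemma Parseval_circle:
  fixes a :: "nat \<Rightarrow> complex"
  assumes f: "\<And>z. z \<in> ball 0 1 \<Longrightarrow> (\<lambda>n. a n * z ^ n) sums f z" and r: "0 \<le> r" "r < 1"
  shows "(\<lambda>n. (cmod (a n))\<^sup>2 * r ^ (2*n)) sums (\<integral>t. (cmod (f (of_real r * cis t)))\<^sup>2 \<partial>circ)"
proof -
  have s: "summable (\<lambda>n. norm (a n) * r ^ n)"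
  proof -
    obtain R where R: "r < R" "R < 1" using r dense by blast
    have "summable (\<lambda>n. a n * of_real R ^ n)"
      using f[of "of_real R"] R r by (auto simp: sums_iff)
    then have "summable (\<lambda>n. norm (a n * of_real r ^ n))"
      by (rule powser_insidea) (use r R in auto)
    then show ?thesis using r by (simp add: norm_mult norm_power)
  qed
  define B where "B = (\<Sum>n. norm (a n) * r ^ n)"
  let ?p = "\<lambda>N t. \<Sum>n<N. a n * (of_real r * cis t) ^ n"
  have "(\<lambda>N. \<integral>t. (cmod (?p N t))\<^sup>2 \<partial>circ) \<longlonglongrightarrow> (\<integral>t. (cmod (f (of_real r * cis t)))\<^sup>2 \<partial>circ)"
  proof (rule integral_dominated_convergence[where w = "\<lambda>_. B\<^sup>2"])
    have l: "(\<lambda>N. (cmod (?p N t))\<^sup>2) \<longlonglongrightarrow> (cmod (f (of_real r * cis t)))\<^sup>2" for t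
      using f[OF circle_in_ball[OF r]] unfolding sums_def by (intro tendsto_intros)
    then show "AE t in circ. (\<lambda>N. (cmod (?p N t))\<^sup>2) \<longlonglongrightarrow> (cmod (f (of_real r * cis t)))\<^sup>2" by simp
    show m: "(\<lambda>t. (cmod (?p N t))\<^sup>2) \<in> borel_measurable circ" for N
      unfolding borel_measurable_circ_iff by (intro borel_measurable_continuous_onI continuous_intros)
    show "(\<lambda>t. (cmod (f (of_real r * cis t)))\<^sup>2) \<in> borel_measurable circ"
      by (rule borel_measurable_LIMSEQ_real[OF l m])
    have "cmod (?p N t) \<le> B" for N t
    proof -
      have "cmod (?p N t) \<le> (\<Sum>n<N. norm (a n) * r ^ n)"
        using r by (intro order_trans[OF norm_sum]) (auto simp: norm_mult norm_power)
      also have "\<dots> \<le> B" unfolding B_def using r by (intro sum_le_suminf s) auto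
      finally show ?thesis .
    qed
    then show "AE t in circ. norm ((cmod (?p N t))\<^sup>2) \<le> B\<^sup>2" for N
      by (simp add: power_mono)
    show "integrable circ (\<lambda>_. B\<^sup>2)" by (intro integrable_circ_continuous continuous_intros)
  qed
  then show ?thesis unfolding sums_def circle_mean_square_poly .
qed

section \<open>The Carleson embedding theorem\<close>

text \<open>Passing from \<open>x\<close> to \<open>t\<close> through \<open>s\<close> leaves a
  correction of size at most \<open>1 - (cmod s)\<^sup>2\<close>, hence at most
  \<open>2 * (1 - cmod s)\<close>. Both distances to \<open>s\<close> are at least
  \<open>1 - cmod s\<close>, so the correction is at most their sum. The distance is thus at most
  twice the sum, and squaring produces 8.\<close>

lemma quasi_triangle:
  fixes s x t :: complex
  assumes "cmod s < 1" "cmod x < 1" "cmod t < 1"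
  shows "(cmod (1 - cnj x * t))\<^sup>2 \<le> 8 * ((cmod (1 - cnj x * s))\<^sup>2 + (cmod (1 - cnj s * t))\<^sup>2)"
proof -
  let ?a = "cmod (1 - cnj x * s)" and ?b = "cmod (1 - cnj s * t)"
  have 0: "1 - (cmod s)\<^sup>2 = (1 - cmod s) * (1 + cmod s)" by (simp add: power2_eq_square algebra_simps)
  have 1: "1 - (cmod s)\<^sup>2 \<le> 2 * (1 - cmod s)"
    unfolding 0 using assms mult_left_mono[of "1 + cmod s" 2 "1 - cmod s"] by (simp add: mult.commute)
  have "cmod (cnj x * s) \<le> cmod s" "cmod (cnj s * t) \<le> cmod s"
    using assms by (auto simp: norm_mult mult_left_le_one_le mult_right_le_one_le)
  then have 2: "1 - cmod s \<le> ?a" "1 - cmod s \<le> ?b"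
    using norm_triangle_ineq2[of 1 "cnj x * s"] norm_triangle_ineq2[of 1 "cnj s * t"] by auto
  have dec: "1 - cnj x * t = (1 - cnj x * s) + cnj x * s * (1 - cnj s * t) + cnj x * t * of_real ((cmod s)\<^sup>2 - 1)"
    using complex_norm_square[of s] by (simp add: algebra_simps)
  have "cmod (1 - cnj x * t) \<le> ?a + cmod (cnj x * s * (1 - cnj s * t)) + cmod (cnj x * t * of_real ((cmod s)\<^sup>2 - 1))"
    using norm_triangle_ineq[of "1 - cnj x * s" "cnj x * s * (1 - cnj s * t)"]
      norm_triangle_ineq[of "1 - cnj x * s + cnj x * s * (1 - cnj s * t)" "cnj x * t * of_real ((cmod s)\<^sup>2 - 1)"]
    unfolding dec by linarith
  moreover have "cmod (cnj x * s * (1 - cnj s * t)) \<le> ?b"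
    using assms unfolding norm_mult[of "cnj x * s"]
    by (intro mult_left_le_one_le) (auto simp: norm_mult intro!: mult_le_one)
  moreover have "cmod (cnj x * t * of_real ((cmod s)\<^sup>2 - 1)) \<le> 1 - (cmod s)\<^sup>2"
  proof -
    have "cmod (complex_of_real ((cmod s)\<^sup>2 - 1)) = 1 - (cmod s)\<^sup>2"
      using assms by (subst norm_of_real) (simp add: power_le_one)
    then show ?thesis using assms unfolding norm_mult[of "cnj x * t"]
      by (simp only:) (intro mult_left_le_one_le, auto simp: norm_mult power_le_one intro!: mult_le_one)
  qed
  ultimately have "cmod (1 - cnj x * t) \<le> 2 * (?a + ?b)" using 1 2 unfolding distrib_left right_diff_distrib by linarith
  then have "(cmod (1 - cnj x * t))\<^sup>2 \<le> (2 * (?a + ?b))\<^sup>2" by (intro power_mono) auto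
  also have "\<dots> \<le> 8 * (?a\<^sup>2 + ?b\<^sup>2)"
    using sum_squares_bound[of ?a ?b] by (simp add: power2_eq_square algebra_simps)
  finally show ?thesis .
qed

lemma ennreal_le_of_square_le:
  fixes Q c :: ennreal
  assumes "Q * Q \<le> c * Q" "Q < \<infinity>"
  shows "Q \<le> c"
proof (cases "Q = 0")
  case False
  show ?thesis
  proof (cases c)
    case (real r)
    obtain q where q: "Q = ennreal q" "q \<ge> 0" using assms(2) by (cases Q) auto
    have "q > 0" using False q by (cases "q = 0") auto
    have "ennreal (q * q) \<le> ennreal (r * q)" using assms(1) q real by (simp add: ennreal_mult)
    then have "q * q \<le> r * q" using q real by (subst (asm) ennreal_le_iff) auto
    then show ?thesis using \<open>q > 0\<close> real q by (simp add: ennreal_leI)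
  qed simp
qed simp

text \<open>Expanding the square of \<open>T\<close> produces the composed kernel, which the test
  bounds by the kernel itself; so the integral of \<open>T\<close> squared is at most
  \<open>2 * C * Q\<close>. Cauchy-Schwarz then bounds \<open>Q * Q\<close> by a multiple of
  \<open>Q\<close>, and \<open>Q\<close> may be cancelled because it is finite.\<close>

lemma Vinogradov_Senichkin_test:
  fixes k :: "'a \<Rightarrow> 'a \<Rightarrow> ennreal" and g :: "'a \<Rightarrow> ennreal"
  assumes "sigma_finite_measure M"
    and k [measurable]: "case_prod k \<in> borel_measurable (M \<Otimes>\<^sub>M M)"
    and g [measurable]: "g \<in> borel_measurable M"
    and test: "\<And>x t. x \<in> space M \<Longrightarrow> t \<in> space M \<Longrightarrow> (\<integral>\<^sup>+s. k x s * k t s \<partial>M) \<le> C * (k x t + k t x)"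
    and fin: "(\<integral>\<^sup>+s. (\<integral>\<^sup>+x. k x s * g x \<partial>M) * g s \<partial>M) < \<infinity>"
  shows "(\<integral>\<^sup>+s. (\<integral>\<^sup>+x. k x s * g x \<partial>M) * g s \<partial>M) \<le> 2 * C * (\<integral>\<^sup>+x. (g x)\<^sup>2 \<partial>M)"
proof -
  interpret sigma_finite_measure M by fact
  interpret P: pair_sigma_finite M M ..
  define T where "T = (\<lambda>s. \<integral>\<^sup>+x. k x s * g x \<partial>M)"
  define Q where "Q = (\<integral>\<^sup>+s. T s * g s \<partial>M)"
  have T [measurable]: "T \<in> borel_measurable M"
    unfolding T_def by measurable
  have Q1: "Q = (\<integral>\<^sup>+s. \<integral>\<^sup>+x. k x s * (g x * g s) \<partial>M \<partial>M)"
    unfolding Q_def T_def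
    by (intro nn_integral_cong) (simp add: nn_integral_multc[symmetric] mult.assoc)
  have Q2: "Q = (\<integral>\<^sup>+x. \<integral>\<^sup>+s. k x s * (g x * g s) \<partial>M \<partial>M)"
    unfolding Q1 by (rule P.Fubini') measurable
  have "(\<integral>\<^sup>+s. (T s)\<^sup>2 \<partial>M) = (\<integral>\<^sup>+s. \<integral>\<^sup>+x. \<integral>\<^sup>+t. k x s * g x * (k t s * g t) \<partial>M \<partial>M \<partial>M)"
    unfolding T_def power2_eq_square
    by (intro nn_integral_cong) (simp add: nn_integral_multc[symmetric] nn_integral_cmult)
  also have "\<dots> = (\<integral>\<^sup>+x. \<integral>\<^sup>+s. \<integral>\<^sup>+t. k x s * g x * (k t s * g t) \<partial>M \<partial>M \<partial>M)"
    by (rule P.Fubini') measurable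
  also have "\<dots> = (\<integral>\<^sup>+x. \<integral>\<^sup>+t. \<integral>\<^sup>+s. k x s * g x * (k t s * g t) \<partial>M \<partial>M \<partial>M)"
    by (intro nn_integral_cong P.Fubini') measurable
  also have "\<dots> = (\<integral>\<^sup>+x. \<integral>\<^sup>+t. g x * g t * (\<integral>\<^sup>+s. k x s * k t s \<partial>M) \<partial>M \<partial>M)"
    by (intro nn_integral_cong) (simp add: nn_integral_cmult[symmetric] mult_ac)
  also have "\<dots> \<le> (\<integral>\<^sup>+x. \<integral>\<^sup>+t. C * (k x t * (g x * g t)) + C * (k t x * (g t * g x)) \<partial>M \<partial>M)"
  proof (intro nn_integral_mono)
    fix x t assume "x \<in> space M" "t \<in> space M"
    from mult_left_mono[OF test[OF this], of "g x * g t"]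
    show "g x * g t * (\<integral>\<^sup>+s. k x s * k t s \<partial>M) \<le> C * (k x t * (g x * g t)) + C * (k t x * (g t * g x))"
      by (simp add: algebra_simps)
  qed
  also have "\<dots> = (\<integral>\<^sup>+x. C * (\<integral>\<^sup>+t. k x t * (g x * g t) \<partial>M) + C * (\<integral>\<^sup>+t. k t x * (g t * g x) \<partial>M) \<partial>M)"
    by (intro nn_integral_cong) (simp add: nn_integral_add nn_integral_cmult)
  also have "\<dots> = C * Q + C * Q"
    by (subst (1) Q2, subst Q1) (simp add: nn_integral_add nn_integral_cmult)
  finally have T2: "(\<integral>\<^sup>+s. (T s)\<^sup>2 \<partial>M) \<le> 2 * C * Q" by (simp add: mult_2 distrib_right)
  have "Q * Q \<le> (\<integral>\<^sup>+s. (T s)\<^sup>2 \<partial>M) * (\<integral>\<^sup>+x. (g x)\<^sup>2 \<partial>M)"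
    unfolding Q_def power2_eq_square[symmetric] by (rule Cauchy_Schwarz_nn_integral) auto
  also have "\<dots> \<le> (2 * C * Q) * (\<integral>\<^sup>+x. (g x)\<^sup>2 \<partial>M)" by (intro mult_right_mono T2) auto
  finally have "Q * Q \<le> 2 * C * (\<integral>\<^sup>+x. (g x)\<^sup>2 \<partial>M) * Q" by (simp add: mult_ac)
  from ennreal_le_of_square_le[OF this] fin show ?thesis unfolding Q_def T_def by simp
qed

text \<open>The two-sided partial sum is \<open>2 * Re s - 1\<close> for the geometric sum
  \<open>s\<close>. Its limit is the Poisson kernel, and the last summand bounds the tail.\<close>

lemma Poisson_kernel_partial_sum:
  fixes q :: complex
  assumes "cmod q \<le> R" "R < 1" "K \<ge> 1"
  shows "cmod ((\<Sum>n<K. q ^ n) + (\<Sum>n\<in>{1..<K}. cnj q ^ n))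
           \<le> (1 - (cmod q)\<^sup>2) / (cmod (1 - q))\<^sup>2 + 2 * R ^ K / (1 - R)"
proof -
  have q1: "q \<noteq> 1" and R0: "R \<ge> 0" using assms norm_ge_zero[of q] by (auto simp del: norm_ge_zero)
  define s where "s = (\<Sum>n<K. q ^ n)"
  have s: "s = 1 / (1 - q) - q ^ K / (1 - q)"
    unfolding s_def using q1 by (simp add: sum_gp_strict diff_divide_distrib)
  have "{..<K} = insert 0 {1..<K}" using assms by auto
  then have "(\<Sum>n\<in>{1..<K}. cnj q ^ n) = cnj s - 1" unfolding s_def by simp
  then have e: "(\<Sum>n<K. q ^ n) + (\<Sum>n\<in>{1..<K}. cnj q ^ n) = of_real (2 * Re s - 1)"
    by (simp add: s_def[symmetric] complex_eq_iff)
  have n1: "(cmod (1 - q))\<^sup>2 = 1 - 2 * Re q + (cmod q)\<^sup>2"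
    unfolding cmod_power2 by (simp add: power2_eq_square algebra_simps)
  have "(cmod (1 - q))\<^sup>2 > 0" using q1 by simp
  then have P: "2 * Re (1 / (1 - q)) - 1 = (1 - (cmod q)\<^sup>2) / (cmod (1 - q))\<^sup>2"
    by (simp add: Re_divide' n1 field_simps)
  have "1 - R \<le> cmod (1 - q)" using norm_triangle_ineq2[of 1 q] assms by simp
  then have e2: "cmod (q ^ K / (1 - q)) \<le> R ^ K / (1 - R)"
    using assms R0 unfolding norm_divide norm_power by (intro frac_le power_mono) auto
  have "2 * Re s - 1 = (1 - (cmod q)\<^sup>2) / (cmod (1 - q))\<^sup>2 - 2 * Re (q ^ K / (1 - q))"
    unfolding s P[symmetric] minus_complex.simps by simp
  moreover have "\<bar>Re (q ^ K / (1 - q))\<bar> \<le> R ^ K / (1 - R)"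
    using abs_Re_le_cmod[of "q ^ K / (1 - q)"] e2 by linarith
  moreover have "(1 - (cmod q)\<^sup>2) / (cmod (1 - q))\<^sup>2 \<ge> 0"
    using assms by (intro divide_nonneg_nonneg) (auto simp: power_le_one)
  ultimately have "\<bar>2 * Re s - 1\<bar> \<le> (1 - (cmod q)\<^sup>2) / (cmod (1 - q))\<^sup>2 + 2 * (R ^ K / (1 - R))"
    by (smt (verit))
  then show ?thesis unfolding e norm_of_real by simp
qed

text \<open>Squared modulus at \<open>s\<close> of the \<open>H2\<close> reproducing kernel of
  \<open>x\<close>, divided by its squared norm. The normalisation involves \<open>x\<close> alone,
  so \<open>kern\<close> is not symmetric.\<close>

definition kern :: "complex \<Rightarrow> complex \<Rightarrow> real" where
  "kern x s = (1 - (cmod x)\<^sup>2) / (cmod (1 - cnj x * s))\<^sup>2"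

lemma kern_nonneg: "cmod x < 1 \<Longrightarrow> kern x s \<ge> 0"
  unfolding kern_def by (auto intro!: divide_nonneg_nonneg simp: power_le_one)

lemma cmod_one_minus_pos:
  assumes "cmod x < 1" "cmod s < 1" shows "cmod (1 - cnj x * s) > 0"
proof -
  have "cmod (cnj x * s) < 1"
    using assms mult_left_le_one_le[of "cmod s" "cmod x"] by (simp add: norm_mult)
  then show ?thesis by auto
qed

lemma cmod_cnj_swap: "cmod (1 - cnj x * s) = cmod (1 - cnj s * x)"
  by (metis complex_cnj_cnj complex_cnj_diff complex_cnj_mult complex_cnj_one complex_mod_cnj mult.commute)

text \<open>The quasi-triangle inequality divided by the three squared distances. The two
  coefficients on the right are \<open>kern t x\<close> and \<open>kern x t\<close>; integrating in
  \<open>s\<close> thus gives the test condition with constant \<open>8 * A\<close>.\<close>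

lemma kern_product_le:
  assumes "cmod s < 1" "cmod x < 1" "cmod t < 1"
  shows "kern x s * kern t s \<le> 8 * ((1 - (cmod t)\<^sup>2) / (cmod (1 - cnj x * t))\<^sup>2 * kern x s
           + (1 - (cmod x)\<^sup>2) / (cmod (1 - cnj x * t))\<^sup>2 * kern t s)"
proof -
  define a b c where "a = (cmod (1 - cnj x * s))\<^sup>2" and "b = (cmod (1 - cnj t * s))\<^sup>2" and "c = (cmod (1 - cnj x * t))\<^sup>2"
  define X T where "X = 1 - (cmod x)\<^sup>2" and "T = 1 - (cmod t)\<^sup>2"
  have p: "a > 0" "b > 0" "c > 0" unfolding a_def b_def c_def using cmod_one_minus_pos assms by auto
  have XT: "X \<ge> 0" "T \<ge> 0" unfolding X_def T_def using assms by (auto simp: power_le_one)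
  have q: "c \<le> 8 * (a + b)" unfolding a_def b_def c_def cmod_cnj_swap[of t s] by (rule quasi_triangle) fact+
  have "X / a * (T / b) = (X * T) * (1 / (a * b))" by simp
  also have "\<dots> \<le> (X * T) * (8 * (a + b) / (a * b * c))"
    using p q XT by (intro mult_left_mono) (auto simp: field_simps)
  also have "\<dots> = 8 * (T / c * (X / a) + X / c * (T / b))" using p by (simp add: field_simps)
  finally show ?thesis unfolding kern_def a_def b_def c_def X_def T_def .
qed

text \<open>For \<open>a\<close>, \<open>b\<close> in the unit interval,
  \<open>1 - a * b \<le> (1 - a) + (1 - b)\<close>. The symmetric Poisson kernel is thereby split
  into the two kernels that the test controls.\<close>

lemma Poisson_le_kern:
  assumes "cmod x < 1" "cmod t < 1"
  shows "(1 - (cmod (cnj x * t))\<^sup>2) / (cmod (1 - cnj x * t))\<^sup>2 \<le> kern x t + kern t x"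
proof -
  have "(1 - (cmod x)\<^sup>2) * (1 - (cmod t)\<^sup>2) \<ge> 0"
    using assms by (intro mult_nonneg_nonneg) (auto simp: power_le_one)
  then have "1 - (cmod (cnj x * t))\<^sup>2 \<le> (1 - (cmod x)\<^sup>2) + (1 - (cmod t)\<^sup>2)"
    by (simp add: norm_mult power_mult_distrib algebra_simps)
  then show ?thesis unfolding kern_def cmod_cnj_swap[of t x] add_divide_distrib[symmetric]
    by (rule divide_right_mono) simp
qed


lemma borel_measurable_cnj [measurable]: "cnj \<in> borel_measurable borel"
  by (intro borel_measurable_continuous_onI continuous_intros)

text \<open>A duality argument: \<open>G\<close> is the pairing of the coefficients
  \<open>a n\<close> with the moments \<open>b n\<close>, and the squared moments sum to at most
  \<open>32 * A * G\<close>; Cauchy-Schwarz and cancelling one \<open>G\<close> finish. Here 32 is 8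
  from the quasi-triangle inequality, 2 from the kernel test and 2 from the two kernels that
  dominate the Poisson kernel. The map \<open>w\<close> stands in for an image measure.\<close>

theorem Carleson_embedding_poly:
  fixes a :: "nat \<Rightarrow> complex" and w :: "'a \<Rightarrow> complex"
  assumes "finite_measure M" and w [measurable]: "w \<in> borel_measurable M"
    and wR: "\<And>x. x \<in> space M \<Longrightarrow> cmod (w x) \<le> R" and R: "0 \<le> R" "R < 1" and A: "A \<ge> 0"
    and test: "\<And>x. x \<in> space M \<Longrightarrow> (\<integral>\<^sup>+s. ennreal (kern (w x) (w s)) \<partial>M) \<le> ennreal A"
  shows "(\<integral>x. (cmod (\<Sum>n<N. a n * w x ^ n))\<^sup>2 \<partial>M) \<le> 32 * A * (\<Sum>n<N. (cmod (a n))\<^sup>2)"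
proof -
  interpret finite_measure M by fact
  have w1: "cmod (w x) < 1" if "x \<in> space M" for x using wR[OF that] R by linarith
  define g where "g = (\<lambda>x. \<Sum>n<N. a n * w x ^ n)"
  have g [measurable]: "g \<in> borel_measurable M" unfolding g_def by measurable
  obtain B where B: "B \<ge> 0" "\<And>x. x \<in> space M \<Longrightarrow> cmod (g x) \<le> B"
  proof
    show "(\<Sum>n<N. cmod (a n)) \<ge> 0" by (intro sum_nonneg) auto
    fix x assume x: "x \<in> space M"
    show "cmod (g x) \<le> (\<Sum>n<N. cmod (a n))"
      unfolding g_def using w1[OF x]
      by (intro order_trans[OF norm_sum] sum_mono) (auto simp: norm_mult norm_power intro!: mult_right_le_one_le power_le_one)
  qed
  define k where "k = (\<lambda>x s. ennreal (kern (w x) (w s)))"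
  have k [measurable]: "case_prod k \<in> borel_measurable (M \<Otimes>\<^sub>M M)"
    unfolding k_def kern_def by measurable
  have kR: "kern (w x) (w s) \<le> 1 / (1 - R)\<^sup>2" if "x \<in> space M" "s \<in> space M" for x s
  proof -
    have "cmod (cnj (w x) * w s) \<le> R * 1"
      unfolding norm_mult complex_mod_cnj by (intro mult_mono) (use wR that w1 R in \<open>auto intro: less_imp_le\<close>)
    then have "1 - R \<le> cmod (1 - cnj (w x) * w s)"
      using norm_triangle_ineq2[of 1 "cnj (w x) * w s"] by simp
    then show ?thesis unfolding kern_def using R w1[OF that(1)] by (intro frac_le power_mono) (auto simp: power_le_one)
  qed
  define Q where "Q = (\<integral>\<^sup>+s. (\<integral>\<^sup>+x. k x s * ennreal (cmod (g x)) \<partial>M) * ennreal (cmod (g s)) \<partial>M)"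
  define G where "G = (\<integral>x. (cmod (g x))\<^sup>2 \<partial>M)"
  have Gi: "integrable M (\<lambda>x. (cmod (g x))\<^sup>2)"
    by (rule integrable_const_bound[of _ "B\<^sup>2"]) (use B in \<open>auto intro!: power_mono\<close>)
  have Gn: "(\<integral>\<^sup>+x. (ennreal (cmod (g x)))\<^sup>2 \<partial>M) = ennreal G"
    unfolding G_def using Gi by (subst nn_integral_eq_integral[symmetric]) (auto simp: ennreal_power)
  have G0: "G \<ge> 0" unfolding G_def by simp
  have Qfin: "Q < \<infinity>"
  proof -
    have "Q \<le> (\<integral>\<^sup>+s. (\<integral>\<^sup>+x. ennreal (1 / (1 - R)\<^sup>2) * ennreal B \<partial>M) * ennreal B \<partial>M)"
      unfolding Q_def k_def using kR B by (intro nn_integral_mono mult_mono ennreal_leI) auto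
    also have "\<dots> < \<infinity>" by (simp add: emeasure_eq_measure ennreal_mult_less_top)
    finally show ?thesis .
  qed
  have QG: "Q \<le> ennreal (16 * A * G)"
  proof -
    have "Q \<le> 2 * ennreal (8 * A) * (\<integral>\<^sup>+x. (ennreal (cmod (g x)))\<^sup>2 \<partial>M)"
      unfolding Q_def
    proof (rule Vinogradov_Senichkin_test)
      show "sigma_finite_measure M" ..
      show "(\<integral>\<^sup>+s. (\<integral>\<^sup>+x. k x s * ennreal (cmod (g x)) \<partial>M) * ennreal (cmod (g s)) \<partial>M) < \<infinity>"
        using Qfin unfolding Q_def .
      fix x t assume xt: "x \<in> space M" "t \<in> space M"
      define c where "c = (cmod (1 - cnj (w x) * w t))\<^sup>2"
      define X T where "X = 1 - (cmod (w x))\<^sup>2" and "T = 1 - (cmod (w t))\<^sup>2"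
      have p: "X \<ge> 0" "T \<ge> 0" "c \<ge> 0" unfolding X_def T_def c_def using w1[OF xt(1)] w1[OF xt(2)] by (auto simp: power_le_one)
      have "(\<integral>\<^sup>+s. k x s * k t s \<partial>M) \<le>
            (\<integral>\<^sup>+s. ennreal (8 * (T / c)) * k x s + ennreal (8 * (X / c)) * k t s \<partial>M)"
      proof (rule nn_integral_mono)
        fix s assume s: "s \<in> space M"
        have "kern (w x) (w s) * kern (w t) (w s) \<le> 8 * (T / c) * kern (w x) (w s) + 8 * (X / c) * kern (w t) (w s)"
          using kern_product_le[OF w1[OF s] w1[OF xt(1)] w1[OF xt(2)]]
          unfolding c_def X_def T_def by (simp add: algebra_simps)
        then have "ennreal (kern (w x) (w s) * kern (w t) (w s)) \<le> ennreal (8 * (T / c) * kern (w x) (w s) + 8 * (X / c) * kern (w t) (w s))"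
          by (rule ennreal_leI)
        moreover have "0 \<le> kern (w x) (w s)" "0 \<le> kern (w t) (w s)" "0 \<le> 8 * (T / c)" "0 \<le> 8 * (X / c)"
          using p kern_nonneg[OF w1] xt by auto
        ultimately show "k x s * k t s \<le> ennreal (8 * (T / c)) * k x s + ennreal (8 * (X / c)) * k t s"
          unfolding k_def by (simp only: ennreal_mult ennreal_plus mult_nonneg_nonneg)
      qed
      also have "\<dots> = ennreal (8 * (T / c)) * (\<integral>\<^sup>+s. k x s \<partial>M) + ennreal (8 * (X / c)) * (\<integral>\<^sup>+s. k t s \<partial>M)"
        using xt by (simp add: nn_integral_add nn_integral_cmult)
      also have "\<dots> \<le> ennreal (8 * (T / c)) * ennreal A + ennreal (8 * (X / c)) * ennreal A"
        unfolding k_def by (intro add_mono mult_left_mono test xt) auto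
      also have "\<dots> = ennreal (8 * A) * (k x t + k t x)"
      proof -
        have "k x t = ennreal (X / c)" "k t x = ennreal (T / c)"
          unfolding k_def kern_def X_def T_def c_def cmod_cnj_swap[of "w t" "w x"] by auto
        then show ?thesis using p A
          by (simp add: ennreal_mult[symmetric] ennreal_plus[symmetric] algebra_simps del: ennreal_plus)
      qed
      finally show "(\<integral>\<^sup>+s. k x s * k t s \<partial>M) \<le> ennreal (8 * A) * (k x t + k t x)" .
    qed measurable
    also have "\<dots> = ennreal (16 * A * G)"
      unfolding Gn using A G0 by (simp add: ennreal_mult[symmetric] flip: ennreal_numeral)
    finally show ?thesis .
  qed
  define b where "b = (\<lambda>n. \<integral>x. g x * cnj (w x) ^ n \<partial>M)"
  \<comment> \<open>The moments \<open>b n\<close> alone lead to the Szego kernel, whose modulus no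
    constant multiple of the two kernels dominates. Adding the nonnegative squares of the
    \<open>c n\<close>, the negative frequencies, turns it into the Poisson kernel.\<close>
  define c where "c = (\<lambda>n. \<integral>x. g x * w x ^ n \<partial>M)"
  have bnd: "integrable M f" if "f \<in> borel_measurable M" "\<And>x. x \<in> space M \<Longrightarrow> cmod (f x) \<le> D" for f :: "'a \<Rightarrow> complex" and D
    by (rule integrable_const_bound[of _ D]) (use that in auto)
  have gw: "cmod (g x) * cmod (w x) ^ n \<le> B" if "x \<in> space M" for x n
    using mult_mono[OF B(2)[OF that] power_le_one[of "cmod (w x)" n]] w1[OF that] B(1) by simp
  have ib: "integrable M (\<lambda>x. g x * cnj (w x) ^ n)" for n
    by (rule bnd[of _ B]) (auto simp: norm_mult norm_power gw)
  have ic: "integrable M (\<lambda>x. g x * w x ^ n)" for n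
    by (rule bnd[of _ B]) (auto simp: norm_mult norm_power gw)
  have ib': "integrable M (\<lambda>x. cnj (g x) * w x ^ n)" for n
    by (rule bnd[of _ B]) (auto simp: norm_mult norm_power gw)
  have ic': "integrable M (\<lambda>x. cnj (g x) * cnj (w x) ^ n)" for n
    by (rule bnd[of _ B]) (auto simp: norm_mult norm_power gw)
  have cb: "cnj (b n) = (\<integral>x. cnj (g x) * w x ^ n \<partial>M)" for n
    unfolding b_def using Bochner_Integration.integral_cnj[of M "\<lambda>x. g x * cnj (w x) ^ n"] by simp
  have cc: "cnj (c n) = (\<integral>x. cnj (g x) * cnj (w x) ^ n \<partial>M)" for n
    unfolding c_def using Bochner_Integration.integral_cnj[of M "\<lambda>x. g x * w x ^ n"] by simp
  have Gb: "complex_of_real G = (\<Sum>n<N. a n * cnj (b n))"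
  proof -
    have "complex_of_real G = (\<integral>x. complex_of_real ((cmod (g x))\<^sup>2) \<partial>M)"
      unfolding G_def by (rule integral_complex_of_real[symmetric])
    also have "\<dots> = (\<integral>x. (\<Sum>n<N. a n * (cnj (g x) * w x ^ n)) \<partial>M)"
      unfolding complex_norm_square
      by (intro Bochner_Integration.integral_cong refl)
         (subst g_def, simp add: sum_distrib_left sum_distrib_right mult_ac)
    also have "\<dots> = (\<Sum>n<N. a n * cnj (b n))"
      unfolding cb using ib' by (simp add: Bochner_Integration.integral_sum)
    finally show ?thesis .
  qed
  \<comment> \<open>Truncation at \<open>K\<close> avoids interchanging infinite sums with
    integrals. As \<open>w\<close> stays in the disc of radius \<open>R\<close>, the error decays
    geometrically and disappears in \<open>bG\<close>.\<close>
  have tail: "(\<Sum>n<N. (cmod (b n))\<^sup>2) \<le> 32 * A * G + 2 * R ^ K / (1 - R) * (B * measure M (space M))\<^sup>2" if K: "K \<ge> N" "K \<ge> 1" for K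
  proof -
    define e where "e = 2 * R ^ K / (1 - R)"
    have e0: "e \<ge> 0" unfolding e_def using R by auto
    define D where "D = (\<lambda>x y. (\<Sum>n<K. (cnj (w x) * w y) ^ n) + (\<Sum>n\<in>{1..<K}. cnj (cnj (w x) * w y) ^ n))"
    define S where "S = (\<Sum>n<K. (cmod (b n))\<^sup>2) + (\<Sum>n\<in>{1..<K}. (cmod (c n))\<^sup>2)"
    have S0: "S \<ge> 0" unfolding S_def by (intro add_nonneg_nonneg sum_nonneg) auto
    have in1: "(\<integral>y. g x * cnj (g y) * D x y \<partial>M) = (\<Sum>n<K. g x * cnj (w x) ^ n * cnj (b n)) + (\<Sum>n\<in>{1..<K}. g x * w x ^ n * cnj (c n))" for x
    proof -
      have "g x * cnj (g y) * D x y = (\<Sum>n<K. g x * cnj (w x) ^ n * (cnj (g y) * w y ^ n)) + (\<Sum>n\<in>{1..<K}. g x * w x ^ n * (cnj (g y) * cnj (w y) ^ n))" for y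
        unfolding D_def distrib_left sum_distrib_left
        by (intro arg_cong2[where f = "(+)"] sum.cong refl) (simp_all add: power_mult_distrib)
      then show ?thesis using ib' ic' by (simp add: cb cc Bochner_Integration.integral_sum)
    qed
    have "(\<integral>x. (\<integral>y. g x * cnj (g y) * D x y \<partial>M) \<partial>M) = (\<Sum>n<K. b n * cnj (b n)) + (\<Sum>n\<in>{1..<K}. c n * cnj (c n))"
      unfolding in1 using ib ic by (simp add: Bochner_Integration.integral_sum b_def c_def)
    also have "\<dots> = of_real S" unfolding S_def by (simp add: complex_norm_square[symmetric])
    finally have "ennreal S = ennreal (cmod (\<integral>x. (\<integral>y. g x * cnj (g y) * D x y \<partial>M) \<partial>M))"
      by (simp only: norm_of_real abs_of_nonneg[OF S0])
    also have "\<dots> \<le> (\<integral>\<^sup>+x. ennreal (cmod (\<integral>y. g x * cnj (g y) * D x y \<partial>M)) \<partial>M)"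
      unfolding in1 by (rule integral_norm_bound_ennreal) (use ib ic in auto)
    also have "\<dots> \<le> (\<integral>\<^sup>+x. \<integral>\<^sup>+y. ennreal (cmod (g x * cnj (g y) * D x y)) \<partial>M \<partial>M)"
    proof (intro nn_integral_mono integral_norm_bound_ennreal)
      fix x
      have "g x * cnj (g y) * D x y = (\<Sum>n<K. g x * cnj (w x) ^ n * (cnj (g y) * w y ^ n)) + (\<Sum>n\<in>{1..<K}. g x * w x ^ n * (cnj (g y) * cnj (w y) ^ n))" for y
        unfolding D_def distrib_left sum_distrib_left
        by (intro arg_cong2[where f = "(+)"] sum.cong refl) (simp_all add: power_mult_distrib)
      then show "integrable M (\<lambda>y. g x * cnj (g y) * D x y)" using ib' ic' by simp
    qed
    also have "\<dots> \<le> (\<integral>\<^sup>+x. \<integral>\<^sup>+y. (k x y * (ennreal (cmod (g x)) * ennreal (cmod (g y))) + k y x * (ennreal (cmod (g y)) * ennreal (cmod (g x))))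
             + ennreal e * ennreal B * ennreal B \<partial>M \<partial>M)"
    proof (intro nn_integral_mono)
      fix x y assume xy: "x \<in> space M" "y \<in> space M"
      have "cmod (cnj (w x) * w y) \<le> R * 1"
        unfolding norm_mult complex_mod_cnj by (intro mult_mono) (use wR xy w1 R in \<open>auto intro: less_imp_le\<close>)
      then have "cmod (D x y) \<le> (1 - (cmod (cnj (w x) * w y))\<^sup>2) / (cmod (1 - cnj (w x) * w y))\<^sup>2 + e"
        unfolding D_def e_def by (intro Poisson_kernel_partial_sum) (use K R in auto)
      also have "\<dots> \<le> kern (w x) (w y) + kern (w y) (w x) + e"
        using Poisson_le_kern[OF w1[OF xy(1)] w1[OF xy(2)]] by simp
      finally have D: "cmod (D x y) \<le> kern (w x) (w y) + kern (w y) (w x) + e" .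
      have "cmod (g x * cnj (g y) * D x y) \<le> cmod (g x) * cmod (g y) * (kern (w x) (w y) + kern (w y) (w x) + e)"
        unfolding norm_mult complex_mod_cnj using D by (intro mult_left_mono) auto
      also have "\<dots> = (kern (w x) (w y) * (cmod (g x) * cmod (g y)) + kern (w y) (w x) * (cmod (g y) * cmod (g x))) + e * (cmod (g x) * cmod (g y))"
        by (simp add: algebra_simps)
      also have "\<dots> \<le> (kern (w x) (w y) * (cmod (g x) * cmod (g y)) + kern (w y) (w x) * (cmod (g y) * cmod (g x))) + e * (B * B)"
        using xy B e0 by (intro add_left_mono mult_left_mono mult_mono) auto
      finally have "ennreal (cmod (g x * cnj (g y) * D x y)) \<le> ennreal \<dots>" by (rule ennreal_leI)
      also have "\<dots> = (k x y * (ennreal (cmod (g x)) * ennreal (cmod (g y))) + k y x * (ennreal (cmod (g y)) * ennreal (cmod (g x))))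
             + ennreal e * ennreal B * ennreal B"
        unfolding k_def using kern_nonneg[OF w1] xy e0 B
        by (simp add: ennreal_mult ennreal_plus mult.assoc)
      finally show "ennreal (cmod (g x * cnj (g y) * D x y)) \<le> \<dots>" .
    qed
    also have "\<dots> = (\<integral>\<^sup>+x. (\<integral>\<^sup>+y. k x y * (ennreal (cmod (g x)) * ennreal (cmod (g y))) \<partial>M)
        + (\<integral>\<^sup>+y. k y x * (ennreal (cmod (g y)) * ennreal (cmod (g x))) \<partial>M)
        + ennreal e * ennreal B * ennreal B * emeasure M (space M) \<partial>M)"
      by (intro nn_integral_cong) (simp add: nn_integral_add)
    also have "\<dots> = (\<integral>\<^sup>+x. \<integral>\<^sup>+y. k x y * (ennreal (cmod (g x)) * ennreal (cmod (g y))) \<partial>M \<partial>M)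
        + (\<integral>\<^sup>+x. \<integral>\<^sup>+y. k y x * (ennreal (cmod (g y)) * ennreal (cmod (g x))) \<partial>M \<partial>M)
        + ennreal e * ennreal B * ennreal B * emeasure M (space M) * emeasure M (space M)"
      by (simp add: nn_integral_add)
    also have "(\<integral>\<^sup>+x. \<integral>\<^sup>+y. k y x * (ennreal (cmod (g y)) * ennreal (cmod (g x))) \<partial>M \<partial>M) = Q"
      unfolding Q_def by (intro nn_integral_cong) (simp add: nn_integral_multc[symmetric] mult.assoc)
    also have "(\<integral>\<^sup>+x. \<integral>\<^sup>+y. k x y * (ennreal (cmod (g x)) * ennreal (cmod (g y))) \<partial>M \<partial>M) = Q"
    proof -
      interpret P: pair_sigma_finite M M ..
      have "(\<integral>\<^sup>+x. \<integral>\<^sup>+y. k x y * (ennreal (cmod (g x)) * ennreal (cmod (g y))) \<partial>M \<partial>M)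
        = (\<integral>\<^sup>+y. \<integral>\<^sup>+x. k x y * (ennreal (cmod (g x)) * ennreal (cmod (g y))) \<partial>M \<partial>M)"
        by (rule P.Fubini'[symmetric]) measurable
      also have "\<dots> = Q"
        unfolding Q_def by (intro nn_integral_cong) (simp add: nn_integral_multc[symmetric] mult.assoc)
      finally show ?thesis .
    qed
    also have "Q + Q + ennreal e * ennreal B * ennreal B * emeasure M (space M) * emeasure M (space M)
       \<le> ennreal (16 * A * G) + ennreal (16 * A * G) + ennreal e * ennreal B * ennreal B * emeasure M (space M) * emeasure M (space M)"
      by (intro add_mono QG order_refl)
    also have "\<dots> = ennreal (32 * A * G + e * (B * measure M (space M))\<^sup>2)"
      using A G0 e0 B by (simp add: emeasure_eq_measure ennreal_mult[symmetric] ennreal_plus[symmetric] power2_eq_square mult_ac del: ennreal_plus)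
    finally have "S \<le> 32 * A * G + e * (B * measure M (space M))\<^sup>2"
      using A G0 e0 by (subst (asm) ennreal_le_iff) auto
    moreover have "(\<Sum>n<N. (cmod (b n))\<^sup>2) \<le> S"
      unfolding S_def using K by (intro add_increasing2 sum_nonneg sum_mono2) auto
    ultimately show ?thesis unfolding e_def by linarith
  qed
  have bG: "(\<Sum>n<N. (cmod (b n))\<^sup>2) \<le> 32 * A * G"
  proof (rule tendsto_lowerbound)
    show "(\<lambda>K. 32 * A * G + 2 * R ^ K / (1 - R) * (B * measure M (space M))\<^sup>2) \<longlonglongrightarrow> 32 * A * G"
    proof -
      have "(\<lambda>K. R ^ K) \<longlonglongrightarrow> 0" using R by (intro LIMSEQ_realpow_zero) auto
      then have "(\<lambda>K. 32 * A * G + 2 * R ^ K / (1 - R) * (B * measure M (space M))\<^sup>2) \<longlonglongrightarrow> 32 * A * G + 2 * 0 / (1 - R) * (B * measure M (space M))\<^sup>2"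
        by (intro tendsto_intros) (use R in auto)
      then show ?thesis by simp
    qed
    show "\<forall>\<^sub>F K in sequentially. (\<Sum>n<N. (cmod (b n))\<^sup>2) \<le> 32 * A * G + 2 * R ^ K / (1 - R) * (B * measure M (space M))\<^sup>2"
      using eventually_ge_at_top[of "max N 1"] by eventually_elim (rule tail, auto)
  qed simp
  have "G = cmod (complex_of_real G)" using G0 by simp
  also have "\<dots> \<le> (\<Sum>n<N. cmod (a n) * cmod (b n))"
    unfolding Gb by (intro order_trans[OF norm_sum] sum_mono) (simp add: norm_mult)
  finally have "G\<^sup>2 \<le> (\<Sum>n<N. cmod (a n) * cmod (b n))\<^sup>2" using G0 by (intro power_mono)
  also have "\<dots> \<le> (\<Sum>n<N. (cmod (a n))\<^sup>2) * (\<Sum>n<N. (cmod (b n))\<^sup>2)"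
    by (rule Cauchy_Schwarz_ineq_sum)
  also have "\<dots> \<le> (\<Sum>n<N. (cmod (a n))\<^sup>2) * (32 * A * G)"
    by (intro mult_left_mono bG sum_nonneg) auto
  finally have "G * G \<le> (32 * A * (\<Sum>n<N. (cmod (a n))\<^sup>2)) * G" by (simp add: power2_eq_square mult_ac)
  moreover have "32 * A * (\<Sum>n<N. (cmod (a n))\<^sup>2) \<ge> 0" using A by (intro mult_nonneg_nonneg sum_nonneg) auto
  ultimately have "G \<le> 32 * A * (\<Sum>n<N. (cmod (a n))\<^sup>2)"
    using G0 mult_le_cancel_right_pos by (cases "G = 0") auto
  then show ?thesis unfolding G_def g_def .
qed

section \<open>From level sets to reproducing kernels\<close>

text \<open>Parseval for the geometric series of \<open>1 / (1 - cnj x * z)\<close>; the factors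
  \<open>r ^ (2 * n)\<close> can only decrease the sum.\<close>

lemma mean_reproducing_kernel_le:
  assumes "cmod x < 1" "0 \<le> r" "r < 1"
  shows "(\<integral>t. 1 / (cmod (1 - cnj x * (of_real r * cis t)))\<^sup>2 \<partial>circ) \<le> 1 / (1 - (cmod x)\<^sup>2)"
proof -
  have "(\<lambda>n. (cnj x) ^ n * z ^ n) sums (1 / (1 - cnj x * z))" if "z \<in> ball 0 1" for z
  proof -
    have "cmod (cnj x * z) < 1"
      using assms that mult_left_le_one_le[of "cmod z" "cmod x"] by (simp add: norm_mult)
    then show ?thesis using geometric_sums[of "cnj x * z"] by (simp add: power_mult_distrib)
  qed
  from Parseval_circle[OF this assms(2,3)]
  have s: "(\<lambda>n. (cmod (cnj x ^ n))\<^sup>2 * r ^ (2 * n)) sums (\<integral>t. (cmod (1 / (1 - cnj x * (of_real r * cis t))))\<^sup>2 \<partial>circ)" .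
  have "(cmod x)\<^sup>2 < 1" using assms by (simp add: power_less_one_iff)
  then have s2: "(\<lambda>n. ((cmod x)\<^sup>2) ^ n) sums (1 / (1 - (cmod x)\<^sup>2))" by (intro geometric_sums) simp
  have "(\<integral>t. (cmod (1 / (1 - cnj x * (of_real r * cis t))))\<^sup>2 \<partial>circ) \<le> 1 / (1 - (cmod x)\<^sup>2)"
  proof (rule sums_le[OF _ s s2])
    fix n
    show "(cmod (cnj x ^ n))\<^sup>2 * r ^ (2 * n) \<le> ((cmod x)\<^sup>2) ^ n"
      using assms by (simp add: norm_power power_mult[symmetric] mult.commute mult_left_le_one_le power_le_one)
  qed
  then show ?thesis by (simp add: norm_divide power_divide)
qed

text \<open>Inside the disc this is \<open>kern x s\<close> times
  \<open>(1 - cmod x) / (1 + cmod x)\<close>. Being bounded by 1, it can serve as the weight in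
  convexity estimates for \<open>\<Psi>\<close>.\<close>

definition bump :: "complex \<Rightarrow> complex \<Rightarrow> real" where
  "bump x s = (1 - cmod x)\<^sup>2 / (cmod (1 - cnj x * s))\<^sup>2"

lemma one_minus_norm_le:
  assumes "cmod s \<le> 1" shows "1 - cmod x \<le> cmod (1 - cnj x * s)"
proof -
  have "cmod (cnj x * s) \<le> cmod x" using assms by (simp add: norm_mult mult_right_le_one_le)
  then show ?thesis using norm_triangle_ineq2[of 1 "cnj x * s"] by simp
qed

lemma bump_nonneg: "bump x s \<ge> 0" by (simp add: bump_def)

lemma bump_le_1: "cmod x < 1 \<Longrightarrow> cmod s \<le> 1 \<Longrightarrow> bump x s \<le> 1"
  unfolding bump_def using one_minus_norm_le[of s x] by (intro divide_le_eq_1[THEN iffD2]) (auto intro!: power_mono)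

lemma continuous_bump_comp:
  assumes "continuous_on UNIV w" "\<And>t. cmod (w t) < 1" "cmod x < 1"
  shows "continuous_on UNIV (\<lambda>t::real. bump x (w t))"
  unfolding bump_def using cmod_one_minus_pos[OF assms(3,2)] assms(1) by (intro continuous_intros) auto

lemma mean_bump_le:
  assumes "cmod x < 1" "0 \<le> r" "r < 1"
  shows "(\<integral>t. bump x (of_real r * cis t) \<partial>circ) \<le> 1 - cmod x"
proof -
  have "(\<integral>t. bump x (of_real r * cis t) \<partial>circ) = (1 - cmod x)\<^sup>2 * (\<integral>t. 1 / (cmod (1 - cnj x * (of_real r * cis t)))\<^sup>2 \<partial>circ)"
    unfolding bump_def by (subst integral_mult_right_zero[symmetric]) simp
  also have "\<dots> \<le> (1 - cmod x)\<^sup>2 * (1 / (1 - (cmod x)\<^sup>2))"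
    by (intro mult_left_mono mean_reproducing_kernel_le assms) auto
  also have "1 - (cmod x)\<^sup>2 = (1 - cmod x) * (1 + cmod x)" by (simp add: power2_eq_square algebra_simps)
  also have "(1 - cmod x)\<^sup>2 * (1 / ((1 - cmod x) * (1 + cmod x))) = (1 - cmod x) * (1 / (1 + cmod x))"
    using assms(1) by (simp add: power2_eq_square)
  also have "\<dots> \<le> (1 - cmod x) * 1"
    using assms(1) add_pos_nonneg[of 1 "cmod x"] by (intro mult_left_mono) (auto simp: divide_le_eq_1)
  finally show ?thesis by simp
qed

text \<open>A bump below 1/36 means that the denominator before squaring is at least
  \<open>6 * h\<close>. Moving \<open>x\<close> radially inwards by \<open>h\<close> enlarges it by
  at most a sixth, while the numerator is multiplied by 4: the ratio is (7/6)^2 / 4 = 49/144. The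
  threshold is small enough that 49/144 times \<open>2 * sqrt 2\<close> is at most 1.\<close>

lemma bump_doubling:
  assumes x: "cmod x = 1 - h" and h: "0 < h" "2 * h < 1" and s: "cmod s \<le> 1" and small: "bump x s < 1 / 36"
  defines "x' \<equiv> of_real ((1 - 2*h) / (1 - h)) * x"
  shows "bump x s \<le> 49 / 144 * bump x' s"
proof -
  have x': "cmod x' = 1 - 2 * h"
    unfolding x'_def norm_mult norm_of_real x using h by simp
  define d where "d = cmod (1 - cnj x * s)"
  have d: "d \<ge> h" unfolding d_def using one_minus_norm_le[OF s, of x] x by simp
  have "(h / d)\<^sup>2 < (1/6)\<^sup>2"
    using small x unfolding bump_def d_def by (simp add: power_divide)
  then have b: "h / d < 1 / 6" by (rule power_less_imp_less_base) simp
  have d0: "d > 0" using d h by linarith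
  have "6 * h \<le> d" using b d0 by (simp add: field_simps)
  have c: "cmod (x - x') = h"
  proof -
    have "x - x' = of_real (h / (1 - h)) * x" unfolding x'_def using h by (simp add: field_simps)
    then have "cmod (x - x') = \<bar>h / (1 - h)\<bar> * cmod x" by (simp only: norm_mult norm_of_real)
    then show ?thesis using h x by simp
  qed
  have "1 - cnj x' * s = (1 - cnj x * s) + cnj (x - x') * s" by (simp add: algebra_simps)
  then have "cmod (1 - cnj x' * s) \<le> d + cmod (cnj (x - x') * s)"
    unfolding d_def by (metis norm_triangle_ineq)
  also have "cmod (cnj (x - x') * s) \<le> h" unfolding norm_mult complex_mod_cnj c using s h by (simp add: mult_left_le)
  finally have "cmod (1 - cnj x' * s) \<le> 7 / 6 * d" using \<open>6 * h \<le> d\<close> by simp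
  moreover have "cmod (1 - cnj x' * s) > 0"
    using one_minus_norm_le[OF s, of x'] x' h by linarith
  ultimately have "(2 * h)\<^sup>2 / (7 / 6 * d)\<^sup>2 \<le> (2 * h)\<^sup>2 / (cmod (1 - cnj x' * s))\<^sup>2"
    using d0 by (intro divide_left_mono power_mono mult_pos_pos) auto
  also have "\<dots> = bump x' s" unfolding bump_def x' by simp
  finally have "(2 * h)\<^sup>2 / (7 / 6 * d)\<^sup>2 \<le> bump x' s" .
  moreover have "bump x s = 49 / 144 * ((2 * h)\<^sup>2 / (7 / 6 * d)\<^sup>2)"
    unfolding bump_def x d_def[symmetric] using d0 by (simp add: field_simps power2_eq_square)
  ultimately show ?thesis by simp
qed

text \<open>Writing \<open>I h\<close> for the mean of the bump at distance \<open>h\<close> from the circle, the level set bound and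
  the doubling lemma give \<open>I h \<le> \<eta> h + (49/144) I (2h)\<close>, hence \<open>I h \<le> 4 \<eta> h + O(h\<^sup>3\<^sup>/\<^sup>2)\<close>.\<close>

lemma mean_bump_vanishing:
  fixes w :: "'i \<Rightarrow> real \<Rightarrow> complex"
  assumes w: "\<And>i. i \<in> I \<Longrightarrow> continuous_on UNIV (w i)" "\<And>i t. i \<in> I \<Longrightarrow> cmod (w i t) < 1"
    and level: "\<And>\<eta>. \<eta> > 0 \<Longrightarrow> \<exists>h0>0. \<forall>x i. i \<in> I \<longrightarrow> cmod x < 1 \<longrightarrow> 1 - cmod x < h0 \<longrightarrow>
        measure circ {t. \<eta> \<le> bump x (w i t)} \<le> \<eta> * (1 - cmod x)"
    and \<epsilon>: "\<epsilon> > 0"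
  shows "\<exists>h0>0. \<forall>x i. i \<in> I \<longrightarrow> cmod x < 1 \<longrightarrow> 1 - cmod x < h0 \<longrightarrow>
        (\<integral>t. bump x (w i t) \<partial>circ) \<le> \<epsilon> * (1 - cmod x)"
proof -
  \<comment> \<open>The bound 1/36 admits the doubling estimate below the level;
    \<open>\<epsilon>/8\<close> makes \<open>4 * \<eta>\<close> at most half of
    \<open>\<epsilon>\<close> and leaves the other half for the remainder.\<close>
  define \<eta> where "\<eta> = min (1/36) (\<epsilon>/8)"
  have \<eta>: "\<eta> > 0" "\<eta> \<le> 1/36" "8 * \<eta> \<le> \<epsilon>" using \<epsilon> by (auto simp: \<eta>_def)
  from level[OF \<eta>(1)] obtain h1 where h1: "h1 > 0" and
    l: "\<And>x i. i \<in> I \<Longrightarrow> cmod x < 1 \<Longrightarrow> 1 - cmod x < h1 \<Longrightarrow> measure circ {t. \<eta> \<le> bump x (w i t)} \<le> \<eta> * (1 - cmod x)"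
    by blast
  define h0 where "h0 = min h1 (1/2)"
  have h0: "h0 > 0" "h0 \<le> h1" "h0 \<le> 1/2" using h1 by (auto simp: h0_def)
  \<comment> \<open>This is \<open>2 / h0\<close> to the power 3/2: once
    \<open>2 * h \<ge> h0\<close>, the remainder \<open>D * (h * sqrt h)\<close> is at least 1 and
    exceeds the trivial bound for the mean.\<close>
  define D where "D = 2 / h0 * sqrt (2 / h0)"
  have D0: "D > 0" unfolding D_def using h0 by simp
  have int: "integrable circ (\<lambda>t. bump x (w i t))" if "i \<in> I" "cmod x < 1" for i x
    by (intro integrable_circ_continuous continuous_bump_comp w that)
  \<comment> \<open>Induction on the number of doublings that carry \<open>h\<close> up to
    \<open>h0\<close>; zero doublings contradict \<open>h < h0\<close>. The linear part reproduces
    itself because 1 + 49/18 is at most 4. The exponent 3/2 makes the remainder o(h) and still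
    survives a doubling, as 49/72 times \<open>sqrt 2\<close> is at most 1.\<close>
  have main: "(\<integral>t. bump x (w i t) \<partial>circ) \<le> 4 * \<eta> * h + D * (h * sqrt h)"
    if "i \<in> I" "cmod x = 1 - h" "0 < h" "h < h0" "h0 \<le> 2 ^ n * h" for x h n i
    using that
  proof (induction n arbitrary: x h)
    case 0
    then show ?case by simp
  next
    case (Suc n)
    have x1: "cmod x < 1" using Suc.prems by simp
    show ?case
    proof (cases "2 * h < h0")
      case False
      have "(\<integral>t. bump x (w i t) \<partial>circ) \<le> (\<integral>t. 1 \<partial>circ)"
        by (intro integral_mono int Suc.prems x1 bump_le_1 less_imp_le[OF w(2)]) (auto simp: Suc.prems)
      also have "\<dots> = 1 * 1" by simp
      also have "\<dots> \<le> (2 / h0 * h) * sqrt (2 / h0 * h)"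
        using False h0 by (intro mult_mono) (auto simp: field_simps)
      also have "\<dots> = D * (h * sqrt h)" unfolding D_def real_sqrt_mult by (simp add: mult_ac)
      finally show ?thesis using \<eta> Suc.prems by (simp add: add_increasing)
    next
      case True
      define x' where "x' = of_real ((1 - 2*h) / (1 - h)) * x"
      have h2: "2 * h < 1" using True h0 by linarith
      have x': "cmod x' = 1 - 2 * h"
        unfolding x'_def norm_mult norm_of_real Suc.prems using h2 Suc.prems by simp
      have x'1: "cmod x' < 1" using x' Suc.prems by simp
      have m: "{t. \<eta> \<le> bump x (w i t)} \<in> sets circ"
        using borel_measurable_continuous_onI[OF continuous_bump_comp[OF w[OF Suc.prems(1)] x1]] by simp
      have pt: "bump x (w i t) \<le> indicator {t. \<eta> \<le> bump x (w i t)} t + 49 / 144 * bump x' (w i t)" for t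
      proof (cases "\<eta> \<le> bump x (w i t)")
        case True
        then show ?thesis using bump_le_1[OF x1 less_imp_le[OF w(2)[OF Suc.prems(1), of t]]] bump_nonneg[of x' "w i t"] by simp
      next
        case False
        then show ?thesis
          using bump_doubling[OF Suc.prems(2,3) h2 less_imp_le[OF w(2)[OF Suc.prems(1), of t]]] \<eta> 
          unfolding x'_def[symmetric] by simp
      qed
      have "(\<integral>t. bump x (w i t) \<partial>circ) \<le> (\<integral>t. indicator {t. \<eta> \<le> bump x (w i t)} t + 49 / 144 * bump x' (w i t) \<partial>circ)"
        using m by (intro integral_mono pt int Suc.prems x1 Bochner_Integration.integrable_add integrable_mult_right x'1)
          (auto simp: circ.emeasure_eq_measure)
      also have "\<dots> = measure circ {t. \<eta> \<le> bump x (w i t)} + 49 / 144 * (\<integral>t. bump x' (w i t) \<partial>circ)"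
        using m int[OF Suc.prems(1) x'1] by (subst Bochner_Integration.integral_add) (auto simp: circ.emeasure_eq_measure)
      also have "\<dots> \<le> \<eta> * h + 49 / 144 * (4 * \<eta> * (2 * h) + D * ((2 * h) * sqrt (2 * h)))"
        using l[OF Suc.prems(1) x1] Suc.prems h0 Suc.IH[OF Suc.prems(1) x' _ True]
        by (intro add_mono mult_left_mono) auto
      also have "\<dots> = \<eta> * h * (1 + 49 / 18) + (49 / 72 * sqrt 2) * (D * (h * sqrt h))"
        by (simp add: real_sqrt_mult algebra_simps)
      also have "\<dots> \<le> \<eta> * h * 4 + 1 * (D * (h * sqrt h))"
      proof (intro add_mono mult_left_mono mult_right_mono)
        have "sqrt 2 \<le> 72 / 49" by (rule real_le_lsqrt) (auto simp: power2_eq_square)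
        then show "49 / 72 * sqrt 2 \<le> 1" by simp
      qed (use \<eta> D0 Suc.prems in auto)
      finally show ?thesis by (simp add: algebra_simps)
    qed
  qed
  define h2 where "h2 = min h0 ((\<epsilon> / (2 * D))\<^sup>2)"
  have "h2 > 0" unfolding h2_def using h0 \<epsilon> D0 by simp
  moreover have "(\<integral>t. bump x (w i t) \<partial>circ) \<le> \<epsilon> * (1 - cmod x)" if "i \<in> I" "cmod x < 1" "1 - cmod x < h2" for x i
  proof -
    define h where "h = 1 - cmod x"
    have h: "h > 0" "h < h0" "h < (\<epsilon> / (2 * D))\<^sup>2" using that by (auto simp: h_def h2_def)
    obtain n where "h0 / h < 2 ^ n" using real_arch_pow[of 2 "h0 / h"] by auto
    then have "h0 \<le> 2 ^ n * h" using h by (simp add: field_simps)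
    from main[OF that(1) _ h(1,2) this, of x]
    have "(\<integral>t. bump x (w i t) \<partial>circ) \<le> 4 * \<eta> * h + D * (h * sqrt h)" by (simp add: h_def)
    also have "\<dots> = h * (4 * \<eta> + D * sqrt h)" by (simp add: algebra_simps)
    also have "\<dots> \<le> h * (\<epsilon> / 2 + D * (\<epsilon> / (2 * D)))"
    proof (intro mult_left_mono add_mono)
      show "sqrt h \<le> \<epsilon> / (2 * D)" using h \<epsilon> D0 by (intro real_le_lsqrt) auto
    qed (use \<eta> D0 h in auto)
    also have "\<dots> = \<epsilon> * (1 - cmod x)" using D0 by (simp add: h_def)
    finally show ?thesis .
  qed
  ultimately show ?thesis by blast
qed

section \<open>Compactness on the Hilbert--Hardy space\<close>

lemma orlicz_square: "orlicz (\<lambda>x. x\<^sup>2)"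
proof
  have "(1 - t) * x\<^sup>2 + t * y\<^sup>2 - ((1 - t) * x + t * y)\<^sup>2 = t * (1 - t) * (x - y)\<^sup>2" for t x y :: real
    by (simp add: power2_eq_square algebra_simps)
  moreover have "t * (1 - t) * (x - y)\<^sup>2 > 0" if "0 < t" "t < 1" "x \<noteq> y" for t x y :: real
    using that by simp
  ultimately have "((1 - t) * x + t * y)\<^sup>2 < (1 - t) * x\<^sup>2 + t * y\<^sup>2" if "0 < t" "t < 1" "x \<noteq> y" for t x y :: real
    using that by (metis diff_gt_0_iff_gt)
  moreover have "strict_mono_on {0..} (\<lambda>x::real. x\<^sup>2)"
    by (auto simp: strict_mono_on_def intro!: power_strict_mono)
  moreover have "filterlim (\<lambda>x::real. x\<^sup>2 / x) at_top at_top"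
  proof (rule filterlim_cong[THEN iffD1, OF refl refl _ filterlim_ident])
    show "\<forall>\<^sub>F x::real in at_top. x = x\<^sup>2 / x"
      using eventually_gt_at_top[of 0] by eventually_elim (simp add: power2_eq_square)
  qed
  ultimately show "orlicz_function (\<lambda>x. x\<^sup>2)"
    unfolding orlicz_function_def by (auto intro!: continuous_intros)
qed

interpretation h2: orlicz "\<lambda>x. x\<^sup>2"
  by (rule orlicz_square)

abbreviation "H2 \<equiv> hardy_orlicz (\<lambda>x. x\<^sup>2)"
abbreviation "H2norm \<equiv> hardy_orlicz_norm (\<lambda>x. x\<^sup>2)"

lemma integrable_circle_square:
  assumes "f holomorphic_on ball 0 1" "0 \<le> r" "r < 1"
  shows "integrable circ (\<lambda>t. (cmod (f (of_real r * cis t)))\<^sup>2)"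
  by (intro integrable_circ_continuous continuous_intros continuous_on_circle holomorphic_on_imp_continuous_on assms)

text \<open>The modular of the square at \<open>C\<close> is the mean square divided by the square
  of \<open>C\<close>. This lemma and \<open>H2_normI\<close> identify the Luxemburg norm with the
  supremum of the L2 means over circles.\<close>

lemma H2_mean_le:
  assumes f: "f \<in> H2" and r: "0 \<le> r" "r < 1"
  shows "(\<integral>t. (cmod (f (of_real r * cis t)))\<^sup>2 \<partial>circ) \<le> (H2norm f)\<^sup>2"
proof -
  let ?I = "\<integral>t. (cmod (f (of_real r * cis t)))\<^sup>2 \<partial>circ"
  have "sqrt ?I \<le> H2norm f"
  proof (rule field_le_epsilon)
    fix e :: real assume "e > 0"
    then have C: "H2norm f + e > 0" using h2.norm_nonneg[of f] by linarith
    have "(\<integral>t. (cmod (f (of_real r * cis t)) / (H2norm f + e))\<^sup>2 \<partial>circ) \<le> 1"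
      using h2.modular_le_1[OF f _ r, of "H2norm f + e"] \<open>e > 0\<close> by simp
    then have "?I / (H2norm f + e)\<^sup>2 \<le> 1" by (simp add: power_divide)
    then have "?I \<le> (H2norm f + e)\<^sup>2" using C by (simp add: divide_le_eq_1)
    then show "sqrt ?I \<le> H2norm f + e" using C by (intro real_le_lsqrt) auto
  qed
  then show ?thesis using sqrt_le_D by blast
qed

lemma H2_normI:
  assumes hol: "f holomorphic_on ball 0 1" and N: "N \<ge> 0"
    and le: "\<And>r. 0 \<le> r \<Longrightarrow> r < 1 \<Longrightarrow> (\<integral>t. (cmod (f (of_real r * cis t)))\<^sup>2 \<partial>circ) \<le> N\<^sup>2"
  shows "f \<in> H2" "H2norm f \<le> N"
proof -
  have *: "f \<in> H2 \<and> H2norm f \<le> N + e" if "e > 0" for e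
  proof -
    have C: "N + e > 0" using that N by linarith
    have "(\<integral>t. (cmod (f (of_real r * cis t)) / (N + e))\<^sup>2 \<partial>circ) \<le> 1" if "0 \<le> r" "r < 1" for r
    proof -
      have "N\<^sup>2 \<le> (N + e)\<^sup>2" using N \<open>e > 0\<close> by (intro power_mono) auto
      with le[OF that] show ?thesis using C by (simp add: power_divide divide_le_eq_1)
    qed
    then show ?thesis using h2.hardy_normI[OF hol C] by blast
  qed
  show "f \<in> H2" using *[of 1] by simp
  show "H2norm f \<le> N" by (rule field_le_epsilon) (use * in blast)
qed

text \<open>Parseval on the circle of radius \<open>r\<close>, then \<open>r\<close> to 1 in each
  finite partial sum, where the limit is immediate.\<close>

lemma H2_coeff:
  assumes f: "f \<in> H2"
  obtains a where "\<And>z. z \<in> ball 0 1 \<Longrightarrow> (\<lambda>n. a n * z ^ n) sums f z"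
    "\<And>N. (\<Sum>n<N. (cmod (a n))\<^sup>2) \<le> (H2norm f)\<^sup>2"
proof
  define a where "a = (\<lambda>n. (deriv ^^ n) f 0 / fact n)"
  show s: "(\<lambda>n. a n * z ^ n) sums f z" if "z \<in> ball 0 1" for z
    using holomorphic_power_series[OF h2.hardy_holo[OF f] that] by (simp add: a_def)
  fix N
  show "(\<Sum>n<N. (cmod (a n))\<^sup>2) \<le> (H2norm f)\<^sup>2"
  proof (rule tendsto_upperbound)
    show "((\<lambda>r::real. \<Sum>n<N. (cmod (a n))\<^sup>2 * r ^ (2 * n)) \<longlongrightarrow> (\<Sum>n<N. (cmod (a n))\<^sup>2)) (at_left 1)"
      by (auto intro!: tendsto_eq_intros)
    have "eventually (\<lambda>r::real. 0 < r \<and> r < 1) (at_left 1)"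
      using eventually_at_left_real[of 0 1] by simp
    then show "\<forall>\<^sub>F r::real in at_left 1. (\<Sum>n<N. (cmod (a n))\<^sup>2 * r ^ (2 * n)) \<le> (H2norm f)\<^sup>2"
    proof eventually_elim
      case (elim r)
      have "(\<lambda>n. (cmod (a n))\<^sup>2 * r ^ (2 * n)) sums (\<integral>t. (cmod (f (of_real r * cis t)))\<^sup>2 \<partial>circ)"
        by (rule Parseval_circle[OF s]) (use elim in auto)
      then have "(\<Sum>n<N. (cmod (a n))\<^sup>2 * r ^ (2 * n)) \<le> (\<integral>t. (cmod (f (of_real r * cis t)))\<^sup>2 \<partial>circ)"
        using sum_le_suminf[of "\<lambda>n. (cmod (a n))\<^sup>2 * r ^ (2 * n)" "{..<N}"] elim by (auto simp: sums_iff)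
      also have "\<dots> \<le> (H2norm f)\<^sup>2" using H2_mean_le[OF f] elim by auto
      finally show ?case .
    qed
  qed simp
qed

text \<open>Every Taylor coefficient is bounded by the norm, which leaves a geometric series. The
  growth exponent is not sharp; the purpose is local boundedness for Montel's theorem.\<close>

lemma H2_pointwise:
  assumes f: "f \<in> H2" and z: "cmod z < 1"
  shows "cmod (f z) \<le> H2norm f / (1 - cmod z)"
proof -
  obtain a where s: "\<And>z. z \<in> ball 0 1 \<Longrightarrow> (\<lambda>n. a n * z ^ n) sums f z"
    and a: "\<And>N. (\<Sum>n<N. (cmod (a n))\<^sup>2) \<le> (H2norm f)\<^sup>2"
    using H2_coeff[OF f] by metis
  have an: "cmod (a n) \<le> H2norm f" for n
  proof -
    have "(cmod (a n))\<^sup>2 \<le> (\<Sum>n<Suc n. (cmod (a n))\<^sup>2)"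
      by (rule member_le_sum[where f = "\<lambda>n. (cmod (a n))\<^sup>2"]) auto
    then have "(cmod (a n))\<^sup>2 \<le> (H2norm f)\<^sup>2" using a[of "Suc n"] by linarith
    then show ?thesis by (rule power2_le_imp_le) (rule h2.norm_nonneg)
  qed
  have g: "(\<lambda>n. H2norm f * cmod z ^ n) sums (H2norm f * (1 / (1 - cmod z)))"
    by (intro sums_mult geometric_sums) (use z in simp)
  have "cmod (f z) = cmod (\<Sum>n. a n * z ^ n)" using s[of z] z by (simp add: sums_iff)
  also have "\<dots> \<le> (\<Sum>n. H2norm f * cmod z ^ n)"
    by (rule norm_suminf_le) (use g an in \<open>auto simp: sums_iff norm_mult norm_power intro!: mult_right_mono\<close>)
  also have "\<dots> = H2norm f / (1 - cmod z)" using g by (simp add: sums_iff)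
  finally show ?thesis .
qed

section \<open>Composition with a self-map of the disc on \<open>H2\<close>\<close>

locale self_map =
  fixes \<phi> :: "complex \<Rightarrow> complex"
  assumes holo: "\<phi> holomorphic_on ball 0 1" and self: "\<phi> ` ball 0 1 \<subseteq> ball 0 1"
begin

lemma cmod_lt_1: "cmod z < 1 \<Longrightarrow> cmod (\<phi> z) < 1"
  using self by (auto simp: image_subset_iff)

lemma continuous_circle: "0 \<le> r \<Longrightarrow> r < 1 \<Longrightarrow> continuous_on UNIV (\<lambda>t. \<phi> (of_real r * cis t))"
  by (intro continuous_on_circle holomorphic_on_imp_continuous_on holo)

lemma circle_bound:
  assumes "0 \<le> r" "r < 1"
  obtains R where "0 \<le> R" "R < 1" "\<And>t. cmod (\<phi> (of_real r * cis t)) \<le> R"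
  using circle_image_cball[OF holomorphic_on_imp_continuous_on[OF holo] self assms] by metis

lemma holomorphic_comp: "f holomorphic_on ball 0 1 \<Longrightarrow> (\<lambda>z. f (\<phi> z)) holomorphic_on ball 0 1"
  using holomorphic_on_compose_gen[OF holo _ self, of f] by (simp add: o_def)

text \<open>The circle is split according to whether its image lies beyond radius
  \<open>\<rho>\<close>: the embedding theorem handles the far part, the bound \<open>B\<close> the
  rest. For compactness \<open>A\<close> is made small through \<open>\<rho>\<close> first, and
  \<open>B\<close> through local uniform convergence afterwards.\<close>

lemma mean_comp_le:
  assumes f: "f \<in> H2" and r: "0 \<le> r" "r < 1"
    and \<rho>: "\<rho> < 1" and A: "A \<ge> 0"
    and kern: "\<And>x. \<rho> < cmod x \<Longrightarrow> cmod x < 1 \<Longrightarrow> (\<integral>\<^sup>+t. ennreal (kern x (\<phi> (of_real r * cis t))) \<partial>circ) \<le> ennreal A"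
    and B: "\<And>z. cmod z \<le> \<rho> \<Longrightarrow> cmod (f z) \<le> B"
  shows "(\<integral>t. (cmod (f (\<phi> (of_real r * cis t))))\<^sup>2 \<partial>circ) \<le> B\<^sup>2 + 32 * A * (H2norm f)\<^sup>2"
proof -
  obtain a where s: "\<And>z. z \<in> ball 0 1 \<Longrightarrow> (\<lambda>n. a n * z ^ n) sums f z"
    and a: "\<And>N. (\<Sum>n<N. (cmod (a n))\<^sup>2) \<le> (H2norm f)\<^sup>2"
    using H2_coeff[OF f] by metis
  define w where "w = (\<lambda>t. \<phi> (of_real r * cis t))"
  obtain R where R: "0 \<le> R" "R < 1" "\<And>t. cmod (w t) \<le> R"
    using circle_bound[OF r] unfolding w_def by metis
  have wm [measurable]: "w \<in> borel_measurable circ"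
    unfolding borel_measurable_circ_iff w_def by (intro borel_measurable_continuous_onI continuous_circle r)
  have w1: "w t \<in> ball 0 1" for t using R(2) R(3)[of t] by simp
  define E where "E = {t. \<rho> < cmod (w t)}"
  have E [measurable]: "E \<in> sets circ" unfolding E_def
  proof -
    have "{t \<in> space circ. \<rho> < cmod (w t)} \<in> sets circ" by measurable
    then show "{t. \<rho> < cmod (w t)} \<in> sets circ" by simp
  qed
  \<comment> \<open>After restriction to \<open>E\<close> the test condition concerns only kernels
    at points beyond radius \<open>\<rho>\<close>, exactly those bounded by
    \<open>kern\<close>.\<close>
  let ?M = "restrict_space circ E"
  have poly: "(\<integral>t. (cmod (\<Sum>n<N. a n * w t ^ n))\<^sup>2 \<partial>?M) \<le> 32 * A * (H2norm f)\<^sup>2" for N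
  proof -
    have "(\<integral>t. (cmod (\<Sum>n<N. a n * w t ^ n))\<^sup>2 \<partial>?M) \<le> 32 * A * (\<Sum>n<N. (cmod (a n))\<^sup>2)"
    proof (rule Carleson_embedding_poly[where R = R])
      show "finite_measure ?M" by (rule finite_measure_restrict_space) (use E circ.finite_measure_axioms in auto)
      show "w \<in> borel_measurable ?M" by (rule measurable_restrict_space1[OF wm])
      fix x assume x: "x \<in> space ?M"
      then have x: "\<rho> < cmod (w x)" by (simp add: space_restrict_space E_def)
      have "(\<integral>\<^sup>+s. ennreal (kern (w x) (w s)) \<partial>?M) \<le> (\<integral>\<^sup>+s. ennreal (kern (w x) (w s)) \<partial>circ)"
        using E by (subst nn_integral_restrict_space) (auto intro!: nn_integral_mono split: split_indicator)
      also have "\<dots> \<le> ennreal A" using kern[OF x] w1[of x] by (simp add: w_def)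
      finally show "(\<integral>\<^sup>+s. ennreal (kern (w x) (w s)) \<partial>?M) \<le> ennreal A" .
    qed (use R A in auto)
    also have "\<dots> \<le> 32 * A * (H2norm f)\<^sup>2" using A by (intro mult_left_mono a) auto
    finally show ?thesis .
  qed
  have sumR: "summable (\<lambda>n. cmod (a n) * R ^ n)"
  proof -
    obtain R' where R': "R < R'" "R' < 1" using R(2) dense by blast
    have "summable (\<lambda>n. a n * of_real R' ^ n)"
      using s[of "of_real R'"] R' R by (auto simp: sums_iff)
    then have "summable (\<lambda>n. norm (a n * of_real R ^ n))"
      by (rule powser_insidea) (use R R' in auto)
    then show ?thesis using R by (simp add: norm_mult norm_power)
  qed
  define b where "b = (\<Sum>n. cmod (a n) * R ^ n)"
  have lim: "(\<lambda>N. \<integral>t. (cmod (\<Sum>n<N. a n * w t ^ n))\<^sup>2 \<partial>?M) \<longlonglongrightarrow> (\<integral>t. (cmod (f (w t)))\<^sup>2 \<partial>?M)"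
  proof (rule integral_dominated_convergence[where w = "\<lambda>_. b\<^sup>2"])
    have l: "(\<lambda>N. (cmod (\<Sum>n<N. a n * w t ^ n))\<^sup>2) \<longlonglongrightarrow> (cmod (f (w t)))\<^sup>2" for t
      using s[OF w1] unfolding sums_def by (intro tendsto_intros)
    then show "AE t in ?M. (\<lambda>N. (cmod (\<Sum>n<N. a n * w t ^ n))\<^sup>2) \<longlonglongrightarrow> (cmod (f (w t)))\<^sup>2" by simp
    have m: "(\<lambda>t. (cmod (\<Sum>n<N. a n * w t ^ n))\<^sup>2) \<in> borel_measurable circ" for N
      by measurable
    show m': "(\<lambda>t. (cmod (\<Sum>n<N. a n * w t ^ n))\<^sup>2) \<in> borel_measurable ?M" for N
      by (rule measurable_restrict_space1[OF m])
    show "(\<lambda>t. (cmod (f (w t)))\<^sup>2) \<in> borel_measurable ?M"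
      by (rule borel_measurable_LIMSEQ_real[OF l m'])
    have "cmod (\<Sum>n<N. a n * w t ^ n) \<le> b" for N t
    proof -
      have "cmod (\<Sum>n<N. a n * w t ^ n) \<le> (\<Sum>n<N. cmod (a n) * R ^ n)"
        using R by (intro order_trans[OF norm_sum] sum_mono) (auto simp: norm_mult norm_power intro!: mult_left_mono power_mono)
      also have "\<dots> \<le> b" unfolding b_def using R by (intro sum_le_suminf sumR) auto
      finally show ?thesis .
    qed
    then show "AE t in ?M. norm ((cmod (\<Sum>n<N. a n * w t ^ n))\<^sup>2) \<le> b\<^sup>2" for N
      by (simp add: power_mono)
    interpret M: finite_measure ?M
      by (rule finite_measure_restrict_space) (use E circ.finite_measure_axioms in auto)
    show "integrable ?M (\<lambda>_. b\<^sup>2)" by simp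
  qed
  have far: "(\<integral>t. (cmod (f (w t)))\<^sup>2 \<partial>?M) \<le> 32 * A * (H2norm f)\<^sup>2"
    by (rule LIMSEQ_le_const2[OF lim]) (use poly in auto)
  have fw: "integrable circ (\<lambda>t. (cmod (f (w t)))\<^sup>2)"
    unfolding w_def by (rule integrable_circle_square[OF holomorphic_comp[OF h2.hardy_holo[OF f]] r])
  have "(\<integral>t. (cmod (f (w t)))\<^sup>2 \<partial>circ) \<le> (\<integral>t. B\<^sup>2 + indicator E t *\<^sub>R (cmod (f (w t)))\<^sup>2 \<partial>circ)"
  proof (rule integral_mono[OF fw])
    show "integrable circ (\<lambda>t. B\<^sup>2 + indicator E t *\<^sub>R (cmod (f (w t)))\<^sup>2)"
      using fw E by (intro Bochner_Integration.integrable_add integrable_mult_indicator) auto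
    fix t
    show "(cmod (f (w t)))\<^sup>2 \<le> B\<^sup>2 + indicator E t *\<^sub>R (cmod (f (w t)))\<^sup>2"
      using B[of "w t"] by (cases "t \<in> E") (auto simp: E_def intro!: power_mono)
  qed
  also have "\<dots> = B\<^sup>2 + (\<integral>t. indicator E t *\<^sub>R (cmod (f (w t)))\<^sup>2 \<partial>circ)"
    using integrable_mult_indicator[OF E fw] by (subst Bochner_Integration.integral_add) auto
  also have "(\<integral>t. indicator E t *\<^sub>R (cmod (f (w t)))\<^sup>2 \<partial>circ) = (\<integral>t. (cmod (f (w t)))\<^sup>2 \<partial>?M)"
    using E by (subst integral_restrict_space) auto
  finally show ?thesis using far unfolding w_def by linarith
qed


lemma H2_comp_bounded:
  assumes vanishing: "\<And>\<epsilon>. \<epsilon> > 0 \<Longrightarrow> \<exists>\<rho><1. \<forall>x r. \<rho> < cmod x \<longrightarrow> cmod x < 1 \<longrightarrow> 0 \<le> r \<longrightarrow> r < 1 \<longrightarrow>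
      (\<integral>\<^sup>+t. ennreal (kern x (\<phi> (of_real r * cis t))) \<partial>circ) \<le> ennreal \<epsilon>"
    and f: "f \<in> H2"
  shows "f \<circ> \<phi> \<in> H2"
proof -
  obtain \<rho> where \<rho>: "\<rho> < 1" "\<And>x r. \<rho> < cmod x \<Longrightarrow> cmod x < 1 \<Longrightarrow> 0 \<le> r \<Longrightarrow> r < 1 \<Longrightarrow>
      (\<integral>\<^sup>+t. ennreal (kern x (\<phi> (of_real r * cis t))) \<partial>circ) \<le> ennreal 1"
    using vanishing[of 1] by auto
  define B where "B = H2norm f / (1 - \<rho>)"
  have B: "cmod (f z) \<le> B" if "cmod z \<le> \<rho>" for z
  proof -
    have "cmod (f z) \<le> H2norm f / (1 - cmod z)" by (rule H2_pointwise[OF f]) (use that \<rho> in auto)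
    also have "\<dots> \<le> B" unfolding B_def using that \<rho> by (intro divide_left_mono h2.norm_nonneg mult_pos_pos) auto
    finally show ?thesis .
  qed
  have "(\<lambda>z. f (\<phi> z)) \<in> H2"
  proof (rule H2_normI)
    show "(\<lambda>z. f (\<phi> z)) holomorphic_on ball 0 1" by (rule holomorphic_comp[OF h2.hardy_holo[OF f]])
    fix r :: real assume r: "0 \<le> r" "r < 1"
    have "(\<integral>t. (cmod (f (\<phi> (of_real r * cis t))))\<^sup>2 \<partial>circ) \<le> B\<^sup>2 + 32 * 1 * (H2norm f)\<^sup>2"
      by (rule mean_comp_le[OF f r \<rho>(1)]) (use \<rho> r B in auto)
    then show "(\<integral>t. (cmod (f (\<phi> (of_real r * cis t))))\<^sup>2 \<partial>circ) \<le> (sqrt (B\<^sup>2 + 32 * 1 * (H2norm f)\<^sup>2))\<^sup>2"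
      by (simp add: add_nonneg_nonneg)
  qed (auto intro!: add_nonneg_nonneg)
  then show ?thesis by (simp add: o_def)
qed

text \<open>Montel's theorem gives a locally uniform limit. Within radius \<open>\<rho>\<close> the
  difference becomes uniformly small; near the boundary it is merely bounded by 2 in norm, and the
  small embedding constant compensates for that.\<close>

lemma H2_comp_subseq:
  assumes vanishing: "\<And>\<epsilon>. \<epsilon> > 0 \<Longrightarrow> \<exists>\<rho><1. \<forall>x r. \<rho> < cmod x \<longrightarrow> cmod x < 1 \<longrightarrow> 0 \<le> r \<longrightarrow> r < 1 \<longrightarrow>
      (\<integral>\<^sup>+t. ennreal (kern x (\<phi> (of_real r * cis t))) \<partial>circ) \<le> ennreal \<epsilon>"
    and F: "\<And>n::nat. F n \<in> H2" "\<And>n. H2norm (F n) \<le> 1"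
  obtains g s where "g \<in> H2" "H2norm g \<le> 1" "strict_mono (s::nat \<Rightarrow> nat)"
    "(\<lambda>n. H2norm (\<lambda>z. F (s n) (\<phi> z) - g (\<phi> z))) \<longlonglongrightarrow> 0"
proof -
  let ?H = "{f \<in> H2. H2norm f \<le> 1}"
  have bd: "\<exists>B. \<forall>h\<in>?H. \<forall>z\<in>K. cmod (h z) \<le> B" if K: "compact K" "K \<subseteq> ball 0 1" for K
  proof (cases "K = {}")
    case False
    have "compact (cmod ` K)" by (intro compact_continuous_image K continuous_intros)
    then obtain m where "m \<in> cmod ` K" and m: "\<And>x. x \<in> cmod ` K \<Longrightarrow> x \<le> m"
      using compact_attains_sup[of "cmod ` K"] False by auto
    then have m1: "m < 1" using K by auto
    have "cmod (h z) \<le> 1 / (1 - m)" if "h \<in> ?H" "z \<in> K" for h z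
    proof -
      have zm: "cmod z \<le> m" using m that by auto
      have "cmod (h z) \<le> H2norm h / (1 - cmod z)" by (rule H2_pointwise) (use that zm m1 in auto)
      also have "\<dots> \<le> 1 / (1 - m)" using that zm m1 h2.norm_nonneg[of h] by (intro frac_le) auto
      finally show ?thesis .
    qed
    then show ?thesis by blast
  qed simp
  obtain g s where g: "g holomorphic_on ball 0 1" and s: "strict_mono (s::nat \<Rightarrow> nat)"
    and unif: "\<And>K. compact K \<Longrightarrow> K \<subseteq> ball 0 1 \<Longrightarrow> uniform_limit K (F \<circ> s) g sequentially"
  proof (rule Montel[of "ball 0 1" ?H F])
    show "range F \<subseteq> ?H" using F by auto
  qed (use bd h2.hardy_holo in auto)
  have circ_sub: "range (\<lambda>t. complex_of_real r * cis t) \<subseteq> ball 0 1" if "0 \<le> r" "r < 1" for r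
    using circle_in_ball that by blast
  \<comment> \<open>Locally uniform convergence says nothing about the norm directly, so the bound
    is carried to the limit on each circle separately.\<close>
  have gle: "(\<integral>t. (cmod (g (of_real r * cis t)))\<^sup>2 \<partial>circ) \<le> 1\<^sup>2" if r: "0 \<le> r" "r < 1" for r
  proof (rule field_le_epsilon)
    fix e :: real assume "e > 0"
    obtain d where d: "d > 0" "(1 + d)\<^sup>2 \<le> 1 + e"
    proof
      show "sqrt (1 + e) - 1 > 0" using \<open>e > 0\<close> by simp
      show "(1 + (sqrt (1 + e) - 1))\<^sup>2 \<le> 1 + e" using \<open>e > 0\<close> by simp
    qed
    have "\<forall>\<^sub>F n in sequentially. \<forall>z\<in>range (\<lambda>t. complex_of_real r * cis t). dist ((F \<circ> s) n z) (g z) < d"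
      using uniform_limitD[OF unif[OF circle_compact circ_sub[OF r]] d(1)] .
    then obtain n where n: "\<And>t. cmod (F (s n) (of_real r * cis t) - g (of_real r * cis t)) < d"
      by (auto simp: eventually_sequentially dist_norm)
    let ?u = "\<lambda>t. cmod (F (s n) (of_real r * cis t))"
    have i2: "integrable circ (\<lambda>t. (?u t)\<^sup>2)" by (rule integrable_circle_square[OF h2.hardy_holo[OF F(1)] r])
    \<comment> \<open>The mixed term of the square is absorbed by the arithmetic-geometric mean
      inequality; as the mean of \<open>?u\<close> squared is at most 1, the total is
      \<open>(1 + d)\<^sup>2\<close>.\<close>
    have pt: "(cmod (g (of_real r * cis t)))\<^sup>2 \<le> (1 + d) * (?u t)\<^sup>2 + (d + d\<^sup>2)" for t
    proof -
      have "cmod (g (of_real r * cis t)) \<le> ?u t + d"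
        using n[of t] norm_triangle_ineq2[of "g (of_real r * cis t)" "F (s n) (of_real r * cis t)"]
        by (simp add: norm_minus_commute)
      then have "(cmod (g (of_real r * cis t)))\<^sup>2 \<le> (?u t + d)\<^sup>2" by (intro power_mono) auto
      also have "\<dots> = (?u t)\<^sup>2 + d * (2 * ?u t * 1) + d\<^sup>2" by (simp add: power2_eq_square algebra_simps)
      also have "\<dots> \<le> (?u t)\<^sup>2 + d * ((?u t)\<^sup>2 + 1\<^sup>2) + d\<^sup>2"
        using d by (intro add_mono mult_left_mono sum_squares_bound) auto
      finally show ?thesis by (simp add: algebra_simps)
    qed
    have "(\<integral>t. (cmod (g (of_real r * cis t)))\<^sup>2 \<partial>circ) \<le> (\<integral>t. (1 + d) * (?u t)\<^sup>2 + (d + d\<^sup>2) \<partial>circ)"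
      using i2 integrable_circle_square[OF g r] pt by (intro integral_mono) auto
    also have "\<dots> = (1 + d) * (\<integral>t. (?u t)\<^sup>2 \<partial>circ) + (d + d\<^sup>2)" using i2 by simp
    also have "\<dots> \<le> (1 + d) * 1 + (d + d\<^sup>2)"
    proof -
      have "(\<integral>t. (?u t)\<^sup>2 \<partial>circ) \<le> (H2norm (F (s n)))\<^sup>2" by (rule H2_mean_le[OF F(1) r])
      also have "\<dots> \<le> 1" using F(2) h2.norm_nonneg by (intro power_le_one) auto
      finally show ?thesis using d by (intro add_right_mono mult_left_mono) auto
    qed
    also have "\<dots> = (1 + d)\<^sup>2" by (simp add: power2_eq_square algebra_simps)
    finally show "(\<integral>t. (cmod (g (of_real r * cis t)))\<^sup>2 \<partial>circ) \<le> 1\<^sup>2 + e" using d by simp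
  qed
  have gH: "g \<in> H2" "H2norm g \<le> 1" using H2_normI[OF g _ gle] by auto
  have "(\<lambda>n. H2norm (\<lambda>z. F (s n) (\<phi> z) - g (\<phi> z))) \<longlonglongrightarrow> 0"
  proof (rule LIMSEQ_I)
    fix e :: real assume e: "e > 0"
    \<comment> \<open>The constant 1024 is chosen so that (e/4)^2 + 32 * (e^2 / 1024) * 2^2 = 3 *
      e^2 / 16, which is below (e/2)^2.\<close>
    obtain \<rho> where \<rho>: "\<rho> < 1" "\<And>x r. \<rho> < cmod x \<Longrightarrow> cmod x < 1 \<Longrightarrow> 0 \<le> r \<Longrightarrow> r < 1 \<Longrightarrow>
        (\<integral>\<^sup>+t. ennreal (kern x (\<phi> (of_real r * cis t))) \<partial>circ) \<le> ennreal (e\<^sup>2 / 1024)"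
      using vanishing[of "e\<^sup>2 / 1024"] e by auto
    have "\<forall>\<^sub>F n in sequentially. \<forall>z\<in>cball 0 \<rho>. dist ((F \<circ> s) n z) (g z) < e / 4"
      by (rule uniform_limitD[OF unif]) (use \<rho> e in auto)
    then obtain N where N': "\<And>n z. n \<ge> N \<Longrightarrow> z \<in> cball 0 \<rho> \<Longrightarrow> dist ((F \<circ> s) n z) (g z) < e / 4"
      unfolding eventually_sequentially by blast
    have N: "cmod (F (s n) z - g z) \<le> e / 4" if "n \<ge> N" "cmod z \<le> \<rho>" for n z
      using N'[OF that(1), of z] that(2) by (simp add: dist_norm)
    have "norm (H2norm (\<lambda>z. F (s n) (\<phi> z) - g (\<phi> z)) - 0) < e" if n: "n \<ge> N" for n
    proof -
      define f where "f = (\<lambda>z. F (s n) z - g z)"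
      have f: "f \<in> H2" unfolding f_def by (rule h2.hardy_diff[OF F(1) gH(1)])
      have f2: "H2norm f \<le> 2"
      proof -
        have "H2norm f \<le> H2norm (F (s n)) + H2norm (\<lambda>z. -1 * g z)"
          using h2.hardy_add(2)[OF F(1) h2.hardy_cmult(1)[OF gH(1), of "-1"], of "s n"] by (simp add: f_def)
        also have "\<dots> \<le> 1 + 1" using h2.hardy_cmult(2)[OF gH(1), of "-1"] gH(2) F(2) by (intro add_mono) auto
        finally show ?thesis by simp
      qed
      have "H2norm (\<lambda>z. f (\<phi> z)) \<le> e / 2"
      proof (rule H2_normI)
        show "(\<lambda>z. f (\<phi> z)) holomorphic_on ball 0 1" by (rule holomorphic_comp[OF h2.hardy_holo[OF f]])
        fix r :: real assume r: "0 \<le> r" "r < 1"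
        have "(\<integral>t. (cmod (f (\<phi> (of_real r * cis t))))\<^sup>2 \<partial>circ) \<le> (e/4)\<^sup>2 + 32 * (e\<^sup>2 / 1024) * (H2norm f)\<^sup>2"
          by (rule mean_comp_le[OF f r \<rho>(1)]) (use \<rho> r N[OF n] in \<open>auto simp: f_def\<close>)
        also have "\<dots> \<le> (e/4)\<^sup>2 + 32 * (e\<^sup>2 / 1024) * 2\<^sup>2"
          using f2 h2.norm_nonneg by (intro add_left_mono mult_left_mono power_mono) auto
        also have "\<dots> \<le> (e / 2)\<^sup>2" by (simp add: power2_eq_square)
        finally show "(\<integral>t. (cmod (f (\<phi> (of_real r * cis t))))\<^sup>2 \<partial>circ) \<le> (e / 2)\<^sup>2" .
      qed (use e in auto)
      then show ?thesis using e h2.norm_nonneg[of "\<lambda>z. f (\<phi> z)"] unfolding f_def by simp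
    qed
    then show "\<exists>no. \<forall>n\<ge>no. norm (H2norm (\<lambda>z. F (s n) (\<phi> z) - g (\<phi> z)) - 0) < e" by blast
  qed
  with that gH s show ?thesis by blast
qed

end

section \<open>The norm topology and sequential compactness\<close>

context orlicz
begin

text \<open>The balls generate the topology as a subbasis; by the triangle inequality they behave as
  a base, so this is the usual seminorm topology.\<close>

lemma openin_ho_norm_topology:
  assumes "openin (ho_norm_topology \<Psi>) U" "f \<in> U"
  shows "\<exists>e>0. \<forall>g\<in>hardy_orlicz \<Psi>. hardy_orlicz_norm \<Psi> (\<lambda>z. g z - f z) < e \<longrightarrow> g \<in> U"
  using openin_topology_generated_by[OF assms(1)[unfolded ho_norm_topology_def]] assms(2)
proof (induction U arbitrary: f)
  case (Int a b)
  then have f: "f \<in> a" "f \<in> b" by auto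
  from Int.IH(1)[OF f(1)] obtain e1 where e1: "e1 > 0"
    "\<forall>g\<in>hardy_orlicz \<Psi>. hardy_orlicz_norm \<Psi> (\<lambda>z. g z - f z) < e1 \<longrightarrow> g \<in> a" by blast
  from Int.IH(2)[OF f(2)] obtain e2 where e2: "e2 > 0"
    "\<forall>g\<in>hardy_orlicz \<Psi>. hardy_orlicz_norm \<Psi> (\<lambda>z. g z - f z) < e2 \<longrightarrow> g \<in> b" by blast
  from e1 e2 show ?case by (intro exI[of _ "min e1 e2"]) auto
next
  case (UN K)
  then obtain k where "k \<in> K" "f \<in> k" by auto
  from UN.IH[OF this] \<open>k \<in> K\<close> show ?case by blast
next
  case (Basis s)
  then obtain f0 r where s: "s = {g \<in> hardy_orlicz \<Psi>. hardy_orlicz_norm \<Psi> (\<lambda>z. g z - f0 z) < r}" "f0 \<in> hardy_orlicz \<Psi>"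
    by auto
  then have f: "f \<in> hardy_orlicz \<Psi>" "hardy_orlicz_norm \<Psi> (\<lambda>z. f z - f0 z) < r" using Basis by auto
  show ?case
  proof (intro exI[of _ "r - hardy_orlicz_norm \<Psi> (\<lambda>z. f z - f0 z)"] conjI ballI impI)
    fix g assume g: "g \<in> hardy_orlicz \<Psi>" "hardy_orlicz_norm \<Psi> (\<lambda>z. g z - f z) < r - hardy_orlicz_norm \<Psi> (\<lambda>z. f z - f0 z)"
    have "hardy_orlicz_norm \<Psi> (\<lambda>z. g z - f0 z) \<le> hardy_orlicz_norm \<Psi> (\<lambda>z. g z - f z) + hardy_orlicz_norm \<Psi> (\<lambda>z. f z - f0 z)"
      using hardy_add(2)[OF hardy_diff[OF g(1) f(1)] hardy_diff[OF f(1) s(2)]] by simp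
    then show "g \<in> s" using g s by simp
  qed (use f in simp)
qed simp

lemma topspace_ho_norm_topology: "topspace (ho_norm_topology \<Psi>) = hardy_orlicz \<Psi>"
  unfolding ho_norm_topology_def topology_generated_by_topspace
proof safe
  fix f assume f: "f \<in> hardy_orlicz \<Psi>"
  let ?B = "{g \<in> hardy_orlicz \<Psi>. hardy_orlicz_norm \<Psi> (\<lambda>z. g z - f z) < 1}"
  have "?B \<in> {{g \<in> hardy_orlicz \<Psi>. hardy_orlicz_norm \<Psi> (\<lambda>z. g z - f z) < r} |f r. f \<in> hardy_orlicz \<Psi> \<and> 0 < r}"
    by (intro CollectI exI[of _ f] exI[of _ "1::real"] conjI refl f) simp
  moreover have "f \<in> ?B" using f by (simp add: norm_zero)
  ultimately show "f \<in> \<Union> {{g \<in> hardy_orlicz \<Psi>. hardy_orlicz_norm \<Psi> (\<lambda>z. g z - f z) < r} |f r. f \<in> hardy_orlicz \<Psi> \<and> 0 < r}"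
    by (rule UnionI)
qed

end

lemma H2norm_eq_0_iff:
  assumes "f \<in> H2" shows "H2norm f = 0 \<longleftrightarrow> (\<forall>z\<in>ball 0 1. f z = 0)"
proof
  assume "H2norm f = 0"
  then show "\<forall>z\<in>ball 0 1. f z = 0" using H2_pointwise[OF assms] by fastforce
next
  assume "\<forall>z\<in>ball 0 1. f z = 0"
  then show "H2norm f = 0" using h2.hardy_norm_cong(2)[of f "\<lambda>z. 0"] h2.norm_zero by simp
qed

lemma H2_diff_commute:
  assumes "f \<in> H2" "g \<in> H2" shows "H2norm (\<lambda>z. f z - g z) = H2norm (\<lambda>z. g z - f z)"
  using h2.hardy_cmult(2)[OF h2.hardy_diff[OF assms], of "-1"] h2.hardy_cmult(2)[OF h2.hardy_diff[OF assms(2,1)], of "-1"]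
  by simp

text \<open>The seminorm only sees the values in the disc; functions that vanish outside it form a metric space.\<close>

lemma compactin_H2_sequentially:
  assumes K: "K \<subseteq> H2"
    and seq: "\<And>F. (\<And>n::nat. F n \<in> K) \<Longrightarrow> \<exists>l\<in>K. \<exists>s. strict_mono (s::nat \<Rightarrow> nat) \<and> (\<lambda>n. H2norm (\<lambda>z. F (s n) z - l z)) \<longlonglongrightarrow> 0"
  shows "compactin (ho_norm_topology (\<lambda>x. x\<^sup>2)) K"
proof -
  define cut where "cut = (\<lambda>f z::complex. if z \<in> ball 0 1 then f z else 0 :: complex)"
  have cutH: "cut f \<in> H2 \<longleftrightarrow> f \<in> H2" for f
    by (rule h2.hardy_norm_cong(3)) (simp add: cut_def)
  have cutn: "H2norm (\<lambda>z. cut f z - cut g z) = H2norm (\<lambda>z. f z - g z)" "H2norm (\<lambda>z. cut f z - g z) = H2norm (\<lambda>z. f z - g z)"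
     "H2norm (\<lambda>z. f z - cut g z) = H2norm (\<lambda>z. f z - g z)" for f g
    by (rule h2.hardy_norm_cong(2); simp add: cut_def)+
  define M where "M = {f \<in> H2. \<forall>z. z \<notin> ball 0 1 \<longrightarrow> f z = 0}"
  \<comment> \<open>The default 0 off \<open>H2\<close> is there because \<open>Metric_space\<close>
    requires symmetry for all arguments, not only on the carrier.\<close>
  define d where "d = (\<lambda>f g. if f \<in> H2 \<and> g \<in> H2 then H2norm (\<lambda>z. f z - g z) else 0)"
  interpret M: Metric_space M d
  proof
    show "0 \<le> d x y" for x y by (simp add: d_def h2.norm_nonneg)
    show "d x y = d y x" for x y using H2_diff_commute by (auto simp: d_def)
    show "d x y = 0 \<longleftrightarrow> x = y" if "x \<in> M" "y \<in> M" for x y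
    proof -
      have "d x y = 0 \<longleftrightarrow> (\<forall>z\<in>ball 0 1. x z = y z)"
        using that H2norm_eq_0_iff[OF h2.hardy_diff[of x y]] by (auto simp: d_def M_def)
      also have "\<dots> \<longleftrightarrow> x = y" using that unfolding M_def by force
      finally show ?thesis .
    qed
    show "d x z \<le> d x y + d y z" if "x \<in> M" "y \<in> M" "z \<in> M" for x y z
      using that h2.hardy_add(2)[OF h2.hardy_diff[of x y] h2.hardy_diff[of y z]] by (simp add: d_def M_def)
  qed
  have cM: "cut f \<in> M" if "f \<in> H2" for f using that cutH by (auto simp: M_def cut_def)
  have comp: "compactin M.mtopology (cut ` K)"
    unfolding M.compactin_sequentially
  proof (intro conjI allI impI)
    show "cut ` K \<subseteq> M" using cM K by auto
    fix \<sigma> :: "nat \<Rightarrow> complex \<Rightarrow> complex" assume "range \<sigma> \<subseteq> cut ` K"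
    then have "\<forall>n. \<exists>f. f \<in> K \<and> \<sigma> n = cut f" by auto
    from choice[OF this] obtain F where "\<forall>n. F n \<in> K \<and> \<sigma> n = cut (F n)" ..
    then have F: "\<And>n. F n \<in> K" "\<And>n. \<sigma> n = cut (F n)" by auto
    from seq[of F, OF F(1)] obtain l s where l: "l \<in> K" and s: "strict_mono (s::nat \<Rightarrow> nat)"
      and lim: "(\<lambda>n. H2norm (\<lambda>z. F (s n) z - l z)) \<longlonglongrightarrow> 0" by blast
    have "limitin M.mtopology (\<sigma> \<circ> s) (cut l) sequentially"
      unfolding M.limitin_metric
    proof (intro conjI allI impI)
      show "cut l \<in> M" using l K cM by auto
      fix e :: real assume "e > 0"
      with lim have "\<forall>\<^sub>F n in sequentially. H2norm (\<lambda>z. F (s n) z - l z) < e" by (rule order_tendstoD)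
      then show "\<forall>\<^sub>F n in sequentially. (\<sigma> \<circ> s) n \<in> M \<and> d ((\<sigma> \<circ> s) n) (cut l) < e"
        by eventually_elim (use F l K cM in \<open>auto simp: d_def cutH cutn subset_iff\<close>)
    qed
    with l s show "\<exists>l r. l \<in> cut ` K \<and> strict_mono r \<and> limitin M.mtopology (\<sigma> \<circ> r) l sequentially" by blast
  qed
  show ?thesis
    unfolding compactin_def
  proof (intro conjI allI impI)
    show "K \<subseteq> topspace (ho_norm_topology (\<lambda>x. x\<^sup>2))" using K by (simp add: h2.topspace_ho_norm_topology)
    fix \<U> assume U: "(\<forall>U\<in>\<U>. openin (ho_norm_topology (\<lambda>x. x\<^sup>2)) U) \<and> K \<subseteq> \<Union>\<U>"
    have cutU: "f \<in> U \<longleftrightarrow> cut f \<in> U" if "U \<in> \<U>" "f \<in> H2" for f U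
    proof
      assume "f \<in> U"
      then show "cut f \<in> U" using h2.openin_ho_norm_topology[of U f] U that cutH cutn(2)[of f f] h2.norm_zero by auto
    next
      assume "cut f \<in> U"
      then show "f \<in> U" using h2.openin_ho_norm_topology[of U "cut f"] U that cutH cutn(3)[of f f] h2.norm_zero by auto
    qed
    have "openin M.mtopology (U \<inter> M)" if "U \<in> \<U>" for U
      unfolding M.openin_mtopology
    proof (intro conjI allI impI)
      fix f assume f: "f \<in> U \<inter> M"
      have "openin (ho_norm_topology (\<lambda>x. x\<^sup>2)) U" using U that by blast
      moreover have "f \<in> U" using f by blast
      ultimately obtain e where e: "e > 0" "\<forall>g\<in>H2. H2norm (\<lambda>z. g z - f z) < e \<longrightarrow> g \<in> U"
        using h2.openin_ho_norm_topology by blast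
      have "M.mball f e \<subseteq> U \<inter> M"
      proof
        fix g assume "g \<in> M.mball f e"
        then have g: "f \<in> M" "g \<in> M" "d f g < e" unfolding M.in_mball by auto
        then have "g \<in> H2" "f \<in> H2" by (auto simp: M_def)
        then have "H2norm (\<lambda>z. g z - f z) < e" using g(3) H2_diff_commute[of f g] by (simp add: d_def)
        then show "g \<in> U \<inter> M" using e(2) \<open>g \<in> H2\<close> g(2) by blast
      qed
      with e show "\<exists>r>0. M.mball f r \<subseteq> U \<inter> M" by blast
    qed auto
    then have op: "\<forall>V\<in>(\<lambda>U. U \<inter> M) ` \<U>. openin M.mtopology V" by blast
    have "cut ` K \<subseteq> \<Union> ((\<lambda>U. U \<inter> M) ` \<U>)"
    proof
      fix x assume "x \<in> cut ` K"
      then obtain f where f: "f \<in> K" "x = cut f" by blast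
      then obtain V where V: "V \<in> \<U>" "f \<in> V" using U by blast
      have fH: "f \<in> H2" using f K by blast
      have "x \<in> V \<inter> M" using cutU[OF V(1) fH] V(2) cM[OF fH] f(2) by blast
      then show "x \<in> \<Union> ((\<lambda>U. U \<inter> M) ` \<U>)" using V(1) by blast
    qed
    with op have "\<exists>\<F>. finite \<F> \<and> \<F> \<subseteq> (\<lambda>U. U \<inter> M) ` \<U> \<and> cut ` K \<subseteq> \<Union>\<F>"
      using comp[unfolded compactin_def, THEN conjunct2, THEN spec, of "(\<lambda>U. U \<inter> M) ` \<U>"] by blast
    then obtain \<F> where F: "finite \<F>" "\<F> \<subseteq> (\<lambda>U. U \<inter> M) ` \<U>" "cut ` K \<subseteq> \<Union>\<F>"
      by blast
    obtain \<G> where G: "\<G> \<subseteq> \<U>" "finite \<G>" "\<F> = (\<lambda>U. U \<inter> M) ` \<G>"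
      using finite_subset_image[OF F(1,2)] by blast
    have "K \<subseteq> \<Union>\<G>"
    proof
      fix f assume f: "f \<in> K"
      then have "cut f \<in> \<Union>\<F>" using F(3) by blast
      then obtain V where V: "V \<in> \<G>" "cut f \<in> V" unfolding G(3) by blast
      have "V \<in> \<U>" "f \<in> H2" using V G f K by auto
      from cutU[OF this] V show "f \<in> \<Union>\<G>" by blast
    qed
    with G show "\<exists>\<F>. finite \<F> \<and> \<F> \<subseteq> \<U> \<and> K \<subseteq> \<Union>\<F>" by blast
  qed
qed

context self_map
begin

theorem H2_comp_op_compact:
  assumes vanishing: "\<And>\<epsilon>. \<epsilon> > 0 \<Longrightarrow> \<exists>\<rho><1. \<forall>x r. \<rho> < cmod x \<longrightarrow> cmod x < 1 \<longrightarrow> 0 \<le> r \<longrightarrow> r < 1 \<longrightarrow>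
      (\<integral>\<^sup>+t. ennreal (kern x (\<phi> (of_real r * cis t))) \<partial>circ) \<le> ennreal \<epsilon>"
  shows "comp_op_compact (\<lambda>x. x\<^sup>2) \<phi>"
  unfolding comp_op_compact_def
proof (intro conjI exI)
  show sub: "comp_op \<phi> ` H2 \<subseteq> H2"
    using H2_comp_bounded[OF vanishing] by (auto simp: comp_op_def)
  \<comment> \<open>The image of the closed ball is already compact, because the Montel limit lies
    in the closed ball.\<close>
  let ?K = "comp_op \<phi> ` ho_unit_ball (\<lambda>x. x\<^sup>2)"
  show "compactin (ho_norm_topology (\<lambda>x. x\<^sup>2)) ?K"
  proof (rule compactin_H2_sequentially)
    show "?K \<subseteq> H2" using sub by (auto simp: ho_unit_ball_def)
    fix G assume "\<And>n::nat. G n \<in> ?K"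
    then have "\<forall>n. \<exists>f. f \<in> ho_unit_ball (\<lambda>x. x\<^sup>2) \<and> G n = comp_op \<phi> f" by auto
    from choice[OF this] obtain F where "\<forall>n. F n \<in> ho_unit_ball (\<lambda>x. x\<^sup>2) \<and> G n = comp_op \<phi> (F n)" ..
    then have F: "\<And>n. F n \<in> ho_unit_ball (\<lambda>x. x\<^sup>2)" "\<And>n. G n = comp_op \<phi> (F n)" by auto
    obtain g s where "g \<in> H2" "H2norm g \<le> 1" "strict_mono (s::nat \<Rightarrow> nat)"
      "(\<lambda>n. H2norm (\<lambda>z. F (s n) (\<phi> z) - g (\<phi> z))) \<longlonglongrightarrow> 0"
      by (rule H2_comp_subseq[OF vanishing, of F]) (use F in \<open>auto simp: ho_unit_ball_def\<close>)
    then show "\<exists>l\<in>?K. \<exists>s. strict_mono (s::nat \<Rightarrow> nat) \<and> (\<lambda>n. H2norm (\<lambda>z. G (s n) z - l z)) \<longlonglongrightarrow> 0"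
      by (intro bexI[of _ "comp_op \<phi> g"] exI[of _ s]) (auto simp: F(2) comp_op_def ho_unit_ball_def)
  qed
qed simp

end

section \<open>Peak functions and averaging functionals\<close>

context orlicz
begin

lemma ex_inverse:
  assumes "u > 0" obtains y where "y > 0" "\<Psi> y = u"
proof -
  have "\<forall>\<^sub>F x in at_top. u \<le> \<Psi> x / x \<and> 1 \<le> x"
    using superlinear eventually_ge_at_top unfolding filterlim_at_top by (intro eventually_conj) auto
  then obtain x where x: "u \<le> \<Psi> x / x" "1 \<le> x" unfolding eventually_at_top_linorder by auto
  have "u * 1 \<le> u * x" using assms x by (intro mult_left_mono) auto
  also have "\<dots> \<le> \<Psi> x" using x by (simp add: field_simps)
  finally have "u \<le> \<Psi> x" by simp
  moreover have "continuous_on {0..x} \<Psi>" by (rule continuous_on_subset[OF cont]) auto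
  ultimately obtain y where "0 \<le> y" "\<Psi> y = u" using IVT'[of \<Psi> 0 u x] assms x by auto
  moreover from this assms have "y \<noteq> 0" by auto
  ultimately show ?thesis using that[of y] by simp
qed

text \<open>The choice is unique for positive \<open>u\<close> by strict monotonicity, and arbitrary
  for other \<open>u\<close>.\<close>

definition inverse_fn :: "real \<Rightarrow> real" where
  "inverse_fn u = (SOME y. y > 0 \<and> \<Psi> y = u)"

lemma inverse_fn: "u > 0 \<Longrightarrow> inverse_fn u > 0" "u > 0 \<Longrightarrow> \<Psi> (inverse_fn u) = u"
proof -
  assume "u > 0"
  then obtain y where "y > 0 \<and> \<Psi> y = u" using ex_inverse by blast
  then have "inverse_fn u > 0 \<and> \<Psi> (inverse_fn u) = u"
    unfolding inverse_fn_def by (rule someI)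
  then show "inverse_fn u > 0" "\<Psi> (inverse_fn u) = u" by auto
qed

lemma le_cancel: "\<Psi> x \<le> \<Psi> y \<Longrightarrow> 0 \<le> x \<Longrightarrow> 0 \<le> y \<Longrightarrow> x \<le> y"
  using strict[of y x] by (meson not_le)

lemma inverse_fn_at_top: "filterlim inverse_fn at_top at_top"
  unfolding filterlim_at_top_gt[where c = 0]
proof (intro allI impI)
  fix Z :: real assume Z: "Z > 0"
  show "\<forall>\<^sub>F u in at_top. Z \<le> inverse_fn u"
    using eventually_ge_at_top[of "\<Psi> Z"]
  proof eventually_elim
    case (elim u)
    then have "u > 0" using pos[OF Z] by linarith
    then show ?case using elim inverse_fn[of u] Z by (auto intro: le_cancel[of Z "inverse_fn u"])
  qed
qed

lemma inverse_fn_sublinear: "((\<lambda>u. inverse_fn u / u) \<longlongrightarrow> 0) at_top"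
proof -
  have "filterlim (\<lambda>u. \<Psi> (inverse_fn u) / inverse_fn u) at_top at_top"
    by (rule filterlim_compose[OF superlinear inverse_fn_at_top])
  then have "((\<lambda>u. inverse (\<Psi> (inverse_fn u) / inverse_fn u)) \<longlongrightarrow> 0) at_top"
    by (rule tendsto_inverse_0_at_top)
  moreover have "\<forall>\<^sub>F u in at_top. inverse (\<Psi> (inverse_fn u) / inverse_fn u) = inverse_fn u / u"
    using eventually_gt_at_top[of 0] by eventually_elim (simp add: inverse_fn)
  ultimately show ?thesis using tendsto_cong by fast
qed

text \<open>The amplitude at which a function concentrated on a set of measure about
  \<open>h\<close> has modular about 1.\<close>

definition height :: "real \<Rightarrow> real" where "height h = inverse_fn (1 / h)"

lemma height: "h > 0 \<Longrightarrow> height h > 0" "h > 0 \<Longrightarrow> \<Psi> (height h) = 1 / h"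
  by (simp_all add: height_def inverse_fn)

lemma at_top_recip: "filterlim (\<lambda>h::real. 1 / h) at_top (at_right 0)"
  using filterlim_inverse_at_top_right by (simp add: inverse_eq_divide)

lemma height_at_top: "filterlim height at_top (at_right 0)"
  unfolding height_def by (rule filterlim_compose[OF inverse_fn_at_top at_top_recip])

lemma height_mult_tendsto_0: "((\<lambda>h. height h * h) \<longlongrightarrow> 0) (at_right 0)"
  using filterlim_compose[OF inverse_fn_sublinear at_top_recip] by (simp add: height_def)

text \<open>Concavity of the inverse of \<open>\<Psi>\<close>, proved through convexity. It lets the
  normalising levels be compared with the peak heights at a loss of one factor
  \<open>\<eta>\<close>.\<close>

lemma height_scale:
  assumes "0 < \<eta>" "\<eta> \<le> 1" "h > 0" shows "\<eta> * height (\<eta> * h) \<le> height h"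
proof (rule le_cancel)
  have "\<Psi> (\<eta> * height (\<eta> * h)) \<le> \<eta> * \<Psi> (height (\<eta> * h))"
    using assms height(1)[of "\<eta> * h"] by (intro scale_le) auto
  also have "\<dots> = \<Psi> (height h)" using assms by (simp add: height)
  finally show "\<Psi> (\<eta> * height (\<eta> * h)) \<le> \<Psi> (height h)" .
qed (use assms height(1)[of h] height(1)[of "\<eta> * h"] in auto)

definition peak :: "complex \<Rightarrow> complex \<Rightarrow> complex" where
  "peak x z = of_real (height (1 - cmod x)) * ((of_real (1 - cmod x))\<^sup>2 / (1 - cnj x * z)\<^sup>2)"

lemma cmod_peak: "cmod x < 1 \<Longrightarrow> cmod (peak x z) = height (1 - cmod x) * bump x z"
  using height(1)[of "1 - cmod x"] unfolding peak_def bump_def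
  by (simp add: norm_mult norm_divide norm_power del: of_real_diff)

lemma peak_holomorphic: "cmod x < 1 \<Longrightarrow> peak x holomorphic_on ball 0 1"
  unfolding peak_def using cmod_one_minus_pos by (intro holomorphic_intros) fastforce

text \<open>By convexity the bump factor moves out of \<open>\<Psi>\<close>, leaving the bump times
  \<open>\<Psi> (height h) = 1 / h\<close>; the mean of the bump is at most
  \<open>h\<close>.\<close>

lemma peak_unit_ball: assumes x: "cmod x < 1" shows "peak x \<in> ho_unit_ball \<Psi>"
proof -
  have "(\<integral>t. \<Psi> (cmod (peak x (of_real r * cis t)) / 1) \<partial>circ) \<le> 1" if r: "0 \<le> r" "r < 1" for r
  proof -
    let ?h = "1 - cmod x"
    have c: "continuous_on UNIV (\<lambda>t. bump x (of_real r * cis t))"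
      using r x by (intro continuous_bump_comp continuous_intros) (auto simp: norm_mult)
    have "(\<integral>t. \<Psi> (cmod (peak x (of_real r * cis t)) / 1) \<partial>circ) \<le> (\<integral>t. (1 / ?h) * bump x (of_real r * cis t) \<partial>circ)"
    proof (rule integral_mono)
      show "integrable circ (\<lambda>t. \<Psi> (cmod (peak x (of_real r * cis t)) / 1))"
        by (intro integrable_circ_continuous continuous_on_modular peak_holomorphic x r) simp
      show "integrable circ (\<lambda>t. (1 / ?h) * bump x (of_real r * cis t))"
        by (intro integrable_circ_continuous continuous_intros c)
      fix t
      have "\<Psi> (bump x (of_real r * cis t) * height ?h) \<le> bump x (of_real r * cis t) * \<Psi> (height ?h)"
        using r x height(1)[of ?h] by (intro scale_le bump_nonneg bump_le_1) (auto simp: norm_mult)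
      then show "\<Psi> (cmod (peak x (of_real r * cis t)) / 1) \<le> (1 / ?h) * bump x (of_real r * cis t)"
        using x height(2)[of ?h] by (simp add: cmod_peak mult.commute)
    qed
    also have "\<dots> = (1 / ?h) * (\<integral>t. bump x (of_real r * cis t) \<partial>circ)" by simp
    also have "\<dots> \<le> (1 / ?h) * ?h" using x by (intro mult_left_mono mean_bump_le r) auto
    finally show ?thesis using x by simp
  qed
  from hardy_normI[OF peak_holomorphic[OF x] zero_less_one this] show ?thesis
    by (simp add: ho_unit_ball_def)
qed

text \<open>The parameter \<open>v\<close> stands for the size that a function of unit norm can have
  in average over \<open>E\<close>: dividing by it makes the functional bounded as soon as
  \<open>1 \<le> \<Psi> v * measure circ E\<close>. The factor \<open>p\<close> is a phase to be
  adapted to one function.\<close>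

definition avg :: "real set \<Rightarrow> (real \<Rightarrow> complex) \<Rightarrow> real \<Rightarrow> real \<Rightarrow> (complex \<Rightarrow> complex) \<Rightarrow> complex" where
  "avg E p r v F = (\<integral>t. indicator E t *\<^sub>R (F (of_real r * cis t) * p t) \<partial>circ) / of_real (measure circ E * v)"

context
  fixes E :: "real set" and p :: "real \<Rightarrow> complex" and r v :: real
  assumes E: "E \<in> sets borel" "measure circ E > 0"
    and p: "p \<in> borel_measurable borel" "\<And>t. cmod (p t) \<le> 1"
    and r: "0 \<le> r" "r < 1" and v: "v > 0" "1 \<le> \<Psi> v * measure circ E"
begin

lemma avg_integrable:
  assumes F: "F holomorphic_on ball 0 1"
  shows "integrable circ (\<lambda>t. indicator E t *\<^sub>R (F (of_real r * cis t) * p t))"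
proof -
  have c: "continuous_on UNIV (\<lambda>t. F (of_real r * cis t))"
    by (intro continuous_on_circle holomorphic_on_imp_continuous_on F r)
  show ?thesis
  proof (rule Bochner_Integration.integrable_bound)
    show "integrable circ (\<lambda>t. F (of_real r * cis t))" by (rule integrable_circ_continuous[OF c])
    show "(\<lambda>t. indicator E t *\<^sub>R (F (of_real r * cis t) * p t)) \<in> borel_measurable circ"
      unfolding borel_measurable_circ_iff using E p borel_measurable_continuous_onI[OF c] by measurable
    show "AE t in circ. norm (indicator E t *\<^sub>R (F (of_real r * cis t) * p t)) \<le> norm (F (of_real r * cis t))"
      using p(2) by (auto simp: norm_mult mult_right_le_one_le split: split_indicator)
  qed
qed

lemma avg_linear:
  assumes "F holomorphic_on ball 0 1" "G holomorphic_on ball 0 1"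
  shows "avg E p r v (\<lambda>z. a * F z + b * G z) = a * avg E p r v F + b * avg E p r v G"
proof -
  have "(\<integral>t. indicator E t *\<^sub>R ((a * F (of_real r * cis t) + b * G (of_real r * cis t)) * p t) \<partial>circ)
      = (\<integral>t. a * (indicator E t *\<^sub>R (F (of_real r * cis t) * p t)) + b * (indicator E t *\<^sub>R (G (of_real r * cis t) * p t)) \<partial>circ)"
    by (intro Bochner_Integration.integral_cong refl) (simp add: scaleR_conv_of_real algebra_simps)
  also have "\<dots> = a * (\<integral>t. indicator E t *\<^sub>R (F (of_real r * cis t) * p t) \<partial>circ) + b * (\<integral>t. indicator E t *\<^sub>R (G (of_real r * cis t) * p t) \<partial>circ)"
    by (subst Bochner_Integration.integral_add[OF integrable_mult_right[OF avg_integrable[OF assms(1)]] integrable_mult_right[OF avg_integrable[OF assms(2)]]])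
       (simp only: integral_mult_right_zero)
  finally show ?thesis by (simp add: avg_def add_divide_distrib)
qed

lemma indicator_integral: "(\<integral>t. indicator E t * (c::real) \<partial>circ) = measure circ E * c"
  using E by simp

lemma avg_le_integral:
  assumes F: "F holomorphic_on ball 0 1"
  shows "cmod (avg E p r v F) \<le> (\<integral>t. indicator E t * cmod (F (of_real r * cis t)) \<partial>circ) / (measure circ E * v)"
proof -
  have "cmod (\<integral>t. indicator E t *\<^sub>R (F (of_real r * cis t) * p t) \<partial>circ) \<le> (\<integral>t. indicator E t * cmod (F (of_real r * cis t)) \<partial>circ)"
  proof (rule order_trans[OF integral_norm_bound integral_mono])
    show "integrable circ (\<lambda>t. norm (indicator E t *\<^sub>R (F (of_real r * cis t) * p t)))"
      by (rule integrable_norm[OF avg_integrable[OF F]])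
    have "integrable circ (\<lambda>t. cmod (F (of_real r * cis t)))"
      by (intro integrable_circ_continuous continuous_intros continuous_on_circle holomorphic_on_imp_continuous_on F r)
    from integrable_mult_indicator[OF _ this, of E] E
    show "integrable circ (\<lambda>t. indicator E t * cmod (F (of_real r * cis t)))" by simp
    show "norm (indicator E t *\<^sub>R (F (of_real r * cis t) * p t)) \<le> indicator E t * cmod (F (of_real r * cis t))" for t
      using p(2)[of t] by (auto simp: norm_mult mult_right_le_one_le split: split_indicator)
  qed
  then show ?thesis unfolding avg_def using E(2) v(1) by (simp add: norm_divide divide_right_mono norm_mult del: of_real_mult)
qed

text \<open>Used for the off-diagonal values: it is small when the function is small on this
  particular circle, or bounded there by much less than \<open>v\<close>.\<close>

lemma avg_bounded_on:
  assumes F: "F holomorphic_on ball 0 1" and B: "\<And>t. cmod (F (of_real r * cis t)) \<le> B"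
  shows "cmod (avg E p r v F) \<le> B / v"
proof -
  have "integrable circ (\<lambda>t. cmod (F (of_real r * cis t)))"
    by (intro integrable_circ_continuous continuous_intros continuous_on_circle holomorphic_on_imp_continuous_on F r)
  from integrable_mult_indicator[OF _ this, of E] E
  have i: "integrable circ (\<lambda>t. indicator E t * cmod (F (of_real r * cis t)))" by simp
  have "(\<integral>t. indicator E t * cmod (F (of_real r * cis t)) \<partial>circ) \<le> (\<integral>t. indicator E t * B \<partial>circ)"
    using E by (intro integral_mono i) (auto intro!: mult_left_mono B integrable_mult_left simp: circ.emeasure_eq_measure)
  also have "\<dots> = measure circ E * B" by (rule indicator_integral)
  finally have "(\<integral>t. indicator E t * cmod (F (of_real r * cis t)) \<partial>circ) / (measure circ E * v) \<le> measure circ E * B / (measure circ E * v)"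
    using E(2) v(1) by (intro divide_right_mono) auto
  with avg_le_integral[OF F] show ?thesis using E(2) by simp
qed

text \<open>A hands-on form of Jensen's inequality: \<open>a \<le> v (1 + \<Psi> a / \<Psi> v)\<close> for all \<open>a \<ge> 0\<close>.\<close>

lemma avg_bounded:
  assumes F: "F \<in> hardy_orlicz \<Psi>"
  shows "cmod (avg E p r v F) \<le> 2 * hardy_orlicz_norm \<Psi> F"
proof (rule field_le_epsilon)
  fix e :: real assume e: "e > 0"
  define C where "C = hardy_orlicz_norm \<Psi> F + e / 2"
  have C: "C > 0" "C > hardy_orlicz_norm \<Psi> F" using e norm_nonneg[of F] by (auto simp: C_def)
  note hol = hardy_holo[OF F]
  let ?G = "\<lambda>t. \<Psi> (cmod (F (of_real r * cis t)) / C)"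
  have Pv: "\<Psi> v > 0" by (rule pos[OF v(1)])
  have y: "a \<le> v * (1 + \<Psi> a / \<Psi> v)" if "a \<ge> 0" for a
  proof (cases "a \<le> v")
    case True
    have "v * 1 \<le> v * (1 + \<Psi> a / \<Psi> v)" using Pv nonneg[OF that] v by (intro mult_left_mono) auto
    with True show ?thesis by simp
  next
    case False
    then have a: "a > 0" "v / a \<le> 1" using v by auto
    have "\<Psi> ((v / a) * a) \<le> (v / a) * \<Psi> a" using a v by (intro scale_le) auto
    then have "\<Psi> v * a \<le> v * \<Psi> a" using a by (simp add: field_simps)
    then have "a \<le> v * (\<Psi> a / \<Psi> v)" using Pv by (simp add: field_simps)
    then show ?thesis using v by (simp add: distrib_left)
  qed
  have i1: "integrable circ (\<lambda>t. cmod (F (of_real r * cis t)))"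
    by (intro integrable_circ_continuous continuous_intros continuous_on_circle holomorphic_on_imp_continuous_on hol r)
  from integrable_mult_indicator[OF _ this, of E] E
  have i: "integrable circ (\<lambda>t. indicator E t * cmod (F (of_real r * cis t)))" by simp
  have i2: "integrable circ ?G" by (intro integrable_circ_continuous continuous_on_modular hol r C)
  have i3: "integrable circ (\<lambda>t. indicator E t * (C * v))" using E by (auto simp: circ.emeasure_eq_measure)
  \<comment> \<open>The constant term of the pointwise inequality is integrated over
    \<open>E\<close> only, the \<open>\<Psi>\<close> term over the whole circle, where its integral
    is at most 1. The two contributions are equally large, whence the factor 2.\<close>
  have "(\<integral>t. indicator E t * cmod (F (of_real r * cis t)) \<partial>circ) \<le> (\<integral>t. indicator E t * (C * v) + C * v / \<Psi> v * ?G t \<partial>circ)"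
  proof (rule integral_mono[OF i])
    show "integrable circ (\<lambda>t. indicator E t * (C * v) + C * v / \<Psi> v * ?G t)"
      by (intro Bochner_Integration.integrable_add integrable_mult_right i2 i3)
    fix t
    have g: "?G t \<ge> 0" using C by (intro nonneg) auto
    have "cmod (F (of_real r * cis t)) = C * (cmod (F (of_real r * cis t)) / C)" using C by simp
    also have "\<dots> \<le> C * (v * (1 + ?G t / \<Psi> v))" using C by (intro mult_left_mono y) auto
    also have "\<dots> = C * v + C * v / \<Psi> v * ?G t" by (simp add: algebra_simps)
    finally show "indicator E t * cmod (F (of_real r * cis t)) \<le> indicator E t * (C * v) + C * v / \<Psi> v * ?G t"
      using g C v Pv by (auto split: split_indicator)
  qed
  also have "\<dots> = (\<integral>t. indicator E t * (C * v) \<partial>circ) + C * v / \<Psi> v * (\<integral>t. ?G t \<partial>circ)"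
    by (subst Bochner_Integration.integral_add[OF i3 integrable_mult_right[OF i2]]) simp
  also have "\<dots> = measure circ E * (C * v) + C * v / \<Psi> v * (\<integral>t. ?G t \<partial>circ)"
    unfolding indicator_integral ..
  also have "\<dots> \<le> measure circ E * (C * v) + C * v / \<Psi> v * (\<Psi> v * measure circ E)"
  proof (intro add_left_mono mult_left_mono)
    show "(\<integral>t. ?G t \<partial>circ) \<le> \<Psi> v * measure circ E"
      using modular_le_1[OF F C(2) r] v(2) by linarith
  qed (use C v Pv in auto)
  also have "\<dots> = 2 * C * (measure circ E * v)" using Pv by simp
  finally have "(\<integral>t. indicator E t * cmod (F (of_real r * cis t)) \<partial>circ) / (measure circ E * v) \<le> 2 * C"
    using E(2) v(1) by (simp add: divide_le_eq)
  with avg_le_integral[OF hol] show "cmod (avg E p r v F) \<le> 2 * hardy_orlicz_norm \<Psi> F + e"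
    by (simp add: C_def)
qed

end

text \<open>The phase turns the integrand into its modulus, so nothing cancels. At zeros of
  \<open>F\<close> the quotient is 0 by convention, which agrees with the modulus.\<close>

lemma avg_phase_ge:
  assumes E: "E \<in> sets borel" "measure circ E > 0" and r: "0 \<le> r" "r < 1" and v: "v > 0"
    and F: "F holomorphic_on ball 0 1" and b: "b > 0" "\<And>t. t \<in> E \<Longrightarrow> b \<le> cmod (F (of_real r * cis t))"
  shows "b / v \<le> cmod (avg E (\<lambda>t. cnj (F (of_real r * cis t)) / of_real (cmod (F (of_real r * cis t)))) r v F)"
proof -
  have "integrable circ (\<lambda>t. cmod (F (of_real r * cis t)))"
    by (intro integrable_circ_continuous continuous_intros continuous_on_circle holomorphic_on_imp_continuous_on F r)
  from integrable_mult_indicator[OF _ this, of E] E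
  have i: "integrable circ (\<lambda>t. indicator E t * cmod (F (of_real r * cis t)))" by simp
  let ?I = "\<integral>t. indicator E t * cmod (F (of_real r * cis t)) \<partial>circ"
  have "w * (cnj w / of_real (cmod w)) = of_real (cmod w)" for w :: complex
    by (cases "w = 0") (simp_all add: complex_norm_square[symmetric] power2_eq_square)
  then have "(\<integral>t. indicator E t *\<^sub>R (F (of_real r * cis t) * (cnj (F (of_real r * cis t)) / of_real (cmod (F (of_real r * cis t))))) \<partial>circ)
      = (\<integral>t. of_real (indicator E t * cmod (F (of_real r * cis t))) \<partial>circ)"
    by (simp add: scaleR_conv_of_real)
  also have "\<dots> = of_real ?I" by (rule integral_complex_of_real)
  finally have e: "avg E (\<lambda>t. cnj (F (of_real r * cis t)) / of_real (cmod (F (of_real r * cis t)))) r v F = of_real (?I / (measure circ E * v))"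
    unfolding avg_def by simp
  have "measure circ E * b = (\<integral>t. indicator E t * b \<partial>circ)" using E by simp
  also have "\<dots> \<le> ?I"
    using E b by (intro integral_mono i) (auto simp: circ.emeasure_eq_measure split: split_indicator)
  finally have "measure circ E * b / (measure circ E * v) \<le> ?I / (measure circ E * v)"
    using E v by (intro divide_right_mono) auto
  then have "b / v \<le> ?I / (measure circ E * v)" using E by simp
  then show ?thesis unfolding e norm_of_real by linarith
qed

end

context orlicz
begin

text \<open>Pointwise, only the last non-negligible summand matters: the earlier ones are bounded by
  \<open>S\<close>, the later ones by a geometric tail. Convexity separates that summand from the
  rest, so \<open>\<Psi>\<close> is evaluated at \<open>y k / \<beta>\<close> and never at
  \<open>y k\<close>. The number \<open>c\<close> carries the discarded tail through the
  induction.\<close>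

lemma lacunary_sum_modular:
  fixes y b S :: "nat \<Rightarrow> real"
  assumes \<beta>: "\<beta> > 1" and B: "B \<ge> 2 * \<beta>" "B \<ge> 4 * \<Psi> 1"
    and y: "\<And>k. y k > 0" and b: "\<And>k. 0 \<le> b k" "\<And>k. b k \<le> 1" and S: "\<And>N. (\<Sum>k<N. y k) \<le> S N"
    and c: "0 \<le> c" "c \<le> 2 * (1/2) ^ N"
  shows "\<Psi> (((\<Sum>k<N. y k * b k) + c) / B) \<le> 1/2 + (\<Sum>k<N. b k * (2 ^ k * y k * \<Psi> (S k + 2) + \<Psi> (y k / \<beta>)))"
  using c
proof (induction N arbitrary: c)
  case 0
  \<comment> \<open>If every summand was negligible, only the tail remains; the condition
    \<open>B \<ge> 4 * \<Psi> 1\<close> makes its contribution at most 1/2.\<close>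
  have "\<Psi> (c / B) \<le> \<Psi> ((2 / B) * 1)" using 0 B \<beta> by (intro mono) (auto intro!: divide_right_mono)
  also have "\<dots> \<le> (2 / B) * \<Psi> 1" using B \<beta> by (intro scale_le) auto
  also have "\<dots> \<le> 1/2" using B \<beta> by (simp add: field_simps)
  finally show ?case by simp
next
  case (Suc N)
  have S0: "S k \<ge> 0" for k using S[of k] sum_nonneg[of "{..<k}" y] y by (smt (verit) less_imp_le)
  have nn: "0 \<le> b k * (2 ^ k * y k * \<Psi> (S k + 2) + \<Psi> (y k / \<beta>))" for k
    using b[of k] y[of k] \<beta> S0[of k] by (intro mult_nonneg_nonneg add_nonneg_nonneg nonneg) auto
  show ?case
  proof (cases "y N * b N \<le> (1/2) ^ N")
    \<comment> \<open>A negligible summand joins the tail: (1/2)^N plus the old bound, again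
      (1/2)^N, is the bound allowed for \<open>N\<close>.\<close>
    case True
    have "\<Psi> (((\<Sum>k<N. y k * b k) + (y N * b N + c)) / B) \<le> 1/2 + (\<Sum>k<N. b k * (2 ^ k * y k * \<Psi> (S k + 2) + \<Psi> (y k / \<beta>)))"
      by (rule Suc.IH) (use True Suc.prems y[of N] b[of N] in auto)
    then show ?thesis using nn[of N] by (simp add: add.assoc)
  next
    case False
    let ?s = "\<Sum>k<N. y k * b k"
    have s: "?s \<le> S N" "0 \<le> ?s"
    proof -
      have "?s \<le> (\<Sum>k<N. y k)" using y b by (intro sum_mono) (simp add: mult_left_le less_imp_le)
      then show "?s \<le> S N" using S[of N] by linarith
      show "0 \<le> ?s" using y b by (intro sum_nonneg mult_nonneg_nonneg) (auto intro: less_imp_le)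
    qed
    have c2: "c \<le> 2" using Suc.prems power_le_one[of "1/2::real" N] by simp
    have yb: "0 \<le> y N * b N" using y[of N] b[of N] by auto
    have "(?s + y N * b N + c) / B \<le> (S N + 2 + y N * b N) / (2 * \<beta>)"
      using s c2 B \<beta> yb Suc.prems by (intro frac_le) auto
    also have "\<dots> = (1 - 1/2) * ((S N + 2) / \<beta>) + 1/2 * (y N * b N / \<beta>)"
      using \<beta> by (simp add: field_simps)
    finally have "\<Psi> ((?s + y N * b N + c) / B) \<le> \<Psi> ((1 - 1/2) * ((S N + 2) / \<beta>) + 1/2 * (y N * b N / \<beta>))"
      using s Suc.prems yb B \<beta> by (intro mono) auto
    also have "\<dots> \<le> (1 - 1/2) * \<Psi> ((S N + 2) / \<beta>) + 1/2 * \<Psi> (y N * b N / \<beta>)"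
      using \<beta> S0[of N] yb by (intro convex_ineq) auto
    also have "\<dots> \<le> 1 * \<Psi> (S N + 2) + 1 * (b N * \<Psi> (y N / \<beta>))"
    proof (intro add_mono mult_mono)
      have "(S N + 2) / \<beta> \<le> (S N + 2) / 1" using \<beta> S0[of N] by (intro divide_left_mono) auto
      then show "\<Psi> ((S N + 2) / \<beta>) \<le> \<Psi> (S N + 2)" using \<beta> S0[of N] by (intro mono) auto
      have "\<Psi> (b N * (y N / \<beta>)) \<le> b N * \<Psi> (y N / \<beta>)" using b[of N] y[of N] \<beta> by (intro scale_le) auto
      then show "\<Psi> (y N * b N / \<beta>) \<le> b N * \<Psi> (y N / \<beta>)" by (simp add: mult.commute)
    qed (use \<beta> S0[of N] yb in \<open>auto intro!: nonneg\<close>)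
    \<comment> \<open>As the summand is not negligible, \<open>1 \<le> 2 ^ N * (y N * b N)\<close>.
      Inserting this factor attaches a weight \<open>b N\<close> to the constant
      \<open>\<Psi> (S N + 2)\<close>, so that its integral will be small.\<close>
    also have "\<dots> \<le> b N * (2 ^ N * y N * \<Psi> (S N + 2) + \<Psi> (y N / \<beta>))"
    proof -
      have "1 \<le> 2 ^ N * (y N * b N)" using False by (simp add: power_divide field_simps)
      then have "1 * \<Psi> (S N + 2) \<le> 2 ^ N * (y N * b N) * \<Psi> (S N + 2)"
        using S0[of N] by (intro mult_right_mono nonneg) auto
      then show ?thesis by (simp add: algebra_simps)
    qed
    also have "\<dots> \<le> 1/2 + (\<Sum>k<Suc N. b k * (2 ^ k * y k * \<Psi> (S k + 2) + \<Psi> (y k / \<beta>)))"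
      using sum_nonneg[of "{..<N}" "\<lambda>k. b k * (2 ^ k * y k * \<Psi> (S k + 2) + \<Psi> (y k / \<beta>))"] nn by simp
    finally show ?thesis by (simp add: add.assoc)
  qed
qed

text \<open>\<open>S\<close> stands for the total height of the earlier peaks and
  \<open>\<rho>\<close> for a radius containing the images of the earlier circles. In order: earlier
  peaks are negligible for the new functional; the new peak is negligible on earlier circles;
  normalising levels are at least 1; the last two clauses control the two integrals that arise from
  \<open>lacunary_sum_modular\<close>, with \<open>D\<close> left open for the growth
  condition.\<close>

definition sparse :: "real \<Rightarrow> (real \<Rightarrow> real) \<Rightarrow> nat \<Rightarrow> real \<Rightarrow> real \<Rightarrow> real \<Rightarrow> bool" where
  "sparse \<eta> D n S \<rho> h \<longleftrightarrow>
     S \<le> \<eta>\<^sup>2 / 8 * (1/2) ^ n * height (\<eta> * h) \<and>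
     height h * h\<^sup>2 / (1 - \<rho>)\<^sup>2 \<le> \<eta>\<^sup>2 / 8 * (1/2) ^ n \<and>
     1 \<le> height (\<eta> * h) \<and>
     2 ^ n * (height h * h) * \<Psi> (S + 2) \<le> (1/2) ^ n / 8 \<and>
     D h \<le> (1/2) ^ n / 8"

lemma eventually_sparse:
  assumes \<eta>: "\<eta> > 0" and D: "(D \<longlongrightarrow> 0) (at_right 0)"
  shows "\<exists>h0>0. \<forall>h. 0 < h \<longrightarrow> h < h0 \<longrightarrow> sparse \<eta> D n S \<rho> h"
proof -
  define \<epsilon> where "\<epsilon> = \<eta>\<^sup>2 / 8 * (1/2) ^ n"
  have \<epsilon>: "\<epsilon> > 0" using \<eta> by (simp add: \<epsilon>_def)
  have "filterlim (\<lambda>h. \<eta> * h) (at_right 0) (at_right 0)"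
    by (rule filterlim_times_pos[OF filterlim_ident \<eta>]) simp
  then have hz: "filterlim (\<lambda>h. height (\<eta> * h)) at_top (at_right 0)"
    by (rule filterlim_compose[OF height_at_top])
  then have "\<forall>\<^sub>F h in at_right 0. max 1 (S / \<epsilon>) \<le> height (\<eta> * h)"
    unfolding filterlim_at_top by blast
  moreover have "((\<lambda>h. (height h * h) * h / (1 - \<rho>)\<^sup>2) \<longlongrightarrow> 0 * 0 / (1 - \<rho>)\<^sup>2) (at_right 0)"
    unfolding divide_inverse by (intro tendsto_mult height_mult_tendsto_0 tendsto_const) (auto intro: tendsto_ident_at)
  then have "\<forall>\<^sub>F h in at_right 0. (height h * h) * h / (1 - \<rho>)\<^sup>2 < \<epsilon>"
    by (rule order_tendstoD) (use \<epsilon> in simp)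
  moreover have "((\<lambda>h. 2 ^ n * (height h * h) * \<Psi> (S + 2)) \<longlongrightarrow> 2 ^ n * 0 * \<Psi> (S + 2)) (at_right 0)"
    by (intro tendsto_mult height_mult_tendsto_0 tendsto_const)
  then have "\<forall>\<^sub>F h in at_right 0. 2 ^ n * (height h * h) * \<Psi> (S + 2) < (1/2) ^ n / 8"
    by (rule order_tendstoD) simp
  moreover have "\<forall>\<^sub>F h in at_right 0. D h < (1/2) ^ n / 8"
    by (rule order_tendstoD[OF D]) simp
  ultimately have "\<forall>\<^sub>F h in at_right 0. sparse \<eta> D n S \<rho> h"
  proof eventually_elim
    case (elim h)
    have "S / \<epsilon> \<le> height (\<eta> * h)" "1 \<le> height (\<eta> * h)" using elim(1) by auto
    then have "S \<le> \<epsilon> * height (\<eta> * h)" using \<epsilon> by (simp add: field_simps)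
    then show ?case using elim \<open>1 \<le> height (\<eta> * h)\<close> unfolding sparse_def \<epsilon>_def by (simp add: power2_eq_square mult.assoc)
  qed
  then show ?thesis unfolding eventually_at_right_field by auto
qed

lemma hardy_sum:
  assumes "finite I" "\<And>i. i \<in> I \<Longrightarrow> f i \<in> hardy_orlicz \<Psi>"
  shows "(\<lambda>z. \<Sum>i\<in>I. f i z) \<in> hardy_orlicz \<Psi>"
  using assms by (induction I) (auto intro: hardy_zero hardy_add(1))

text \<open>A cluster point \<open>L\<close> of the functionals \<open>\<Lambda> n\<close> in the product topology belongs to the dual;
  the sets \<open>{|\<Lambda> n| < c}\<close> and \<open>{|L| > c/2}\<close> cover everything, but no finite subfamily catches all \<open>V N\<close>.\<close>

lemma weakly_compact_contradiction:
  assumes K: "compactin (ho_weak_topology \<Psi>) K" and V: "\<And>N. V N \<in> K"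
    and bd: "\<And>n f. f \<in> hardy_orlicz \<Psi> \<Longrightarrow> cmod (\<Lambda> n f) \<le> C * hardy_orlicz_norm \<Psi> f"
    and lin: "\<And>n f g a b. f \<in> hardy_orlicz \<Psi> \<Longrightarrow> g \<in> hardy_orlicz \<Psi> \<Longrightarrow> \<Lambda> n (\<lambda>z. a * f z + b * g z) = a * \<Lambda> n f + b * \<Lambda> n g"
    and c: "c > 0" and large: "\<And>n N. n < N \<Longrightarrow> c \<le> cmod (\<Lambda> n (V N))"
    and small: "\<And>N. (\<lambda>n. \<Lambda> n (V N)) \<longlonglongrightarrow> 0"
  shows False
proof -
  let ?H = "hardy_orlicz \<Psi>"
  have "K \<subseteq> topspace (ho_weak_topology \<Psi>)" by (rule compactin_subset_topspace[OF K])
  also have "\<dots> \<subseteq> ?H" unfolding ho_weak_topology_def topology_generated_by_topspace by auto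
  finally have KH: "K \<subseteq> ?H" .
  \<comment> \<open>Replacing the functionals by 0 off \<open>hardy_orlicz\<close>, where their
    values are uncontrolled, places all of them in one product of closed discs.\<close>
  define \<Lambda>' where "\<Lambda>' = (\<lambda>n f. if f \<in> ?H then \<Lambda> n f else 0)"
  define P where "P = (\<Pi>\<^sub>E f\<in>UNIV. cball (0::complex) (if f \<in> ?H then C * hardy_orlicz_norm \<Psi> f else 0))"
  have "compactin (product_topology (\<lambda>_. euclidean) UNIV) P"
    unfolding P_def by (subst compactin_PiE) auto
  then have "compact P" by (simp add: euclidean_product_topology)
  moreover have "\<forall>\<^sub>F x in filtermap \<Lambda>' sequentially. x \<in> P"
    unfolding eventually_filtermap by (rule always_eventually) (auto simp: P_def \<Lambda>'_def bd)
  moreover have "filtermap \<Lambda>' sequentially \<noteq> bot" by (simp add: filtermap_bot_iff)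
  ultimately obtain L where L: "L \<in> P" "inf (nhds L) (filtermap \<Lambda>' sequentially) \<noteq> bot"
    unfolding compact_filter by blast
  \<comment> \<open>The cluster point is pulled back to a proper filter on the indices, finer than
    \<open>sequentially\<close>, along which the functionals converge pointwise on
    \<open>hardy_orlicz\<close>.\<close>
  define G where "G = inf (filtercomap \<Lambda>' (nhds L)) sequentially"
  have G: "G \<noteq> bot"
  proof
    assume "G = bot"
    then have "eventually (\<lambda>_. False) G" by simp
    then obtain Q R where Q: "eventually Q (filtercomap \<Lambda>' (nhds L))" and R: "eventually R sequentially" and QR: "\<And>x. Q x \<Longrightarrow> R x \<Longrightarrow> False"
      unfolding G_def eventually_inf by auto
    from Q obtain Q' where Q': "eventually Q' (nhds L)" "\<And>x. Q' (\<Lambda>' x) \<Longrightarrow> Q x"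
      unfolding eventually_filtercomap by auto
    have "eventually (\<lambda>x. \<not> Q' x) (filtermap \<Lambda>' sequentially)"
      unfolding eventually_filtermap using R by eventually_elim (use QR Q' in blast)
    then have "eventually (\<lambda>_. False) (inf (nhds L) (filtermap \<Lambda>' sequentially))"
      unfolding eventually_inf using Q'(1) by (intro exI[of _ Q'] exI[of _ "\<lambda>x. \<not> Q' x"]) auto
    then show False using L(2) by (simp add: trivial_limit_def)
  qed
  have lim: "((\<lambda>n. \<Lambda> n f) \<longlongrightarrow> L f) G" if f: "f \<in> ?H" for f
  proof -
    have "filterlim \<Lambda>' (nhds L) G" unfolding G_def filterlim_iff_le_filtercomap by simp
    moreover have "((\<lambda>x. x f) \<longlongrightarrow> L f) (nhds L)"
    proof (rule topological_tendstoI)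
      fix S :: "complex set" assume S: "open S" "L f \<in> S"
      have "open ((\<lambda>x. x f) -` S)" by (rule open_vimage[OF S(1) continuous_on_product_coordinates])
      then show "\<forall>\<^sub>F x in nhds L. x f \<in> S" using S(2) unfolding eventually_nhds by blast
    qed
    ultimately have "((\<lambda>n. \<Lambda>' n f) \<longlongrightarrow> L f) G" by (rule filterlim_compose[rotated])
    then show ?thesis using f by (simp add: \<Lambda>'_def)
  qed
  have Gs: "G \<le> sequentially" by (simp add: G_def)
  have Ldual: "L \<in> ho_dual \<Psi>"
    unfolding ho_dual_def
  proof (intro CollectI conjI ballI allI exI)
    fix f g a b assume fg: "f \<in> ?H" "g \<in> ?H"
    have h: "(\<lambda>z. a * f z + b * g z) \<in> ?H" using hardy_add(1)[OF hardy_cmult(1)[OF fg(1)] hardy_cmult(1)[OF fg(2)]] .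
    have "((\<lambda>n. a * \<Lambda> n f + b * \<Lambda> n g) \<longlongrightarrow> a * L f + b * L g) G" by (intro tendsto_intros lim fg)
    then have "((\<lambda>n. \<Lambda> n (\<lambda>z. a * f z + b * g z)) \<longlongrightarrow> a * L f + b * L g) G" by (simp add: lin[OF fg])
    from tendsto_unique[OF G lim[OF h] this] show "L (\<lambda>z. a * f z + b * g z) = a * L f + b * L g" .
  next
    fix f assume "f \<in> ?H"
    then show "cmod (L f) \<le> C * hardy_orlicz_norm \<Psi> f" using L(1) by (auto simp: P_def PiE_iff dest!: spec[of _ f])
  qed
  have \<Lambda>dual: "\<Lambda> n \<in> ho_dual \<Psi>" for n
    unfolding ho_dual_def using bd lin by blast
  have LV: "L (V N) = 0" for N
    by (rule tendsto_unique[OF G lim]) (use KH V tendsto_mono[OF Gs small] in auto)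
  define W where "W = (\<lambda>n. {f \<in> ?H. \<Lambda> n f \<in> ball 0 c})"
  define W' where "W' = {f \<in> ?H. L f \<in> - cball 0 (c / 2)}"
  have oW: "openin (ho_weak_topology \<Psi>) (W n)" for n
    unfolding ho_weak_topology_def W_def by (rule topology_generated_by_Basis) (use \<Lambda>dual in blast)
  have oW': "openin (ho_weak_topology \<Psi>) W'"
    unfolding ho_weak_topology_def W'_def by (rule topology_generated_by_Basis) (use Ldual in blast)
  have cov: "K \<subseteq> \<Union>(insert W' (range W))"
  proof
    fix f assume "f \<in> K"
    then have f: "f \<in> ?H" using KH by auto
    show "f \<in> \<Union>(insert W' (range W))"
    proof (cases "\<exists>n. cmod (\<Lambda> n f) < c")
      case True
      then show ?thesis using f by (auto simp: W_def)
    next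
      case False
      have "c \<le> cmod (L f)"
        by (rule tendsto_lowerbound[OF tendsto_norm[OF lim[OF f]] _ G]) (use False in \<open>auto simp: not_less\<close>)
      then show ?thesis using f c by (auto simp: W'_def)
    qed
  qed
  have "\<exists>\<F>. finite \<F> \<and> \<F> \<subseteq> insert W' (range W) \<and> K \<subseteq> \<Union>\<F>"
    using K[unfolded compactin_def, THEN conjunct2, THEN spec, of "insert W' (range W)"] oW oW' cov by blast
  then obtain \<F> where F: "finite \<F>" "\<F> \<subseteq> insert W' (range W)" "K \<subseteq> \<Union>\<F>" by blast
  have "finite (\<F> - {W'})" "\<F> - {W'} \<subseteq> range W" using F by auto
  then obtain J where J: "finite J" "\<F> - {W'} = W ` J" using finite_subset_image[of "\<F> - {W'}" W UNIV] by auto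
  obtain N where N: "\<And>n. n \<in> J \<Longrightarrow> n < N" using J(1) finite_nat_iff_bounded by (metis lessThan_iff subsetD)
  have "V N \<in> \<Union>\<F>" using F(3) V by blast
  then obtain X where X: "X \<in> \<F>" "V N \<in> X" by blast
  show False
  proof (cases "X = W'")
    case True
    then show False using X LV c by (auto simp: W'_def)
  next
    case False
    then obtain n where n: "n \<in> J" "X = W n" using X J by blast
    then have "cmod (\<Lambda> n (V N)) < c" using X by (simp add: W_def)
    with large[OF N[OF n(1)]] show False by simp
  qed
qed

text \<open>Finitely many balls of radius \<open>c\<close> cover \<open>K\<close>, so two members of
  the sequence share a ball. The functional \<open>\<Lambda> n\<close> moves each by at most
  \<open>2 * c\<close> to the centre, and \<open>8 * c \<le> 2 * c + 2 * c + c\<close> is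
  absurd.\<close>

lemma norm_compact_contradiction:
  assumes K: "compactin (ho_norm_topology \<Psi>) K" and u: "\<And>n::nat. u n \<in> K"
    and bd: "\<And>n f. f \<in> hardy_orlicz \<Psi> \<Longrightarrow> cmod (\<Lambda> n f) \<le> 2 * hardy_orlicz_norm \<Psi> f"
    and lin: "\<And>n f g a b. f \<in> hardy_orlicz \<Psi> \<Longrightarrow> g \<in> hardy_orlicz \<Psi> \<Longrightarrow> \<Lambda> n (\<lambda>z. a * f z + b * g z) = a * \<Lambda> n f + b * \<Lambda> n g"
    and c: "c > 0" and diag: "\<And>n. 8 * c \<le> cmod (\<Lambda> n (u n))" and cross: "\<And>n m. n \<noteq> m \<Longrightarrow> cmod (\<Lambda> n (u m)) \<le> c"
  shows False
proof -
  let ?H = "hardy_orlicz \<Psi>"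
  have KH: "K \<subseteq> ?H" using compactin_subset_topspace[OF K] topspace_ho_norm_topology by simp
  define W where "W = (\<lambda>g. {f \<in> ?H. hardy_orlicz_norm \<Psi> (\<lambda>z. f z - g z) < c})"
  have oW: "openin (ho_norm_topology \<Psi>) (W g)" if "g \<in> ?H" for g
    unfolding ho_norm_topology_def W_def by (rule topology_generated_by_Basis) (use that c in blast)
  have cov: "K \<subseteq> \<Union>(W ` K)" using KH c by (auto simp: W_def norm_zero)
  have "\<exists>\<F>. finite \<F> \<and> \<F> \<subseteq> W ` K \<and> K \<subseteq> \<Union>\<F>"
    using K[unfolded compactin_def, THEN conjunct2, THEN spec, of "W ` K"] oW KH cov by blast
  then obtain \<F> where F: "finite \<F>" "\<F> \<subseteq> W ` K" "K \<subseteq> \<Union>\<F>" by blast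
  obtain J where J: "J \<subseteq> K" "finite J" "\<F> = W ` J" using finite_subset_image[OF F(1,2)] by blast
  have "\<forall>n. \<exists>g. g \<in> J \<and> u n \<in> W g" using F(3) u unfolding J(3) by blast
  from choice[OF this] obtain ch where ch: "\<And>n. ch n \<in> J" "\<And>n. u n \<in> W (ch n)" by blast
  have "finite (range ch)" using ch(1) J(2) by (meson finite_subset image_subsetI)
  then have "\<not> inj ch" using finite_imageD[of ch UNIV] by auto
  then obtain n m where nm: "n \<noteq> m" "ch n = ch m" by (auto simp: inj_def)
  define g where "g = ch n"
  have H: "g \<in> ?H" "u n \<in> ?H" "u m \<in> ?H" using ch J KH u unfolding g_def by auto
  have d: "cmod (\<Lambda> n f - \<Lambda> n g) \<le> 2 * c" if "f \<in> W g" for f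
  proof -
    have f: "f \<in> ?H" "hardy_orlicz_norm \<Psi> (\<lambda>z. f z - g z) < c" using that by (auto simp: W_def)
    have "\<Lambda> n (\<lambda>z. 1 * f z + (-1) * g z) = 1 * \<Lambda> n f + (-1) * \<Lambda> n g" by (rule lin[OF f(1) H(1)])
    then have "cmod (\<Lambda> n f - \<Lambda> n g) = cmod (\<Lambda> n (\<lambda>z. f z - g z))" by simp
    also have "\<dots> \<le> 2 * hardy_orlicz_norm \<Psi> (\<lambda>z. f z - g z)" by (rule bd[OF hardy_diff[OF f(1) H(1)]])
    finally show ?thesis using f(2) by simp
  qed
  have "cmod (\<Lambda> n (u n) - \<Lambda> n g) \<le> 2 * c" "cmod (\<Lambda> n (u m) - \<Lambda> n g) \<le> 2 * c"
    using d ch(2)[of n] ch(2)[of m] nm unfolding g_def by auto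
  moreover have "cmod (\<Lambda> n (u n)) \<le> cmod (\<Lambda> n (u n) - \<Lambda> n g) + cmod (\<Lambda> n (u m) - \<Lambda> n g) + cmod (\<Lambda> n (u m))"
    using norm_triangle_ineq2[of "\<Lambda> n (u n)" "\<Lambda> n g"] norm_triangle_ineq3[of "\<Lambda> n g" "\<Lambda> n (u m)"]
      norm_minus_commute[of "\<Lambda> n g" "\<Lambda> n (u m)"] by linarith
  ultimately show False using diag[of n] cross[OF nm(1)] c by linarith
qed

end

section \<open>Compactness forces small level sets\<close>

lemma sum_half_powers_le: "(\<Sum>k\<in>A. (1/2::real) ^ k) \<le> 2" if "A \<subseteq> {..<N}" for A :: "nat set"
proof -
  have "(\<Sum>k\<in>A. (1/2::real) ^ k) \<le> (\<Sum>k<N. (1/2) ^ k)" using that by (intro sum_mono2) auto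
  also have "\<dots> \<le> 2" by (simp add: sum_gp_strict)
  finally show ?thesis .
qed

locale orlicz_self_map = orlicz \<Psi> + self_map \<phi> for \<Psi> :: "real \<Rightarrow> real" and \<phi> :: "complex \<Rightarrow> complex"
begin

definition big_level :: "real \<Rightarrow> complex \<Rightarrow> real \<Rightarrow> bool" where
  "big_level \<eta> x r \<longleftrightarrow> cmod x < 1 \<and> 0 \<le> r \<and> r < 1 \<and>
     \<eta> * (1 - cmod x) < measure circ {t. \<eta> \<le> bump x (\<phi> (of_real r * cis t))}"

text \<open>Dependent choice, with \<open>S\<close> and \<open>\<rho>\<close> carried in the state
  as the record of the past. Each stage asks only that the distance of the new point from the circle
  be small, which \<open>bad\<close> can always supply.\<close>

lemma sparse_sequence:
  assumes \<eta>: "\<eta> > 0" and D: "(D \<longlongrightarrow> 0) (at_right 0)"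
    and bad: "\<And>h0. h0 > 0 \<Longrightarrow> \<exists>x r. big_level \<eta> x r \<and> 1 - cmod x < h0"
  obtains x r S \<rho> where "\<And>n::nat. big_level \<eta> (x n) (r n)" "\<And>n. sparse \<eta> D n (S n) (\<rho> n) (1 - cmod (x n))"
    "\<And>n. (\<Sum>k<n. height (1 - cmod (x k))) \<le> S n" "\<And>n. \<rho> n < 1"
    "\<And>m n t. m < n \<Longrightarrow> cmod (\<phi> (of_real (r m) * cis t)) \<le> \<rho> n"
proof -
  define P where "P = (\<lambda>n (x, r, S, \<rho>). big_level \<eta> x r \<and> sparse \<eta> D n S \<rho> (1 - cmod x) \<and> \<rho> < 1 \<and> 0 \<le> S)"
  define Q where "Q = (\<lambda>(n::nat) (x, r, S, \<rho>) (x'::complex, r'::real, S', \<rho>').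
     S' = S + height (1 - cmod x) \<and> \<rho> \<le> \<rho>' \<and> (\<forall>t. cmod (\<phi> (of_real r * cis t)) \<le> \<rho>'))"
  have ex: "\<exists>x r. big_level \<eta> x r \<and> sparse \<eta> D n S \<rho> (1 - cmod x)" for n S \<rho>
  proof -
    obtain h0 where h0: "h0 > 0" "\<And>h. 0 < h \<Longrightarrow> h < h0 \<Longrightarrow> sparse \<eta> D n S \<rho> h"
      using eventually_sparse[OF \<eta> D] by blast
    obtain x r where x: "big_level \<eta> x r" "1 - cmod x < h0" using bad[OF h0(1)] by blast
    then have "sparse \<eta> D n S \<rho> (1 - cmod x)" by (intro h0(2)) (auto simp: big_level_def)
    with x show ?thesis by blast
  qed
  have "\<exists>f. \<forall>n. P n (f n) \<and> Q n (f n) (f (Suc n))"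
  proof (rule dependent_nat_choice)
    obtain x r where "big_level \<eta> x r" "sparse \<eta> D 0 0 0 (1 - cmod x)" using ex[of 0 0 0] by blast
    then have "P 0 (x, r, 0, 0)" by (simp add: P_def)
    then show "\<exists>s. P 0 s" ..
  next
    fix s n assume s: "P n s"
    obtain x r S \<rho> where sd: "s = (x, r, S, \<rho>)" by (cases s)
    have s': "big_level \<eta> x r" "\<rho> < 1" "0 \<le> S" using s by (auto simp: sd P_def)
    then have r: "0 \<le> r" "r < 1" and x: "cmod x < 1" by (auto simp: big_level_def)
    obtain R where R: "R < 1" "\<And>t. cmod (\<phi> (of_real r * cis t)) \<le> R" using circle_bound[OF r] by metis
    obtain x' r' where x': "big_level \<eta> x' r'" "sparse \<eta> D (Suc n) (S + height (1 - cmod x)) (max \<rho> R) (1 - cmod x')"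
      using ex by blast
    have "P (Suc n) (x', r', S + height (1 - cmod x), max \<rho> R)"
      using x' s' R height(1)[of "1 - cmod x"] x by (simp add: P_def)
    moreover have "Q n s (x', r', S + height (1 - cmod x), max \<rho> R)"
      using R(2) by (simp add: Q_def sd le_max_iff_disj)
    ultimately show "\<exists>y. P (Suc n) y \<and> Q n s y" by blast
  qed
  then obtain f where f: "\<And>n. P n (f n)" "\<And>n. Q n (f n) (f (Suc n))" by blast
  define x r S \<rho> where "x = (\<lambda>n. fst (f n))" and "r = (\<lambda>n. fst (snd (f n)))" and "S = (\<lambda>n. fst (snd (snd (f n))))"
    and "\<rho> = (\<lambda>n. snd (snd (snd (f n))))"
  have P: "big_level \<eta> (x n) (r n)" "sparse \<eta> D n (S n) (\<rho> n) (1 - cmod (x n))" "\<rho> n < 1" "0 \<le> S n" for n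
    using f(1)[of n] by (auto simp: P_def x_def r_def S_def \<rho>_def split: prod.splits)
  have Q: "S (Suc n) = S n + height (1 - cmod (x n))" "\<rho> n \<le> \<rho> (Suc n)" "cmod (\<phi> (of_real (r n) * cis t)) \<le> \<rho> (Suc n)" for n t
    using f(2)[of n] by (auto simp: Q_def x_def r_def S_def \<rho>_def split: prod.splits)
  have sumS: "(\<Sum>k<n. height (1 - cmod (x k))) \<le> S n" for n
    by (induction n) (use P Q in \<open>auto simp: add_right_mono\<close>)
  have "cmod (\<phi> (of_real (r m) * cis t)) \<le> \<rho> n" if "m < n" for m n t
  proof -
    have "\<rho> (Suc m) \<le> \<rho> n" by (rule lift_Suc_mono_le[of \<rho>]) (use Q that in auto)
    with Q(3)[of m t] show ?thesis by linarith
  qed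
  with P sumS that show ?thesis by blast
qed

text \<open>The interface between the common construction and the two compactness arguments.
  Off-diagonal values are at most an eighth of the diagonal bound, and they decay geometrically so
  that they can also be summed.\<close>

definition almost_biorthogonal ::
  "real \<Rightarrow> (real \<Rightarrow> real) \<Rightarrow> (nat \<Rightarrow> complex) \<Rightarrow> (nat \<Rightarrow> real) \<Rightarrow> (nat \<Rightarrow> real) \<Rightarrow>
    (nat \<Rightarrow> (complex \<Rightarrow> complex) \<Rightarrow> complex) \<Rightarrow> bool" where
  "almost_biorthogonal \<eta> D x S \<rho> \<Lambda> \<longleftrightarrow>
    (\<forall>n. cmod (x n) < 1) \<and> (\<forall>n. sparse \<eta> D n (S n) (\<rho> n) (1 - cmod (x n))) \<and>
    (\<forall>n. (\<Sum>k<n. height (1 - cmod (x k))) \<le> S n) \<and>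
    (\<forall>n. \<forall>f\<in>hardy_orlicz \<Psi>. cmod (\<Lambda> n f) \<le> 2 * hardy_orlicz_norm \<Psi> f) \<and>
    (\<forall>n. \<forall>f\<in>hardy_orlicz \<Psi>. \<forall>g\<in>hardy_orlicz \<Psi>. \<forall>a b. \<Lambda> n (\<lambda>z. a * f z + b * g z) = a * \<Lambda> n f + b * \<Lambda> n g) \<and>
    (\<forall>n. \<eta>\<^sup>2 \<le> cmod (\<Lambda> n (comp_op \<phi> (peak (x n))))) \<and>
    (\<forall>n. (\<Sum>m<n. cmod (\<Lambda> n (comp_op \<phi> (peak (x m))))) \<le> \<eta>\<^sup>2 / 8 * (1/2) ^ n) \<and>
    (\<forall>n m. n < m \<longrightarrow> cmod (\<Lambda> n (comp_op \<phi> (peak (x m)))) \<le> \<eta>\<^sup>2 / 8 * (1/2) ^ m)"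

lemmas almost_biorthogonalD =
  almost_biorthogonal_def[THEN iffD1, THEN conjunct1, rule_format]
  almost_biorthogonal_def[THEN iffD1, THEN conjunct2, THEN conjunct1, rule_format]
  almost_biorthogonal_def[THEN iffD1, THEN conjunct2, THEN conjunct2, THEN conjunct1, rule_format]
  almost_biorthogonal_def[THEN iffD1, THEN conjunct2, THEN conjunct2, THEN conjunct2, THEN conjunct1, rule_format]
  almost_biorthogonal_def[THEN iffD1, THEN conjunct2, THEN conjunct2, THEN conjunct2, THEN conjunct2, THEN conjunct1, rule_format]
  almost_biorthogonal_def[THEN iffD1, THEN conjunct2, THEN conjunct2, THEN conjunct2, THEN conjunct2, THEN conjunct2, THEN conjunct1, rule_format]
  almost_biorthogonal_def[THEN iffD1, THEN conjunct2, THEN conjunct2, THEN conjunct2, THEN conjunct2, THEN conjunct2, THEN conjunct2, THEN conjunct1, rule_format]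
  almost_biorthogonal_def[THEN iffD1, THEN conjunct2, THEN conjunct2, THEN conjunct2, THEN conjunct2, THEN conjunct2, THEN conjunct2, THEN conjunct2, rule_format]

lemma biorthogonal_sequence:
  assumes \<eta>: "\<eta> > 0" and D: "(D \<longlongrightarrow> 0) (at_right 0)"
    and bad: "\<And>h0. h0 > 0 \<Longrightarrow> \<exists>x r. big_level \<eta> x r \<and> 1 - cmod x < h0"
    and self_hardy: "comp_op \<phi> ` hardy_orlicz \<Psi> \<subseteq> hardy_orlicz \<Psi>"
  obtains x S \<rho> \<Lambda> where "almost_biorthogonal \<eta> D x S \<rho> \<Lambda>"
proof -
  obtain x r S \<rho> where xs: "\<And>n::nat. big_level \<eta> (x n) (r n)" "\<And>n. sparse \<eta> D n (S n) (\<rho> n) (1 - cmod (x n))"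
    "\<And>n. (\<Sum>k<n. height (1 - cmod (x k))) \<le> S n" "\<And>n. \<rho> n < 1"
    "\<And>m n t. m < n \<Longrightarrow> cmod (\<phi> (of_real (r m) * cis t)) \<le> \<rho> n"
    using sparse_sequence[OF \<eta> D bad] by metis
  have x1: "cmod (x n) < 1" and r: "0 \<le> r n" "r n < 1" for n using xs(1)[of n] by (auto simp: big_level_def)
  define h where "h = (\<lambda>n. 1 - cmod (x n))"
  have h: "h n > 0" for n using x1 by (simp add: h_def)
  define w where "w = (\<lambda>n t. \<phi> (of_real (r n) * cis t))"
  have w1: "cmod (w n t) < 1" for n t unfolding w_def using r[of n] by (intro cmod_lt_1) (simp add: norm_mult)
  define E where "E = (\<lambda>n. {t. \<eta> \<le> bump (x n) (w n t)})"
  have Em: "E n \<in> sets borel" for n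
  proof -
    have "continuous_on UNIV (\<lambda>t. bump (x n) (w n t))"
      by (rule continuous_bump_comp[OF _ w1 x1]) (use continuous_circle[OF r] in \<open>simp add: w_def\<close>)
    from borel_measurable_continuous_onI[OF this] show ?thesis by (simp add: E_def)
  qed
  have E: "\<eta> * h n < measure circ (E n)" for n using xs(1)[of n] by (simp add: big_level_def E_def h_def w_def)
  then have E0: "measure circ (E n) > 0" for n using \<eta> h[of n] by (meson less_trans mult_pos_pos)
  \<comment> \<open>Needed for \<open>height_scale\<close>: a level set of positive measure is
    nonempty, and bumps never exceed 1.\<close>
  have \<eta>1: "\<eta> \<le> 1"
  proof -
    have "E 0 \<noteq> {}" using E0[of 0] by auto
    then obtain t where "\<eta> \<le> bump (x 0) (w 0 t)" by (auto simp: E_def)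
    also have "\<dots> \<le> 1" by (rule bump_le_1[OF x1 less_imp_le[OF w1]])
    finally show ?thesis .
  qed
  define u where "u = (\<lambda>n. comp_op \<phi> (peak (x n)))"
  have uH: "u n \<in> hardy_orlicz \<Psi>" for n
    using self_hardy peak_unit_ball[OF x1[of n]] by (auto simp: u_def ho_unit_ball_def)
  note uhol = hardy_holo[OF uH]
  have cu: "cmod (u n (of_real (r k) * cis t)) = height (h n) * bump (x n) (w k t)" for n k t
    unfolding u_def comp_op_def by (simp add: cmod_peak[OF x1] h_def w_def)
  \<comment> \<open>The level belongs to \<open>\<eta> * h n\<close> and not to \<open>h n\<close>,
    since only \<open>\<eta> * h n\<close> is known to lie below the measure of
    \<open>E n\<close>.\<close>
  define v where "v = (\<lambda>n. height (\<eta> * h n))"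
  have v0: "v n > 0" and v1: "1 \<le> \<Psi> (v n) * measure circ (E n)" for n
  proof -
    have "\<eta> * h n > 0" using \<eta> h by simp
    then show "v n > 0" "1 \<le> \<Psi> (v n) * measure circ (E n)"
      using height[of "\<eta> * h n"] E[of n] by (auto simp: v_def le_divide_eq_1_pos)
  qed
  define p where "p = (\<lambda>n t. cnj (u n (of_real (r n) * cis t)) / of_real (cmod (u n (of_real (r n) * cis t))))"
  have pm: "p n \<in> borel_measurable borel" for n
  proof -
    have [measurable]: "(\<lambda>t. u n (of_real (r n) * cis t)) \<in> borel_measurable borel"
      by (intro borel_measurable_continuous_onI continuous_on_circle holomorphic_on_imp_continuous_on uhol r)
    show ?thesis unfolding p_def by measurable
  qed
  have p1: "cmod (p n t) \<le> 1" for n t unfolding p_def by (simp add: norm_divide)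
  define \<Lambda> where "\<Lambda> = (\<lambda>n. avg (E n) (p n) (r n) (v n))"
  note ctx = Em E0 pm p1 r v0 v1
  have bound: "cmod (\<Lambda> n (u m)) \<le> B / v n" if "\<And>t. bump (x m) (w n t) * height (h m) \<le> B" for n m B
    unfolding \<Lambda>_def
  proof (rule avg_bounded_on[OF ctx uhol])
    show "cmod (u m (of_real (r n) * cis t)) \<le> B" for t
      unfolding cu using that[of t] by (simp add: mult.commute)
  qed
  have sp: "S n \<le> \<eta>\<^sup>2 / 8 * (1/2) ^ n * v n" "height (h n) * (h n)\<^sup>2 / (1 - \<rho> n)\<^sup>2 \<le> \<eta>\<^sup>2 / 8 * (1/2) ^ n" "1 \<le> v n" for n
    using xs(2)[of n] unfolding sparse_def h_def v_def by blast+
  have "almost_biorthogonal \<eta> D x S \<rho> \<Lambda>"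
    unfolding almost_biorthogonal_def
  proof (intro conjI allI ballI impI)
    show "cmod (\<Lambda> n f) \<le> 2 * hardy_orlicz_norm \<Psi> f" if "f \<in> hardy_orlicz \<Psi>" for n f
      unfolding \<Lambda>_def by (rule avg_bounded[OF ctx that])
    show "\<Lambda> n (\<lambda>z. a * f z + b * g z) = a * \<Lambda> n f + b * \<Lambda> n g" if "f \<in> hardy_orlicz \<Psi>" "g \<in> hardy_orlicz \<Psi>" for n f g a b
      unfolding \<Lambda>_def by (rule avg_linear[OF ctx hardy_holo[OF that(1)] hardy_holo[OF that(2)]])
    show "\<eta>\<^sup>2 \<le> cmod (\<Lambda> n (comp_op \<phi> (peak (x n))))" for n
    proof -
      have "\<eta> * v n \<le> height (h n)" unfolding v_def by (rule height_scale[OF \<eta> \<eta>1 h])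
      then have "\<eta> * (\<eta> * v n) \<le> \<eta> * height (h n)" using \<eta> by (intro mult_left_mono) auto
      then have "\<eta>\<^sup>2 \<le> \<eta> * height (h n) / v n" using v0[of n] by (simp add: power2_eq_square le_divide_eq)
      also have "\<dots> \<le> cmod (\<Lambda> n (u n))"
        unfolding \<Lambda>_def p_def
      proof (rule avg_phase_ge[OF Em E0 r v0 uhol])
        show "\<eta> * height (h n) > 0" using \<eta> height(1)[OF h] by simp
        fix t assume "t \<in> E n"
        then have "\<eta> * height (h n) \<le> bump (x n) (w n t) * height (h n)"
          using height(1)[OF h[of n]] by (intro mult_right_mono) (auto simp: E_def)
        then show "\<eta> * height (h n) \<le> cmod (u n (of_real (r n) * cis t))" unfolding cu by (simp add: mult.commute)
      qed
      finally show ?thesis by (simp add: u_def)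
    qed
    show "(\<Sum>m<n. cmod (\<Lambda> n (comp_op \<phi> (peak (x m))))) \<le> \<eta>\<^sup>2 / 8 * (1/2) ^ n" for n
    proof -
      have "(\<Sum>m<n. cmod (\<Lambda> n (u m))) \<le> (\<Sum>m<n. height (h m) / v n)"
        using height(1)[OF h] by (intro sum_mono bound mult_left_le_one_le bump_nonneg bump_le_1 x1 less_imp_le[OF w1]) (auto intro: less_imp_le)
      also have "\<dots> \<le> S n / v n" unfolding sum_divide_distrib[symmetric] h_def using xs(3)[of n] v0[of n] by (intro divide_right_mono) auto
      also have "\<dots> \<le> \<eta>\<^sup>2 / 8 * (1/2) ^ n" using sp(1)[of n] v0[of n] by (simp add: divide_le_eq)
      finally show ?thesis by (simp add: u_def)
    qed
    show "cmod (\<Lambda> n (comp_op \<phi> (peak (x m)))) \<le> \<eta>\<^sup>2 / 8 * (1/2) ^ m" if "n < m" for n m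
    proof -
      have "cmod (\<Lambda> n (u m)) \<le> (height (h m) * (h m)\<^sup>2 / (1 - \<rho> m)\<^sup>2) / v n"
      proof (rule bound)
        fix t
        \<comment> \<open>The earlier circle is mapped into radius \<open>\<rho> m\<close>, so the
          later peak is seen from a distance of at least \<open>1 - \<rho> m\<close>.\<close>
        have "1 - \<rho> m \<le> 1 - cmod (w n t)" using xs(5)[OF that, of t] by (simp add: w_def)
        also have "\<dots> \<le> cmod (1 - cnj (x m) * w n t)"
          unfolding cmod_cnj_swap[of "x m" "w n t"] by (rule one_minus_norm_le[OF less_imp_le[OF x1]])
        finally have "(1 - \<rho> m)\<^sup>2 \<le> (cmod (1 - cnj (x m) * w n t))\<^sup>2" using xs(4)[of m] by (intro power_mono) auto
        then have "bump (x m) (w n t) \<le> (h m)\<^sup>2 / (1 - \<rho> m)\<^sup>2"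
          unfolding bump_def h_def using xs(4)[of m] by (intro divide_left_mono mult_pos_pos zero_less_power cmod_one_minus_pos x1 w1) auto
        then have "bump (x m) (w n t) * height (h m) \<le> (h m)\<^sup>2 / (1 - \<rho> m)\<^sup>2 * height (h m)"
          using height(1)[OF h[of m]] by (intro mult_right_mono) auto
        then show "bump (x m) (w n t) * height (h m) \<le> height (h m) * (h m)\<^sup>2 / (1 - \<rho> m)\<^sup>2" by (simp add: mult.commute)
      qed
      also have "\<dots> \<le> (\<eta>\<^sup>2 / 8 * (1/2) ^ m) / 1" by (intro frac_le sp) auto
      finally show ?thesis by (simp add: u_def)
    qed
  qed (use x1 xs in auto)
  then show ?thesis by (rule that)
qed

lemma compact_imp_level_small:
  assumes comp: "comp_op_compact \<Psi> \<phi>" and \<eta>: "\<eta> > 0"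
  shows "\<exists>h0>0. \<forall>x r. big_level \<eta> x r \<longrightarrow> h0 \<le> 1 - cmod x"
proof (rule ccontr)
  assume "\<not> ?thesis"
  then have bad: "\<exists>x r. big_level \<eta> x r \<and> 1 - cmod x < h0" if "h0 > 0" for h0
    using that by (meson not_le)
  obtain K where K: "compactin (ho_norm_topology \<Psi>) K" "comp_op \<phi> ` ho_unit_ball \<Psi> \<subseteq> K"
    and self_hardy: "comp_op \<phi> ` hardy_orlicz \<Psi> \<subseteq> hardy_orlicz \<Psi>"
    using comp unfolding comp_op_compact_def by blast
  \<comment> \<open>The peaks are used one at a time and never summed, so no growth condition is
    imposed and \<open>D\<close> is 0.\<close>
  obtain x S \<rho> \<Lambda> where "almost_biorthogonal \<eta> (\<lambda>_. 0) x S \<rho> \<Lambda>"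
    by (rule biorthogonal_sequence[OF \<eta> tendsto_const[of 0] bad self_hardy])
  note b = almost_biorthogonalD[OF this]
  have half: "\<eta>\<^sup>2 / 8 * (1/2) ^ n \<le> \<eta>\<^sup>2 / 8" for n
    by (intro mult_right_le_one_le power_le_one) auto
  show False
  proof (rule norm_compact_contradiction[OF K(1) _ b(4,5), where c = "\<eta>\<^sup>2 / 8"])
    show "comp_op \<phi> (peak (x n)) \<in> K" for n using K(2) peak_unit_ball[OF b(1)] by auto
    show "8 * (\<eta>\<^sup>2 / 8) \<le> cmod (\<Lambda> n (comp_op \<phi> (peak (x n))))" for n using b(6)[of n] by simp
    show "cmod (\<Lambda> n (comp_op \<phi> (peak (x m)))) \<le> \<eta>\<^sup>2 / 8" if "n \<noteq> m" for n m
    proof (cases "n < m")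
      case True
      with b(8)[OF True] half[of m] show ?thesis by linarith
    next
      case False
      then have "cmod (\<Lambda> n (comp_op \<phi> (peak (x m)))) \<le> (\<Sum>m<n. cmod (\<Lambda> n (comp_op \<phi> (peak (x m)))))"
        using that by (intro member_le_sum[where f = "\<lambda>m. cmod (\<Lambda> n (comp_op \<phi> (peak (x m))))"]) auto
      with b(7)[of n] half[of n] show ?thesis by linarith
    qed
  qed (use \<eta> in auto)
qed

text \<open>On integrating the pointwise bound, each bump turns into at most \<open>h k\<close>, and
  the last two clauses of \<open>sparse\<close> bound the k-th term by (1/2)^k / 4. These terms add
  up to at most 1/2, and with the constant 1/2 the modular is at most 1 for every
  \<open>N\<close>.\<close>

lemma peak_sum_unit_ball:
  assumes \<beta>: "\<beta> > 1" and B: "B \<ge> 2 * \<beta>" "B \<ge> 4 * \<Psi> 1" and x: "\<And>n. cmod (x n) < 1"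
    and sparse: "\<And>n. sparse \<eta> (\<lambda>h. h * \<Psi> (height h / \<beta>)) n (S n) (\<rho> n) (1 - cmod (x n))"
    and S: "\<And>n. (\<Sum>k<n. height (1 - cmod (x k))) \<le> S n"
  shows "(\<lambda>z. \<Sum>k<N. of_real (1 / B) * peak (x k) z) \<in> ho_unit_ball \<Psi>"
proof -
  define h where "h = (\<lambda>n. 1 - cmod (x n))"
  have h: "h n > 0" for n using x by (simp add: h_def)
  define q where "q = (\<lambda>k. 2 ^ k * height (h k) * \<Psi> (S k + 2) + \<Psi> (height (h k) / \<beta>))"
  let ?f = "\<lambda>z. \<Sum>k<N. of_real (1 / B) * peak (x k) z"
  have B0: "B > 0" using B \<beta> by linarith
  have q0: "q k \<ge> 0" for k
  proof -
    have "0 \<le> (\<Sum>j<k. height (1 - cmod (x j)))" using height(1)[OF h] by (intro sum_nonneg) (simp add: h_def less_imp_le)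
    then have "S k \<ge> 0" using S[of k] by linarith
    then show ?thesis unfolding q_def using height(1)[OF h[of k]] \<beta> by (intro add_nonneg_nonneg mult_nonneg_nonneg nonneg) auto
  qed
  have hol: "?f holomorphic_on ball 0 1" by (intro holomorphic_intros peak_holomorphic x)
  have "(\<integral>t. \<Psi> (cmod (?f (of_real r * cis t)) / 1) \<partial>circ) \<le> 1" if r: "0 \<le> r" "r < 1" for r :: real
  proof -
    have ib: "integrable circ (\<lambda>t. bump (x k) (of_real r * cis t))" for k
      by (intro integrable_circ_continuous continuous_bump_comp continuous_intros x) (use r in \<open>simp add: norm_mult\<close>)
    have "(\<integral>t. \<Psi> (cmod (?f (of_real r * cis t)) / 1) \<partial>circ) \<le> (\<integral>t. 1/2 + (\<Sum>k<N. bump (x k) (of_real r * cis t) * q k) \<partial>circ)"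
    proof (rule integral_mono)
      show "integrable circ (\<lambda>t. \<Psi> (cmod (?f (of_real r * cis t)) / 1))"
        by (intro integrable_circ_continuous continuous_on_modular hol r) simp
      show "integrable circ (\<lambda>t. 1/2 + (\<Sum>k<N. bump (x k) (of_real r * cis t) * q k))"
        using ib by simp
      fix t
      let ?b = "\<lambda>k. bump (x k) (of_real r * cis t)"
      have "cmod (?f (of_real r * cis t)) \<le> (\<Sum>k<N. (1 / B) * (height (h k) * ?b k))"
        using B0 by (intro order_trans[OF norm_sum] sum_mono) (simp add: norm_mult norm_divide cmod_peak[OF x] h_def)
      also have "\<dots> = ((\<Sum>k<N. height (h k) * ?b k) + 0) / B" by (simp add: sum_divide_distrib)
      finally have "\<Psi> (cmod (?f (of_real r * cis t)) / 1) \<le> \<Psi> (((\<Sum>k<N. height (h k) * ?b k) + 0) / B)"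
        by (intro mono) auto
      also have "\<dots> \<le> 1/2 + (\<Sum>k<N. ?b k * q k)"
        unfolding q_def
        by (rule lacunary_sum_modular[OF \<beta> B])
           (use height(1)[OF h] S r in \<open>auto simp: h_def norm_mult intro!: bump_nonneg bump_le_1 x\<close>)
      finally show "\<Psi> (cmod (?f (of_real r * cis t)) / 1) \<le> 1/2 + (\<Sum>k<N. ?b k * q k)" .
    qed
    also have "\<dots> = 1/2 + (\<Sum>k<N. (\<integral>t. bump (x k) (of_real r * cis t) \<partial>circ) * q k)"
      using ib by (simp add: Bochner_Integration.integral_sum)
    also have "\<dots> \<le> 1/2 + (\<Sum>k<N. (1/2) ^ k / 4)"
    proof (intro add_left_mono sum_mono)
      fix k
      have "(\<integral>t. bump (x k) (of_real r * cis t) \<partial>circ) * q k \<le> h k * q k"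
        unfolding h_def by (intro mult_right_mono mean_bump_le x r q0)
      also have "\<dots> = 2 ^ k * (height (h k) * h k) * \<Psi> (S k + 2) + h k * \<Psi> (height (h k) / \<beta>)"
        by (simp add: q_def algebra_simps)
      also have "\<dots> \<le> (1/2) ^ k / 8 + (1/2) ^ k / 8"
        using sparse[of k] unfolding sparse_def h_def by (intro add_mono) blast+
      finally show "(\<integral>t. bump (x k) (of_real r * cis t) \<partial>circ) * q k \<le> (1/2) ^ k / 4" by simp
    qed
    also have "\<dots> = 1/2 + (\<Sum>k<N. (1/2) ^ k) / 4" by (simp add: sum_divide_distrib)
    also have "\<dots> \<le> 1" using sum_half_powers_le[of "{..<N}" N] by simp
    finally show ?thesis .
  qed
  from hardy_normI[OF hol zero_less_one this] show ?thesis by (simp add: ho_unit_ball_def)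
qed

text \<open>With \<open>a = height h / \<beta>\<close> the expression equals
  \<open>\<Psi> a / \<Psi> (\<beta> * a)\<close>, because \<open>\<Psi> (height h) = 1 / h\<close>.
  This is where the growth condition enters.\<close>

lemma delta0_imp_tendsto:
  assumes \<beta>: "\<beta> > 1" and lim: "filterlim (\<lambda>x. \<Psi> (\<beta> * x) / \<Psi> x) at_top at_top"
  shows "((\<lambda>h. h * \<Psi> (height h / \<beta>)) \<longlongrightarrow> 0) (at_right 0)"
proof -
  have "filterlim (\<lambda>h. height h / \<beta>) at_top (at_right 0)"
    using filterlim_tendsto_pos_mult_at_top[OF tendsto_const[of "1 / \<beta>"] _ height_at_top] \<beta> by simp
  then have "filterlim (\<lambda>h. \<Psi> (\<beta> * (height h / \<beta>)) / \<Psi> (height h / \<beta>)) at_top (at_right 0)"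
    by (rule filterlim_compose[OF lim])
  then have "((\<lambda>h. inverse (\<Psi> (\<beta> * (height h / \<beta>)) / \<Psi> (height h / \<beta>))) \<longlongrightarrow> 0) (at_right 0)"
    by (rule tendsto_inverse_0_at_top)
  moreover have "\<forall>\<^sub>F h in at_right 0. inverse (\<Psi> (\<beta> * (height h / \<beta>)) / \<Psi> (height h / \<beta>)) = h * \<Psi> (height h / \<beta>)"
    using eventually_at_right_less[of 0] by eventually_elim (use \<beta> in \<open>simp add: height\<close>)
  ultimately show ?thesis using tendsto_cong by fast
qed

text \<open>The partial sums \<open>V N\<close> stay in \<open>K\<close>. The functional
  \<open>\<Lambda> n\<close> is bounded away from 0 on them as long as \<open>n < N\<close> and
  nearly vanishes from \<open>N\<close> on, which excludes weak compactness.\<close>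

lemma weakly_compact_imp_level_small:
  assumes "delta0 \<Psi>" and comp: "comp_op_weakly_compact \<Psi> \<phi>" and \<eta>: "\<eta> > 0"
  shows "\<exists>h0>0. \<forall>x r. big_level \<eta> x r \<longrightarrow> h0 \<le> 1 - cmod x"
proof (rule ccontr)
  assume "\<not> ?thesis"
  then have bad: "\<exists>x r. big_level \<eta> x r \<and> 1 - cmod x < h0" if "h0 > 0" for h0
    using that by (meson not_le)
  obtain \<beta> where \<beta>: "\<beta> > 1" "filterlim (\<lambda>x. \<Psi> (\<beta> * x) / \<Psi> x) at_top at_top"
    using assms(1) unfolding delta0_def by blast
  obtain K where K: "compactin (ho_weak_topology \<Psi>) K" "comp_op \<phi> ` ho_unit_ball \<Psi> \<subseteq> K"
    and self_hardy: "comp_op \<phi> ` hardy_orlicz \<Psi> \<subseteq> hardy_orlicz \<Psi>"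
    using comp unfolding comp_op_weakly_compact_def by blast
  obtain x S \<rho> \<Lambda> where "almost_biorthogonal \<eta> (\<lambda>h. h * \<Psi> (height h / \<beta>)) x S \<rho> \<Lambda>"
    by (rule biorthogonal_sequence[OF \<eta> delta0_imp_tendsto[OF \<beta>] bad self_hardy])
  note b = almost_biorthogonalD[OF this]
  define u where "u = (\<lambda>n. comp_op \<phi> (peak (x n)))"
  have uH: "u n \<in> hardy_orlicz \<Psi>" for n
    using self_hardy peak_unit_ball[OF b(1)[of n]] by (auto simp: u_def ho_unit_ball_def)
  define \<delta> where "\<delta> = \<eta>\<^sup>2 / 8"
  have \<delta>: "\<delta> > 0" using \<eta> by (simp add: \<delta>_def)
  have b': "\<And>n. \<eta>\<^sup>2 \<le> cmod (\<Lambda> n (u n))" "\<And>n. (\<Sum>m<n. cmod (\<Lambda> n (u m))) \<le> \<delta> * (1/2) ^ n"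
    "\<And>n m. n < m \<Longrightarrow> cmod (\<Lambda> n (u m)) \<le> \<delta> * (1/2) ^ m"
    unfolding u_def \<delta>_def by (fact b(6-8))+
  define B where "B = 2 * \<beta> + 4 * \<Psi> 1"
  have "\<Psi> 1 \<ge> 0" by (rule nonneg) simp
  then have B: "B \<ge> 2 * \<beta>" "B \<ge> 4 * \<Psi> 1" "B > 0" using \<beta>(1) by (auto simp: B_def)
  define V where "V = (\<lambda>N z. \<Sum>k<N. of_real (1 / B) * u k z)"
  have VK: "V N \<in> K" for N
  proof -
    have "V N = comp_op \<phi> (\<lambda>z. \<Sum>k<N. of_real (1 / B) * peak (x k) z)"
      by (simp add: V_def u_def comp_op_def fun_eq_iff)
    then show ?thesis using K(2) peak_sum_unit_ball[OF \<beta>(1) B(1,2) b(1-3)] by auto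
  qed
  have \<Lambda>V: "\<Lambda> n (V N) = of_real (1 / B) * (\<Sum>k<N. \<Lambda> n (u k))" for n N
  proof (induction N)
    case 0
    have "cmod (\<Lambda> n (\<lambda>z. 0)) \<le> 2 * hardy_orlicz_norm \<Psi> (\<lambda>z. 0)" by (rule b(4)[OF hardy_zero])
    then show ?case by (simp add: V_def norm_zero)
  next
    case (Suc N)
    have "V N \<in> hardy_orlicz \<Psi>" unfolding V_def by (intro hardy_sum hardy_cmult(1) uH) auto
    from b(5)[OF this uH[of N], of n 1 "of_real (1 / B)"] Suc.IH
    show ?case by (simp add: V_def distrib_left)
  qed
  have half: "\<delta> * (1/2) ^ n \<le> \<delta>" for n
    using \<delta> by (intro mult_right_le_one_le power_le_one) auto
  show False
  \<comment> \<open>Up to the factor \<open>1 / B\<close>, the diagonal value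
    \<open>8 * \<delta>\<close> loses at most \<open>\<delta>\<close> to the earlier peaks and
    \<open>2 * \<delta>\<close> to the later ones, leaving \<open>5 * \<delta>\<close>.\<close>
  proof (rule weakly_compact_contradiction[OF K(1) VK b(4,5), where c = "5 * \<delta> / B"])
    show "5 * \<delta> / B > 0" using \<delta> B by simp
    show "5 * \<delta> / B \<le> cmod (\<Lambda> n (V N))" if n: "n < N" for n N
    proof -
      have split: "{..<N} = insert n ({..<n} \<union> {Suc n..<N})" using n by auto
      have sum: "(\<Sum>k<N. \<Lambda> n (u k)) = \<Lambda> n (u n) + ((\<Sum>k<n. \<Lambda> n (u k)) + (\<Sum>k\<in>{Suc n..<N}. \<Lambda> n (u k)))"
        unfolding split by (subst sum.insert) (auto intro!: sum.union_disjoint)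
      have "cmod (\<Sum>k<n. \<Lambda> n (u k)) \<le> \<delta>"
        using norm_sum[of "\<lambda>k. \<Lambda> n (u k)" "{..<n}"] b'(2)[of n] half[of n] by linarith
      moreover have "cmod (\<Sum>k\<in>{Suc n..<N}. \<Lambda> n (u k)) \<le> \<delta> * 2"
      proof -
        have "cmod (\<Sum>k\<in>{Suc n..<N}. \<Lambda> n (u k)) \<le> (\<Sum>k\<in>{Suc n..<N}. \<delta> * (1/2) ^ k)"
          by (intro order_trans[OF norm_sum] sum_mono b'(3)) auto
        also have "\<dots> = \<delta> * (\<Sum>k\<in>{Suc n..<N}. (1/2) ^ k)" by (rule sum_distrib_left[symmetric])
        also have "\<dots> \<le> \<delta> * 2" using \<delta> by (intro mult_left_mono sum_half_powers_le[of _ N]) auto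
        finally show ?thesis .
      qed
      moreover have "8 * \<delta> \<le> cmod (\<Lambda> n (u n))" using b'(1)[of n] by (simp add: \<delta>_def)
      ultimately have "5 * \<delta> \<le> cmod (\<Sum>k<N. \<Lambda> n (u k))"
        using norm_triangle_ineq2[of "\<Lambda> n (u n)" "- ((\<Sum>k<n. \<Lambda> n (u k)) + (\<Sum>k\<in>{Suc n..<N}. \<Lambda> n (u k)))"]
          norm_triangle_ineq[of "\<Sum>k<n. \<Lambda> n (u k)" "\<Sum>k\<in>{Suc n..<N}. \<Lambda> n (u k)"]
        unfolding sum minus_minus diff_minus_eq_add norm_minus_cancel by linarith
      then show ?thesis using B by (simp add: \<Lambda>V norm_mult norm_divide divide_right_mono)
    qed
    show "(\<lambda>n. \<Lambda> n (V N)) \<longlonglongrightarrow> 0" for N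
    proof (rule Lim_null_comparison)
      have "(\<lambda>n. (1 / B) * (\<delta> * (1/2) ^ n)) \<longlonglongrightarrow> (1 / B) * (\<delta> * 0)"
        by (intro tendsto_intros LIMSEQ_realpow_zero) auto
      then show "(\<lambda>n. (1 / B) * (\<delta> * (1/2) ^ n)) \<longlonglongrightarrow> 0" by simp
      show "\<forall>\<^sub>F n in sequentially. cmod (\<Lambda> n (V N)) \<le> (1 / B) * (\<delta> * (1/2) ^ n)"
        using eventually_ge_at_top[of N]
      proof eventually_elim
        case (elim n)
        have "cmod (\<Sum>k<N. \<Lambda> n (u k)) \<le> (\<Sum>k<N. cmod (\<Lambda> n (u k)))" by (rule norm_sum)
        also have "\<dots> \<le> (\<Sum>k<n. cmod (\<Lambda> n (u k)))" using elim by (intro sum_mono2) auto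
        also have "\<dots> \<le> \<delta> * (1/2) ^ n" by (rule b'(2))
        finally have "cmod (\<Sum>k<N. \<Lambda> n (u k)) \<le> \<delta> * (1/2) ^ n" .
        then have "(1 / B) * cmod (\<Sum>k<N. \<Lambda> n (u k)) \<le> (1 / B) * (\<delta> * (1/2) ^ n)"
          using B by (intro mult_left_mono) auto
        then show ?case using B by (simp add: \<Lambda>V norm_mult norm_divide)
      qed
    qed
  qed
qed

text \<open>The radius serves as the index of the family in \<open>mean_bump_vanishing\<close>,
  which makes the estimate uniform over circles. Since \<open>1 - (cmod x)\<^sup>2\<close> is at
  most twice \<open>1 - cmod x\<close>, an o(h) mean of the bump is an o(1) mean of
  \<open>kern\<close>.\<close>

lemma kern_vanishing:
  assumes level: "\<And>\<eta>. \<eta> > 0 \<Longrightarrow> \<exists>h0>0. \<forall>x r. big_level \<eta> x r \<longrightarrow> h0 \<le> 1 - cmod x" and \<epsilon>: "\<epsilon> > 0"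
  shows "\<exists>\<rho><1. \<forall>x r. \<rho> < cmod x \<longrightarrow> cmod x < 1 \<longrightarrow> 0 \<le> r \<longrightarrow> r < 1 \<longrightarrow>
      (\<integral>\<^sup>+t. ennreal (kern x (\<phi> (of_real r * cis t))) \<partial>circ) \<le> ennreal \<epsilon>"
proof -
  have w1: "cmod (\<phi> (of_real r * cis t)) < 1" if "r \<in> {0..<1}" for r t
    using that by (intro cmod_lt_1) (simp add: norm_mult)
  have wc: "continuous_on UNIV (\<lambda>t. \<phi> (of_real r * cis t))" if "r \<in> {0..<1}" for r
    using continuous_circle that by simp
  have "\<exists>h0>0. \<forall>x r. r \<in> {0..<1} \<longrightarrow> cmod x < 1 \<longrightarrow> 1 - cmod x < h0 \<longrightarrow>
        (\<integral>t. bump x (\<phi> (of_real r * cis t)) \<partial>circ) \<le> \<epsilon> / 2 * (1 - cmod x)"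
  proof (rule mean_bump_vanishing)
    fix \<eta> :: real assume "\<eta> > 0"
    then obtain h0 where h0: "h0 > 0" "\<And>x r. big_level \<eta> x r \<Longrightarrow> h0 \<le> 1 - cmod x" using level by blast
    then show "\<exists>h0>0. \<forall>x r. r \<in> {0..<1} \<longrightarrow> cmod x < 1 \<longrightarrow> 1 - cmod x < h0 \<longrightarrow>
        measure circ {t. \<eta> \<le> bump x (\<phi> (of_real r * cis t))} \<le> \<eta> * (1 - cmod x)"
      unfolding big_level_def by (intro exI[of _ h0]) (fastforce simp: not_less)
  qed (use w1 wc \<epsilon> in auto)
  then obtain h0 where h0: "h0 > 0" "\<And>x r. 0 \<le> r \<Longrightarrow> r < 1 \<Longrightarrow> cmod x < 1 \<Longrightarrow> 1 - cmod x < h0 \<Longrightarrow>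
        (\<integral>t. bump x (\<phi> (of_real r * cis t)) \<partial>circ) \<le> \<epsilon> / 2 * (1 - cmod x)"
    by auto
  have "(\<integral>\<^sup>+t. ennreal (kern x (\<phi> (of_real r * cis t))) \<partial>circ) \<le> ennreal \<epsilon>"
    if x: "1 - h0 < cmod x" "cmod x < 1" and r: "0 \<le> r" "r < 1" for x r
  proof -
    let ?h = "1 - cmod x"
    have i: "integrable circ (\<lambda>t. 2 / ?h * bump x (\<phi> (of_real r * cis t)))"
      by (intro integrable_circ_continuous continuous_intros continuous_bump_comp wc w1 x) (use r in auto)
    have pt: "kern x s \<le> 2 / ?h * bump x s" for s
    proof -
      have "(1 - (cmod x)\<^sup>2) = ?h * (1 + cmod x)" by (simp add: power2_eq_square algebra_simps)
      also have "\<dots> \<le> ?h * 2" using x by (intro mult_left_mono) auto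
      also have "\<dots> = 2 / ?h * ?h\<^sup>2" using x by (simp add: power2_eq_square)
      finally have "(1 - (cmod x)\<^sup>2) / (cmod (1 - cnj x * s))\<^sup>2 \<le> 2 / ?h * ?h\<^sup>2 / (cmod (1 - cnj x * s))\<^sup>2"
        by (rule divide_right_mono) simp
      then show ?thesis unfolding kern_def bump_def times_divide_eq_right .
    qed
    have "(\<integral>\<^sup>+t. ennreal (kern x (\<phi> (of_real r * cis t))) \<partial>circ) \<le> (\<integral>\<^sup>+t. ennreal (2 / ?h * bump x (\<phi> (of_real r * cis t))) \<partial>circ)"
      by (intro nn_integral_mono ennreal_leI pt)
    also have "\<dots> = ennreal (\<integral>t. 2 / ?h * bump x (\<phi> (of_real r * cis t)) \<partial>circ)"
      by (rule nn_integral_eq_integral[OF i]) (use x bump_nonneg in \<open>auto simp: divide_nonneg_pos\<close>)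
    also have "\<dots> = ennreal (2 / ?h * (\<integral>t. bump x (\<phi> (of_real r * cis t)) \<partial>circ))" by simp
    also have "\<dots> \<le> ennreal (2 / ?h * (\<epsilon> / 2 * ?h))"
      using x by (intro ennreal_leI mult_left_mono h0(2) r) auto
    also have "2 / ?h * (\<epsilon> / 2 * ?h) = \<epsilon>" using x by simp
    finally show ?thesis .
  qed
  with h0(1) show ?thesis by (intro exI[of _ "1 - h0"]) auto
qed

end

theorem mainTheorem4:
  fixes \<Psi> :: "real \<Rightarrow> real" and \<phi> :: "complex \<Rightarrow> complex"
  assumes "orlicz_function \<Psi>"
    and "\<phi> holomorphic_on ball 0 1" and "\<phi> ` ball 0 1 \<subseteq> ball 0 1"
    and "comp_op_compact \<Psi> \<phi> \<or> (delta0 \<Psi> \<and> comp_op_weakly_compact \<Psi> \<phi>)"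
  shows "comp_op_compact (\<lambda>x. x ^ 2) \<phi>"
proof -
  interpret orlicz_self_map \<Psi> \<phi>
    by standard (fact assms)+
  have "\<exists>h0>0. \<forall>x r. big_level \<eta> x r \<longrightarrow> h0 \<le> 1 - cmod x" if "\<eta> > 0" for \<eta>
    using assms(4) compact_imp_level_small weakly_compact_imp_level_small that by blast
  from H2_comp_op_compact[OF kern_vanishing[OF this]] show ?thesis by blast
qed

end
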